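(* Let $\mathcal{K}:H^1_0(\Omega)\to H^{-1}(\Omega)$ be any compact linear operator. Then the following statements (i)–(ii) hold: (i) For all $0<\theta\le1$ and $C_{\rm mark}\ge1$, there exist $\ell_0\in\mathbb{N}_0$, $C_{\rm lin}>0$, and $0<q_{\rm lin}<1$ such that Algorithm A guarantees that, for all $\ell,n\in\mathbb{N}_0$ with $n\ge\ell\ge\ell_0$, $$\eta_n(u_n)\big[\eta_n(u_n)^2+\zeta_n(z_n[u_n])^2\big]^{1/2}\le C_{\rm lin}\,q_{\rm lin}^{\,n-\ell}\,\eta_\ell(u_\ell)\big[\eta_\ell(u_\ell)^2+\zeta_\ell(z_\ell[u_\ell])^2\big]^{1/2}.$$ (ii) There exist $C_{\rm opt}>0$ and $\ell_0\in\mathbb{N}_0$ such that Algorithm A guarantees that, for all $0<\theta<\theta_{\rm opt}:=(1+C_{\rm stab}^2C_{\rm drel}^2)^{-1}$, for all $s,t>0$ with $\|u\|_{\mathbb{A}_s}+\|z[u]\|_{\mathbb{A}_t}<\infty$, and all $\ell\in\mathbb{N}_0$ with $\ell\ge\ell_0$, it holds that $$\eta_\ell(u_\ell)\big[\eta_\ell(u_\ell)^2+\zeta_\ell(z_\ell[u_\ell])^2\big]^{1/2}\le C_{\rm opt}\,\|u\|_{\mathbb{A}_s}\big(\|u\|_{\mathbb{A}_s}+\|z[u]\|_{\mathbb{A}_t}\big)(\#\mathcal{T}_\ell-\#\mathcal{T}_0)^{-\alpha},$$ where $\alpha:=\min\{2s,s+t\}$. The constants $C_{\rm lin}$, $q_{\rm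 lin}$, and $\ell_0$ depend only on $\theta$, $q_{\rm red}$, $C_{\rm stab}$, $C_{\rm rel}$, the bilinear form $a(\cdot,\cdot)$, and the compact operator $\mathcal{K}$. The constant $C_{\rm opt}$ depends only on $\theta$, $C_{\rm mesh}$, $C_{\rm mark}$, $C_{\rm lin}$, $q_{\rm lin}$, $\ell_0$, and (A1)–(A4).
   Context: **Model problem.** $\Omega\subset\mathbb{R}^d$, $d\ge2$, is a bounded Lipschitz domain; $f\in L^2(\Omega)$, $\boldsymbol{f}\in[L^2(\Omega)]^d$; $\boldsymbol{A},\boldsymbol{b},c\in L^\infty(\Omega)$ with $\boldsymbol{A}(x)\in\mathbb{R}^{d\times d}$ symmetric and uniformly positive definite, $\boldsymbol{b}(x)\in\mathbb{R}^d$, $c(x)\in\mathbb{R}$. Set $a(u,v):=\int_\Omega \boldsymbol{A}\nabla u\cdot\nabla v\,dx+\int_\Omega \boldsymbol{b}\cdot\nabla u\,v\,dx+\int_\Omega cuv\,dx$, assumed continuous and elliptic on $H^1_0(\Omega)$ (i.e., $a(v,v)\ge C_{\rm ell}\|v\|_{H^1(\Omega)}^2$ with $C_{\rm ell}>0$), and $F(v):=\int_\Omega fv\,dx-\int_\Omega\boldsymbol{f}\cdot\nabla v\,dx$. The energy norm is $|\!|\!|v|\!|\!|^2:=\int_\Omega\boldsymbol{A}\nabla v\cdot\nabla v\,dx$, an equivalent norm on $H^1_0(\Omega)$. For a bounded linear operator $\mathcal{K}:H^1_0(\Omega)\to H^{-1}(\Omega):=H^1_0(\Omega)'$, set $b(v,w):=\langle\mathcal{K}v,w\rangle_{H^{-1}\times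 H^1_0}$. The primal solution $u\in H^1_0(\Omega)$ solves $a(u,v)=F(v)$ for all $v\in H^1_0(\Omega)$. For $w\in H^1_0(\Omega)$, the dual solution $z[w]\in H^1_0(\Omega)$ solves $a(v,z[w])=b(v,w)+b(w,v)$ for all $v\in H^1_0(\Omega)$. **Discretization.** For a conforming triangulation $\mathcal{T}_H$ of $\Omega$ into compact simplices and a fixed polynomial degree $p\ge1$, $\mathcal{X}_H:=\{v_H\in H^1_0(\Omega): v_H|_T\text{ is a polynomial of degree}\le p\text{ for all }T\in\mathcal{T}_H\}$. The discrete solutions $u_H,z_H[w]\in\mathcal{X}_H$ solve $a(u_H,v_H)=F(v_H)$ and $a(v_H,z_H[w])=b(v_H,w)+b(w,v_H)$ for all $v_H\in\mathcal{X}_H$. Quantities with index $h$, $\ell$, etc. are associated in the same way with $\mathcal{T}_h$, $\mathcal{T}_\ell$, etc. **Mesh refinement.** $\mathcal{T}_0$ is a fixed initial conforming triangulation. A fixed deterministic refinement strategy (e.g., newest vertex bisection) is given: for a triangulation $\mathcal{T}_H$ and marked elements $\mathcal{M}_H\subseteq\mathcal{T}_H$, $\mathtt{refine}(\mathcal{T}_H,\mathcal{M}_H)$ is the coarsest triangulation $\mathcal{T}_h$ in which all $T\in\mathcal{M}_H$ have been refined, i.e., $\mathcal{M}_H\subseteq\mathcal{T}_H\setminus\mathcal{T}_h$. Write $\mathcal{T}_h\in\mathbb{T}(\mathcal{T}_H)$ if $\mathcal{T}_h$ is obtained from $\mathcal{T}_H$ by finitely many refinement steps, and $\mathbb{T}:=\mathbb{T}(\mathcal{T}_0)$.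 If $\mathcal{T}_h\in\mathbb{T}(\mathcal{T}_H)$, then $\mathcal{X}_H\subseteq\mathcal{X}_h$. Assumptions: (a) $\#(\mathcal{T}_H\setminus\mathcal{T}_h)+\#\mathcal{T}_H\le\#\mathcal{T}_h$ for all $\mathcal{T}_H\in\mathbb{T}$, $\mathcal{T}_h\in\mathbb{T}(\mathcal{T}_H)$; (b) if $\mathcal{T}_{j+1}=\mathtt{refine}(\mathcal{T}_j,\mathcal{M}_j)$ for all $j$, then $\#\mathcal{T}_\ell-\#\mathcal{T}_0\le C_{\rm mesh}\sum_{j=0}^{\ell-1}\#\mathcal{M}_j$ for all $\ell\in\mathbb{N}$, with $C_{\rm mesh}>0$ depending only on $\mathcal{T}_0$; (c) all $\mathcal{T}_H,\mathcal{T}_h\in\mathbb{T}$ have a common refinement $\mathcal{T}_H\oplus\mathcal{T}_h\in\mathbb{T}(\mathcal{T}_H)\cap\mathbb{T}(\mathcal{T}_h)$ with $\#(\mathcal{T}_H\oplus\mathcal{T}_h)\le\#\mathcal{T}_H+\#\mathcal{T}_h-\#\mathcal{T}_0$. **Error estimators.** For $\mathcal{T}_H\in\mathbb{T}$, $v_H\in\mathcal{X}_H$, $T\in\mathcal{T}_H$, refinement indicators $\eta_H(T,v_H)\ge0$ and $\zeta_H(T,v_H)\ge0$ are given. For $\mathcal{U}_H\subseteq\mathcal{T}_H$, $\eta_H(\mathcal{U}_H,v_H):=\big(\sum_{T\in\mathcal{U}_H}\eta_H(T,v_H)^2\big)^{1/2}$, $\eta_H(v_H):=\eta_H(\mathcal{T}_H,v_H)$,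 and analogously for $\zeta_H$. There are constants $C_{\rm stab},C_{\rm rel},C_{\rm drel}>0$ and $0<q_{\rm red}<1$ such that for all $\mathcal{T}_H\in\mathbb{T}$ and $\mathcal{T}_h\in\mathbb{T}(\mathcal{T}_H)$: (A1) stability: for all $v_h\in\mathcal{X}_h$, $v_H\in\mathcal{X}_H$, $\mathcal{U}_H\subseteq\mathcal{T}_h\cap\mathcal{T}_H$: $|\eta_h(\mathcal{U}_H,v_h)-\eta_H(\mathcal{U}_H,v_H)|+|\zeta_h(\mathcal{U}_H,v_h)-\zeta_H(\mathcal{U}_H,v_H)|\le C_{\rm stab}|\!|\!|v_h-v_H|\!|\!|$. (A2) reduction: for all $v_H\in\mathcal{X}_H$: $\eta_h(\mathcal{T}_h\setminus\mathcal{T}_H,v_H)\le q_{\rm red}\,\eta_H(\mathcal{T}_H\setminus\mathcal{T}_h,v_H)$ and $\zeta_h(\mathcal{T}_h\setminus\mathcal{T}_H,v_H)\le q_{\rm red}\,\zeta_H(\mathcal{T}_H\setminus\mathcal{T}_h,v_H)$. (A3) reliability: for all $w\in H^1_0(\Omega)$: $|\!|\!|u-u_H|\!|\!|\le C_{\rm rel}\,\eta_H(u_H)$ and $|\!|\!|z[w]-z_H[w]|\!|\!|\le C_{\rm rel}\,\zeta_H(z_H[w])$. (A4) discrete reliability: for all $w\in H^1_0(\Omega)$: $|\!|\!|u_h-u_H|\!|\!|\le C_{\rm drel}\,\eta_H(\mathcal{T}_H\setminus\mathcal{T}_h,u_H)$ and $|\!|\!|z_h[w]-z_H[w]|\!|\!|\le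 C_{\rm drel}\,\zeta_H(\mathcal{T}_H\setminus\mathcal{T}_h,z_H[w])$. Convention on constants: $C_{\rm stab},C_{\rm rel},C_{\rm drel}$ are taken large enough (depending additionally on $a(\cdot,\cdot)$ and the boundedness of $\mathcal{K}$) that they also satisfy the analogous properties of the combined estimator: $\big|[\eta_h(\mathcal{U}_H,v_h)^2+\zeta_h(\mathcal{U}_H,w_h)^2]^{1/2}-[\eta_H(\mathcal{U}_H,v_H)^2+\zeta_H(\mathcal{U}_H,w_H)^2]^{1/2}\big|\le C_{\rm stab}[|\!|\!|v_h-v_H|\!|\!|+|\!|\!|w_h-w_H|\!|\!|]$; $|\!|\!|u-u_H|\!|\!|+|\!|\!|z[u]-z_H[u_H]|\!|\!|+|\!|\!|z[u_H]-z_H[u_H]|\!|\!|\le C_{\rm rel}[\eta_H(u_H)^2+\zeta_H(z_H[u_H])^2]^{1/2}$; $|\!|\!|u_h-u_H|\!|\!|+|\!|\!|z_h[u_h]-z_H[u_H]|\!|\!|\le C_{\rm drel}[\eta_H(\mathcal{T}_H\setminus\mathcal{T}_h,u_H)^2+\zeta_H(\mathcal{T}_H\setminus\mathcal{T}_h,z_H[u_H])^2]^{1/2}$. **Approximation classes.** $\mathbb{T}_N:=\{\mathcal{T}\in\mathbb{T}:\#\mathcal{T}-\#\mathcal{T}_0\le N\}$ for $N\in\mathbb{N}_0$. For $s,t>0$: $\|u\|_{\mathbb{A}_s}:=\sup_{N\in\mathbb{N}_0}\big((N+1)^s\min_{\mathcal{T}_H\in\mathbb{T}_N}\eta_H(u_H)\big)$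 and $\|z[u]\|_{\mathbb{A}_t}:=\sup_{N\in\mathbb{N}_0}\big((N+1)^t\min_{\mathcal{T}_H\in\mathbb{T}_N}\zeta_H(z_H[u])\big)$, both in $[0,\infty]$. **Algorithm A.** Input: $0<\theta\le1$, $C_{\rm mark}\ge1$, $\mathcal{T}_0$. For $\ell=0,1,2,\dots$: (i) compute $u_\ell,z_\ell[u_\ell]\in\mathcal{X}_\ell$; (ii) compute $\eta_\ell(T,u_\ell)$, $\zeta_\ell(T,z_\ell[u_\ell])$ for all $T\in\mathcal{T}_\ell$; (iii) determine sets $\overline{\mathcal{M}}_\ell^u,\overline{\mathcal{M}}_\ell^{uz}\subseteq\mathcal{T}_\ell$ of, up to the multiplicative constant $C_{\rm mark}$, minimal cardinality such that $\theta\,\eta_\ell(u_\ell)^2\le\eta_\ell(\overline{\mathcal{M}}_\ell^u,u_\ell)^2$ and $\theta[\eta_\ell(u_\ell)^2+\zeta_\ell(z_\ell[u_\ell])^2]\le\eta_\ell(\overline{\mathcal{M}}_\ell^{uz},u_\ell)^2+\zeta_\ell(\overline{\mathcal{M}}_\ell^{uz},z_\ell[u_\ell])^2$; (iv) choose $\mathcal{M}_\ell^u\subseteq\overline{\mathcal{M}}_\ell^u$ and $\mathcal{M}_\ell^{uz}\subseteq\overline{\mathcal{M}}_\ell^{uz}$ with $\#\mathcal{M}_\ell^u=\#\mathcal{M}_\ell^{uz}=\min\{\#\overline{\mathcal{M}}_\ell^u,\#\overline{\mathcal{M}}_\ell^{uz}\}$; (v) set $\mathcal{M}_\ell:=\mathcal{M}_\ell^u\cup\mathcal{M}_\ell^{uz}$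 and $\mathcal{T}_{\ell+1}:=\mathtt{refine}(\mathcal{T}_\ell,\mathcal{M}_\ell)$.
   Formalization: In (ii), C_opt may depend on an arbitrary upper bound for s (one constant for all s > 0 is impossible in general); it is chosen after θ, C_mark, C_mesh and the constants of (A1)–(A4), for fixed Ω, a(·,·) and K. *)

theory Defs
  imports "HOL-Analysis.Analysis"
begin

text \<open>Elements of \<open>L\<^sup>2(\<Omega>)\<close>, \<open>H\<^sup>1(\<Omega>)\<close> and \<open>H\<^sup>1\<^sub>0(\<Omega>)\<close> are represented by functions on
  the whole space whose values outside \<open>\<Omega>\<close> and on null sets are irrelevant.\<close>

definition L2 :: "(real ^ 'n) set \<Rightarrow> (real ^ 'n \<Rightarrow> 'b::euclidean_space) set" where
  "L2 \<Omega> = {f \<in> borel_measurable (lebesgue_on \<Omega>). integrable (lebesgue_on \<Omega>) (\<lambda>x. (norm (f x))\<^sup>2)}"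

definition Linf :: "(real ^ 'n) set \<Rightarrow> (real ^ 'n \<Rightarrow> 'b::euclidean_space) set" where
  "Linf \<Omega> = {f \<in> borel_measurable (lebesgue_on \<Omega>). \<exists>B. AE x in lebesgue_on \<Omega>. norm (f x) \<le> B}"

definition partial_deriv :: "'n \<Rightarrow> (real ^ 'n \<Rightarrow> real) \<Rightarrow> real ^ 'n \<Rightarrow> real" where
  "partial_deriv i \<phi> x = frechet_derivative \<phi> (at x) (axis i 1)"

primrec C_k :: "nat \<Rightarrow> (real ^ 'n \<Rightarrow> real) \<Rightarrow> bool" where
  "C_k 0 \<phi> \<longleftrightarrow> continuous_on UNIV \<phi>"
| "C_k (Suc k) \<phi> \<longleftrightarrow> (\<forall>x. \<phi> differentiable (at x)) \<and> (\<forall>i. C_k k (partial_deriv i \<phi>))"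

definition test_functions :: "(real ^ 'n) set \<Rightarrow> (real ^ 'n \<Rightarrow> real) set" where
  "test_functions \<Omega> =
     {\<phi>. (\<forall>k. C_k k \<phi>) \<and> compact (closure {x. \<phi> x \<noteq> 0}) \<and> closure {x. \<phi> x \<noteq> 0} \<subseteq> \<Omega>}"

definition weak_gradient ::
  "(real ^ 'n) set \<Rightarrow> (real ^ 'n \<Rightarrow> real) \<Rightarrow> (real ^ 'n \<Rightarrow> real ^ 'n) \<Rightarrow> bool" where
  "weak_gradient \<Omega> v g \<longleftrightarrow> g \<in> L2 \<Omega> \<and>
     (\<forall>\<phi>\<in>test_functions \<Omega>. \<forall>i.
        (LINT x|lebesgue_on \<Omega>. v x * partial_deriv i \<phi> x) = - (LINT x|lebesgue_on \<Omega>. g x $ i * \<phi> x))"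

definition H1 :: "(real ^ 'n) set \<Rightarrow> (real ^ 'n \<Rightarrow> real) set" where
  "H1 \<Omega> = {v \<in> L2 \<Omega>. \<exists>g. weak_gradient \<Omega> v g}"

text \<open>The weak gradient is unique only up to null sets; \<open>grad\<close> picks a representative.\<close>

definition grad :: "(real ^ 'n) set \<Rightarrow> (real ^ 'n \<Rightarrow> real) \<Rightarrow> real ^ 'n \<Rightarrow> real ^ 'n" where
  "grad \<Omega> v = (SOME g. weak_gradient \<Omega> v g)"

definition H1_norm :: "(real ^ 'n) set \<Rightarrow> (real ^ 'n \<Rightarrow> real) \<Rightarrow> real" where
  "H1_norm \<Omega> v = sqrt ((LINT x|lebesgue_on \<Omega>. (v x)\<^sup>2) + (LINT x|lebesgue_on \<Omega>. (norm (grad \<Omega> v x))\<^sup>2))"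

definition H10 :: "(real ^ 'n) set \<Rightarrow> (real ^ 'n \<Rightarrow> real) set" where
  "H10 \<Omega> = {v \<in> H1 \<Omega>. \<exists>\<phi>. (\<forall>k. \<phi> k \<in> test_functions \<Omega>) \<and>
     (\<lambda>k. H1_norm \<Omega> (\<lambda>x. v x - \<phi> k x)) \<longlonglongrightarrow> 0}"

text \<open>Functionals on \<open>H\<^sup>1\<^sub>0(\<Omega>)\<close>; values at functions outside \<open>H10 \<Omega>\<close> are irrelevant.\<close>

definition Hm1 :: "(real ^ 'n) set \<Rightarrow> ((real ^ 'n \<Rightarrow> real) \<Rightarrow> real) set" where
  "Hm1 \<Omega> = {\<psi>.
     (\<forall>v\<in>H10 \<Omega>. \<forall>w\<in>H10 \<Omega>. \<psi> (\<lambda>x. v x + w x) = \<psi> v + \<psi> w) \<and>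
     (\<forall>r. \<forall>v\<in>H10 \<Omega>. \<psi> (\<lambda>x. r * v x) = r * \<psi> v) \<and>
     (\<exists>B. \<forall>v\<in>H10 \<Omega>. \<bar>\<psi> v\<bar> \<le> B * H1_norm \<Omega> v)}"

definition Hm1_norm :: "(real ^ 'n) set \<Rightarrow> ((real ^ 'n \<Rightarrow> real) \<Rightarrow> real) \<Rightarrow> real" where
  "Hm1_norm \<Omega> \<psi> = (SUP w\<in>{w \<in> H10 \<Omega>. H1_norm \<Omega> w \<le> 1}. \<bar>\<psi> w\<bar>)"

definition compact_linear_operator ::
  "(real ^ 'n) set \<Rightarrow> ((real ^ 'n \<Rightarrow> real) \<Rightarrow> (real ^ 'n \<Rightarrow> real) \<Rightarrow> real) \<Rightarrow> bool" where
  "compact_linear_operator \<Omega> K \<longleftrightarrow>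
     (\<forall>v\<in>H10 \<Omega>. K v \<in> Hm1 \<Omega>) \<and>
     (\<forall>v\<in>H10 \<Omega>. \<forall>v'\<in>H10 \<Omega>. \<forall>w\<in>H10 \<Omega>. K (\<lambda>x. v x + v' x) w = K v w + K v' w) \<and>
     (\<forall>r. \<forall>v\<in>H10 \<Omega>. \<forall>w\<in>H10 \<Omega>. K (\<lambda>x. r * v x) w = r * K v w) \<and>
     (\<forall>v. (\<forall>k. v k \<in> H10 \<Omega>) \<and> (\<exists>B. \<forall>k::nat. H1_norm \<Omega> (v k) \<le> B) \<longrightarrow>
        (\<exists>r \<psi>. strict_mono r \<and> \<psi> \<in> Hm1 \<Omega> \<and>
           (\<lambda>k. Hm1_norm \<Omega> (\<lambda>w. K (v (r k)) w - \<psi> w)) \<longlonglongrightarrow> 0))"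


text \<open>Near each boundary point, \<open>\<Omega>\<close> is the strict epigraph, in direction \<open>\<nu>\<close>, of a
  Lipschitz function on the hyperplane orthogonal to \<open>\<nu>\<close>.\<close>

definition lipschitz_domain :: "(real ^ 'n) set \<Rightarrow> bool" where
  "lipschitz_domain \<Omega> \<longleftrightarrow> open \<Omega> \<and> connected \<Omega> \<and> \<Omega> \<noteq> {} \<and>
     (\<forall>x\<in>frontier \<Omega>. \<exists>\<nu> \<gamma> L r. norm \<nu> = 1 \<and> 0 < r \<and> lipschitz_on L {y. y \<bullet> \<nu> = 0} \<gamma> \<and>
        \<Omega> \<inter> ball x r = {y \<in> ball x r. \<gamma> (y - (y \<bullet> \<nu>) *\<^sub>R \<nu>) < y \<bullet> \<nu>})"

definition a_form ::
  "(real ^ 'n) set \<Rightarrow> (real ^ 'n \<Rightarrow> real ^ 'n ^ 'n) \<Rightarrow> (real ^ 'n \<Rightarrow> real ^ 'n) \<Rightarrow> (real ^ 'n \<Rightarrow> real) \<Rightarrow>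
   (real ^ 'n \<Rightarrow> real) \<Rightarrow> (real ^ 'n \<Rightarrow> real) \<Rightarrow> real" where
  "a_form \<Omega> A b c u v =
     (LINT x|lebesgue_on \<Omega>. (A x *v grad \<Omega> u x) \<bullet> grad \<Omega> v x) +
     (LINT x|lebesgue_on \<Omega>. (b x \<bullet> grad \<Omega> u x) * v x) +
     (LINT x|lebesgue_on \<Omega>. c x * u x * v x)"

definition F_form ::
  "(real ^ 'n) set \<Rightarrow> (real ^ 'n \<Rightarrow> real) \<Rightarrow> (real ^ 'n \<Rightarrow> real ^ 'n) \<Rightarrow> (real ^ 'n \<Rightarrow> real) \<Rightarrow> real" where
  "F_form \<Omega> f ff v =
     (LINT x|lebesgue_on \<Omega>. f x * v x) - (LINT x|lebesgue_on \<Omega>. ff x \<bullet> grad \<Omega> v x)"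

definition energy_norm ::
  "(real ^ 'n) set \<Rightarrow> (real ^ 'n \<Rightarrow> real ^ 'n ^ 'n) \<Rightarrow> (real ^ 'n \<Rightarrow> real) \<Rightarrow> real" where
  "energy_norm \<Omega> A v = sqrt (LINT x|lebesgue_on \<Omega>. (A x *v grad \<Omega> v x) \<bullet> grad \<Omega> v x)"

definition model_problem ::
  "(real ^ 'n) set \<Rightarrow> (real ^ 'n \<Rightarrow> real ^ 'n ^ 'n) \<Rightarrow> (real ^ 'n \<Rightarrow> real ^ 'n) \<Rightarrow> (real ^ 'n \<Rightarrow> real) \<Rightarrow> bool"
  where
  "model_problem \<Omega> A b c \<longleftrightarrow>
     2 \<le> CARD('n) \<and> bounded \<Omega> \<and> lipschitz_domain \<Omega> \<and>
     A \<in> Linf \<Omega> \<and> b \<in> Linf \<Omega> \<and> c \<in> Linf \<Omega> \<and>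
     (AE x in lebesgue_on \<Omega>. transpose (A x) = A x) \<and>
     (\<exists>\<alpha>>0. AE x in lebesgue_on \<Omega>. \<forall>\<xi>. \<alpha> * (norm \<xi>)\<^sup>2 \<le> (A x *v \<xi>) \<bullet> \<xi>) \<and>
     (\<exists>B. \<forall>v\<in>H10 \<Omega>. \<forall>w\<in>H10 \<Omega>. \<bar>a_form \<Omega> A b c v w\<bar> \<le> B * H1_norm \<Omega> v * H1_norm \<Omega> w) \<and>
     (\<exists>Cell>0. \<forall>v\<in>H10 \<Omega>. Cell * (H1_norm \<Omega> v)\<^sup>2 \<le> a_form \<Omega> A b c v v)"


type_synonym 'n mesh = "(real ^ 'n) set set"

definition conforming_triangulation :: "(real ^ 'n) set \<Rightarrow> 'n mesh \<Rightarrow> bool" where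
  "conforming_triangulation \<Omega> \<T> \<longleftrightarrow>
     triangulation \<T> \<and> (\<forall>T\<in>\<T>. int CARD('n) simplex T) \<and> \<Union>\<T> = closure \<Omega>"

definition polynomials :: "nat \<Rightarrow> (real ^ 'n \<Rightarrow> real) set" where
  "polynomials p = {q. \<exists>k :: ('n \<Rightarrow> nat) \<Rightarrow> real. \<forall>x.
     q x = (\<Sum>\<alpha> | (\<Sum>i\<in>UNIV. \<alpha> i) \<le> p. k \<alpha> * (\<Prod>i\<in>UNIV. (x $ i) ^ \<alpha> i))}"

definition fe_space :: "(real ^ 'n) set \<Rightarrow> nat \<Rightarrow> 'n mesh \<Rightarrow> (real ^ 'n \<Rightarrow> real) set" where
  "fe_space \<Omega> p \<T> = {v \<in> H10 \<Omega>. \<forall>T\<in>\<T>. \<exists>q\<in>polynomials p. AE x in lebesgue_on (T \<inter> \<Omega>). v x = q x}"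

inductive_set refinements ::
  "('n mesh \<Rightarrow> 'n mesh \<Rightarrow> 'n mesh) \<Rightarrow> 'n mesh \<Rightarrow> 'n mesh set"
  for refine :: "'n mesh \<Rightarrow> 'n mesh \<Rightarrow> 'n mesh" and \<T> :: "'n mesh" where
  base: "\<T> \<in> refinements refine \<T>"
| step: "\<lbrakk>\<T>' \<in> refinements refine \<T>; \<M> \<subseteq> \<T>'\<rbrakk> \<Longrightarrow> refine \<T>' \<M> \<in> refinements refine \<T>"

text \<open>\<open>refine \<T>\<^sub>H \<M>\<close> is the coarsest refinement of \<open>\<T>\<^sub>H\<close> without the elements of \<open>\<M>\<close>: every refinement of
  \<open>\<T>\<^sub>H\<close> without these elements is a refinement of it.\<close>

definition refinement_strategy ::
  "(real ^ 'n) set \<Rightarrow> 'n mesh \<Rightarrow> ('n mesh \<Rightarrow> 'n mesh \<Rightarrow> 'n mesh) \<Rightarrow> bool" where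
  "refinement_strategy \<Omega> \<T>\<^sub>0 refine \<longleftrightarrow>
     conforming_triangulation \<Omega> \<T>\<^sub>0 \<and>
     (\<forall>\<T>\<^sub>H\<in>refinements refine \<T>\<^sub>0. \<forall>\<M>. \<M> \<subseteq> \<T>\<^sub>H \<longrightarrow>
        conforming_triangulation \<Omega> (refine \<T>\<^sub>H \<M>) \<and>
        (\<forall>T'\<in>refine \<T>\<^sub>H \<M>. \<exists>T\<in>\<T>\<^sub>H. T' \<subseteq> T) \<and>
        \<M> \<subseteq> \<T>\<^sub>H - refine \<T>\<^sub>H \<M> \<and>
        (\<forall>\<T>\<^sub>h\<in>refinements refine \<T>\<^sub>H. \<M> \<subseteq> \<T>\<^sub>H - \<T>\<^sub>h \<longrightarrow> \<T>\<^sub>h \<in> refinements refine (refine \<T>\<^sub>H \<M>)))"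

definition refinement_assumptions ::
  "'n mesh \<Rightarrow> ('n mesh \<Rightarrow> 'n mesh \<Rightarrow> 'n mesh) \<Rightarrow> real \<Rightarrow> bool" where
  "refinement_assumptions \<T>\<^sub>0 refine Cmesh \<longleftrightarrow>
     (\<forall>\<T>\<^sub>H\<in>refinements refine \<T>\<^sub>0. \<forall>\<T>\<^sub>h\<in>refinements refine \<T>\<^sub>H.
        card (\<T>\<^sub>H - \<T>\<^sub>h) + card \<T>\<^sub>H \<le> card \<T>\<^sub>h) \<and>
     0 < Cmesh \<and>
     (\<forall>\<T> \<M>. \<T> 0 = \<T>\<^sub>0 \<and> (\<forall>j::nat. \<M> j \<subseteq> \<T> j \<and> \<T> (Suc j) = refine (\<T> j) (\<M> j)) \<longrightarrow>
        (\<forall>l. real (card (\<T> l)) - real (card \<T>\<^sub>0) \<le> Cmesh * (\<Sum>j<l. real (card (\<M> j))))) \<and>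
     (\<forall>\<T>\<^sub>H\<in>refinements refine \<T>\<^sub>0. \<forall>\<T>\<^sub>h\<in>refinements refine \<T>\<^sub>0.
        \<exists>\<T>'\<in>refinements refine \<T>\<^sub>H \<inter> refinements refine \<T>\<^sub>h.
          card \<T>' + card \<T>\<^sub>0 \<le> card \<T>\<^sub>H + card \<T>\<^sub>h)"


text \<open>All data on which the constants of the convergence theorem must not depend, except through the
  constants in the assumptions: right-hand sides, exact solutions \<open>u\<close> and \<open>z[w]\<close>, polynomial degree,
  initial mesh, refinement strategy, discrete solutions \<open>u\<^sub>H\<close> and \<open>z\<^sub>H[w]\<close>, refinement indicators.\<close>

record ('n::finite) goafem =
  rhs_f :: "real ^ 'n \<Rightarrow> real"
  rhs_ff :: "real ^ 'n \<Rightarrow> real ^ 'n"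
  sol_u :: "real ^ 'n \<Rightarrow> real"
  sol_z :: "(real ^ 'n \<Rightarrow> real) \<Rightarrow> (real ^ 'n \<Rightarrow> real)"
  fe_deg :: nat
  mesh0 :: "'n mesh"
  mesh_refine :: "'n mesh \<Rightarrow> 'n mesh \<Rightarrow> 'n mesh"
  disc_u :: "'n mesh \<Rightarrow> (real ^ 'n \<Rightarrow> real)"
  disc_z :: "'n mesh \<Rightarrow> (real ^ 'n \<Rightarrow> real) \<Rightarrow> (real ^ 'n \<Rightarrow> real)"
  ind_eta :: "'n mesh \<Rightarrow> (real ^ 'n) set \<Rightarrow> (real ^ 'n \<Rightarrow> real) \<Rightarrow> real"
  ind_zeta :: "'n mesh \<Rightarrow> (real ^ 'n) set \<Rightarrow> (real ^ 'n \<Rightarrow> real) \<Rightarrow> real"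

definition meshes :: "('n::finite) goafem \<Rightarrow> 'n mesh set" where
  "meshes P = refinements (mesh_refine P) (mesh0 P)"

definition solution_data ::
  "(real ^ 'n) set \<Rightarrow> (real ^ 'n \<Rightarrow> real ^ 'n ^ 'n) \<Rightarrow> (real ^ 'n \<Rightarrow> real ^ 'n) \<Rightarrow> (real ^ 'n \<Rightarrow> real) \<Rightarrow>
   ((real ^ 'n \<Rightarrow> real) \<Rightarrow> (real ^ 'n \<Rightarrow> real) \<Rightarrow> real) \<Rightarrow> 'n goafem \<Rightarrow> bool" where
  "solution_data \<Omega> A b c K P \<longleftrightarrow>
     rhs_f P \<in> L2 \<Omega> \<and> rhs_ff P \<in> L2 \<Omega> \<and> 1 \<le> fe_deg P \<and>
     sol_u P \<in> H10 \<Omega> \<and>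
     (\<forall>v\<in>H10 \<Omega>. a_form \<Omega> A b c (sol_u P) v = F_form \<Omega> (rhs_f P) (rhs_ff P) v) \<and>
     (\<forall>w\<in>H10 \<Omega>. sol_z P w \<in> H10 \<Omega> \<and>
        (\<forall>v\<in>H10 \<Omega>. a_form \<Omega> A b c v (sol_z P w) = K v w + K w v)) \<and>
     (\<forall>\<T>\<^sub>H\<in>meshes P. let X = fe_space \<Omega> (fe_deg P) \<T>\<^sub>H in
        disc_u P \<T>\<^sub>H \<in> X \<and>
        (\<forall>v\<in>X. a_form \<Omega> A b c (disc_u P \<T>\<^sub>H) v = F_form \<Omega> (rhs_f P) (rhs_ff P) v) \<and>
        (\<forall>w\<in>H10 \<Omega>. disc_z P \<T>\<^sub>H w \<in> X \<and>
           (\<forall>v\<in>X. a_form \<Omega> A b c v (disc_z P \<T>\<^sub>H w) = K v w + K w v)))"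


text \<open>\<open>eta P \<T>\<^sub>H \<U> v\<close> is \<open>\<eta>\<^sub>H(\<U>, v)\<close>.\<close>

definition eta :: "('n::finite) goafem \<Rightarrow> 'n mesh \<Rightarrow> 'n mesh \<Rightarrow> (real ^ 'n \<Rightarrow> real) \<Rightarrow> real" where
  "eta P \<T>\<^sub>H \<U> v = sqrt (\<Sum>T\<in>\<U>. (ind_eta P \<T>\<^sub>H T v)\<^sup>2)"

definition zeta :: "('n::finite) goafem \<Rightarrow> 'n mesh \<Rightarrow> 'n mesh \<Rightarrow> (real ^ 'n \<Rightarrow> real) \<Rightarrow> real" where
  "zeta P \<T>\<^sub>H \<U> v = sqrt (\<Sum>T\<in>\<U>. (ind_zeta P \<T>\<^sub>H T v)\<^sup>2)"

definition eta_zeta ::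
  "('n::finite) goafem \<Rightarrow> 'n mesh \<Rightarrow> 'n mesh \<Rightarrow> (real ^ 'n \<Rightarrow> real) \<Rightarrow> (real ^ 'n \<Rightarrow> real) \<Rightarrow> real" where
  "eta_zeta P \<T>\<^sub>H \<U> v w = sqrt ((eta P \<T>\<^sub>H \<U> v)\<^sup>2 + (zeta P \<T>\<^sub>H \<U> w)\<^sup>2)"

definition estimator_axioms ::
  "(real ^ 'n) set \<Rightarrow> (real ^ 'n \<Rightarrow> real ^ 'n ^ 'n) \<Rightarrow> real \<Rightarrow> real \<Rightarrow> real \<Rightarrow> real \<Rightarrow> 'n goafem \<Rightarrow> bool" where
  "estimator_axioms \<Omega> A qred Cstab Crel Cdrel P \<longleftrightarrow>
     (\<forall>\<T>\<^sub>H\<in>meshes P. \<forall>v\<in>fe_space \<Omega> (fe_deg P) \<T>\<^sub>H. \<forall>T\<in>\<T>\<^sub>H.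
        0 \<le> ind_eta P \<T>\<^sub>H T v \<and> 0 \<le> ind_zeta P \<T>\<^sub>H T v) \<and>
     0 < Cstab \<and> 0 < Crel \<and> 0 < Cdrel \<and> 0 < qred \<and> qred < 1 \<and>
     (\<forall>\<T>\<^sub>H\<in>meshes P. \<forall>\<T>\<^sub>h\<in>refinements (mesh_refine P) \<T>\<^sub>H.
        let X\<^sub>H = fe_space \<Omega> (fe_deg P) \<T>\<^sub>H; X\<^sub>h = fe_space \<Omega> (fe_deg P) \<T>\<^sub>h;
            d = (\<lambda>v w. energy_norm \<Omega> A (\<lambda>x. v x - w x));
            u = sol_u P; u\<^sub>H = disc_u P \<T>\<^sub>H; u\<^sub>h = disc_u P \<T>\<^sub>h;
            z = sol_z P; z\<^sub>H = disc_z P \<T>\<^sub>H; z\<^sub>h = disc_z P \<T>\<^sub>h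
        in
          \<comment> \<open>stability\<close>
          (\<forall>v\<^sub>h\<in>X\<^sub>h. \<forall>v\<^sub>H\<in>X\<^sub>H. \<forall>\<U>. \<U> \<subseteq> \<T>\<^sub>h \<inter> \<T>\<^sub>H \<longrightarrow>
             \<bar>eta P \<T>\<^sub>h \<U> v\<^sub>h - eta P \<T>\<^sub>H \<U> v\<^sub>H\<bar> + \<bar>zeta P \<T>\<^sub>h \<U> v\<^sub>h - zeta P \<T>\<^sub>H \<U> v\<^sub>H\<bar>
               \<le> Cstab * d v\<^sub>h v\<^sub>H) \<and>
          \<comment> \<open>reduction\<close>
          (\<forall>v\<^sub>H\<in>X\<^sub>H.
             eta P \<T>\<^sub>h (\<T>\<^sub>h - \<T>\<^sub>H) v\<^sub>H \<le> qred * eta P \<T>\<^sub>H (\<T>\<^sub>H - \<T>\<^sub>h) v\<^sub>H \<and>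
             zeta P \<T>\<^sub>h (\<T>\<^sub>h - \<T>\<^sub>H) v\<^sub>H \<le> qred * zeta P \<T>\<^sub>H (\<T>\<^sub>H - \<T>\<^sub>h) v\<^sub>H) \<and>
          \<comment> \<open>reliability\<close>
          d u u\<^sub>H \<le> Crel * eta P \<T>\<^sub>H \<T>\<^sub>H u\<^sub>H \<and>
          (\<forall>w\<in>H10 \<Omega>. d (z w) (z\<^sub>H w) \<le> Crel * zeta P \<T>\<^sub>H \<T>\<^sub>H (z\<^sub>H w)) \<and>
          \<comment> \<open>discrete reliability\<close>
          d u\<^sub>h u\<^sub>H \<le> Cdrel * eta P \<T>\<^sub>H (\<T>\<^sub>H - \<T>\<^sub>h) u\<^sub>H \<and>
          (\<forall>w\<in>H10 \<Omega>. d (z\<^sub>h w) (z\<^sub>H w) \<le> Cdrel * zeta P \<T>\<^sub>H (\<T>\<^sub>H - \<T>\<^sub>h) (z\<^sub>H w)) \<and>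
          \<comment> \<open>convention: the same constants work for the combined estimator\<close>
          (\<forall>v\<^sub>h\<in>X\<^sub>h. \<forall>w\<^sub>h\<in>X\<^sub>h. \<forall>v\<^sub>H\<in>X\<^sub>H. \<forall>w\<^sub>H\<in>X\<^sub>H. \<forall>\<U>. \<U> \<subseteq> \<T>\<^sub>h \<inter> \<T>\<^sub>H \<longrightarrow>
             \<bar>eta_zeta P \<T>\<^sub>h \<U> v\<^sub>h w\<^sub>h - eta_zeta P \<T>\<^sub>H \<U> v\<^sub>H w\<^sub>H\<bar> \<le> Cstab * (d v\<^sub>h v\<^sub>H + d w\<^sub>h w\<^sub>H)) \<and>
          d u u\<^sub>H + d (z u) (z\<^sub>H u\<^sub>H) + d (z u\<^sub>H) (z\<^sub>H u\<^sub>H)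
             \<le> Crel * eta_zeta P \<T>\<^sub>H \<T>\<^sub>H u\<^sub>H (z\<^sub>H u\<^sub>H) \<and>
          d u\<^sub>h u\<^sub>H + d (z\<^sub>h u\<^sub>h) (z\<^sub>H u\<^sub>H)
             \<le> Cdrel * eta_zeta P \<T>\<^sub>H (\<T>\<^sub>H - \<T>\<^sub>h) u\<^sub>H (z\<^sub>H u\<^sub>H))"

definition admissible ::
  "(real ^ 'n) set \<Rightarrow> (real ^ 'n \<Rightarrow> real ^ 'n ^ 'n) \<Rightarrow> (real ^ 'n \<Rightarrow> real ^ 'n) \<Rightarrow> (real ^ 'n \<Rightarrow> real) \<Rightarrow>
   ((real ^ 'n \<Rightarrow> real) \<Rightarrow> (real ^ 'n \<Rightarrow> real) \<Rightarrow> real) \<Rightarrow>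
   real \<Rightarrow> real \<Rightarrow> real \<Rightarrow> real \<Rightarrow> real \<Rightarrow> 'n goafem \<Rightarrow> bool" where
  "admissible \<Omega> A b c K Cmesh qred Cstab Crel Cdrel P \<longleftrightarrow>
     refinement_strategy \<Omega> (mesh0 P) (mesh_refine P) \<and>
     refinement_assumptions (mesh0 P) (mesh_refine P) Cmesh \<and>
     solution_data \<Omega> A b c K P \<and>
     estimator_axioms \<Omega> A qred Cstab Crel Cdrel P"


text \<open>The infimum is a minimum, since it ranges over a finite set of meshes.\<close>

definition approx_u :: "('n::finite) goafem \<Rightarrow> real \<Rightarrow> ennreal" where
  "approx_u P s = (SUP N::nat. ennreal ((real N + 1) powr s) *
     (INF \<T>\<^sub>H\<in>{\<T> \<in> meshes P. card \<T> - card (mesh0 P) \<le> N}. ennreal (eta P \<T>\<^sub>H \<T>\<^sub>H (disc_u P \<T>\<^sub>H))))"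

definition approx_z :: "('n::finite) goafem \<Rightarrow> real \<Rightarrow> ennreal" where
  "approx_z P t = (SUP N::nat. ennreal ((real N + 1) powr t) *
     (INF \<T>\<^sub>H\<in>{\<T> \<in> meshes P. card \<T> - card (mesh0 P) \<le> N}.
        ennreal (zeta P \<T>\<^sub>H \<T>\<^sub>H (disc_z P \<T>\<^sub>H (sol_u P)))))"


text \<open>\<open>algorithm_A P \<theta> Cmark \<T>\<close>: the sequence \<open>\<T>\<close> of meshes is a possible output of the algorithm.\<close>

definition quasi_minimal :: "real \<Rightarrow> 'a set set \<Rightarrow> 'a set \<Rightarrow> bool" where
  "quasi_minimal Cmark \<S> M \<longleftrightarrow> M \<in> \<S> \<and> (\<forall>M'\<in>\<S>. real (card M) \<le> Cmark * real (card M'))"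

definition algorithm_A :: "('n::finite) goafem \<Rightarrow> real \<Rightarrow> real \<Rightarrow> (nat \<Rightarrow> 'n mesh) \<Rightarrow> bool" where
  "algorithm_A P \<theta> Cmark \<T> \<longleftrightarrow> \<T> 0 = mesh0 P \<and>
     (\<forall>l. let u = disc_u P (\<T> l); z = disc_z P (\<T> l) u in
        \<exists>Mbar_u Mbar_uz M_u M_uz.
          quasi_minimal Cmark
            {M. M \<subseteq> \<T> l \<and> \<theta> * (eta P (\<T> l) (\<T> l) u)\<^sup>2 \<le> (eta P (\<T> l) M u)\<^sup>2} Mbar_u \<and>
          quasi_minimal Cmark
            {M. M \<subseteq> \<T> l \<and> \<theta> * ((eta P (\<T> l) (\<T> l) u)\<^sup>2 + (zeta P (\<T> l) (\<T> l) z)\<^sup>2)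
                             \<le> (eta P (\<T> l) M u)\<^sup>2 + (zeta P (\<T> l) M z)\<^sup>2} Mbar_uz \<and>
          M_u \<subseteq> Mbar_u \<and> M_uz \<subseteq> Mbar_uz \<and>
          card M_u = min (card Mbar_u) (card Mbar_uz) \<and>
          card M_uz = min (card Mbar_u) (card Mbar_uz) \<and>
          \<T> (Suc l) = mesh_refine P (\<T> l) (M_u \<union> M_uz))"

definition estimator_product :: "('n::finite) goafem \<Rightarrow> 'n mesh \<Rightarrow> real" where
  "estimator_product P \<T>\<^sub>H = (let u\<^sub>H = disc_u P \<T>\<^sub>H; z\<^sub>H = disc_z P \<T>\<^sub>H u\<^sub>H in
     eta P \<T>\<^sub>H \<T>\<^sub>H u\<^sub>H * sqrt ((eta P \<T>\<^sub>H \<T>\<^sub>H u\<^sub>H)\<^sup>2 + (zeta P \<T>\<^sub>H \<T>\<^sub>H z\<^sub>H)\<^sup>2))"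

end

theory Submission
  imports Defs "HOL-Computational_Algebra.Polynomial"
begin

text \<open>The pair of primal and dual Galerkin solutions is itself the Galerkin solution of one coupled
  variational problem, which is elliptic if the primal equation is given a large weight. For an elliptic
  bounded form \<open>a\<close>, the increments \<open>e\<^sub>k\<close> of Galerkin solutions on nested spaces satisfy
  \<open>a(e\<^sub>j, e\<^sub>k) = 0\<close> for \<open>k < j\<close>. Sums of consecutive blocks of a sequence with this property enclose an
  angle bounded away from zero, so that by the parallelogram law the squared norm of a sum of \<open>2\<^sup>n\<close> elements
  is at most \<open>\<rho>\<^sup>n\<close> times the sum of the squared norms with some \<open>\<rho> < 2\<close>. Dualising this bound shows that
  the squared increments of the Galerkin solutions sum up to at most \<open>C \<rho>\<^sup>n\<close> times the squared error, which
  suffices for linear convergence of either estimator along those steps in which its Doerfler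
  criterion holds. Every step is of this kind for one of the two factors of the product. Compactness of
  \<open>K\<close> enters only through boundedness. Optimal rates then follow from the optimality of
  Doerfler marking for small \<open>\<theta>\<close>.\<close>

section \<open>Quasi-orthogonality for elliptic forms\<close>

text \<open>Since \<open>a\<close> need not be symmetric, Galerkin orthogonality removes only one of
  the two mixed terms of a pair of increments, and Pythagoras fails. A bound for the norm of a sum
  by the squares of its terms also points in the wrong direction: what is needed bounds the squares
  by the norm of the sum. The reversal goes through a biorthogonal family that is triangular in the
  opposite order and has the same norms. The growth \<open>rho ^ n\<close> is harmless because it is
  averaged over \<open>2 ^ n\<close> steps, and \<open>(rho / 2) ^ n\<close> tends to zero. The
  coupled problem is forced by the algorithm: the functional defining the discrete dual solution
  contains the discrete primal solution and changes with the mesh, so these dual solutions are not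
  Galerkin approximations for one fixed functional. In the coupled form that functional stands on
  the left, and the right-hand side is the same on all meshes. Rates are fixed from
  \<open>a\<close>, \<open>K\<close>, \<open>\<theta>\<close> and the estimator constants before any
  discretisation is chosen; this makes them uniform.\<close>

text \<open>Forward substitution for a triangular Gram matrix: the result pairs to zero with every
  \<open>e i\<close>, \<open>i \<noteq> k\<close>, and to \<open>a (e k) (e k)\<close> with
  \<open>e k\<close>. Where \<open>a (e j) (e j) = 0\<close> the quotient is 0, which is consistent
  because boundedness then gives \<open>a (e j) (e k) = 0\<close>.\<close>

fun biorth :: "(('x \<Rightarrow> real) \<Rightarrow> ('x \<Rightarrow> real) \<Rightarrow> real) \<Rightarrow> (nat \<Rightarrow> 'x \<Rightarrow> real) \<Rightarrow> nat \<Rightarrow> 'x \<Rightarrow> real" where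
  "biorth a e k = (\<lambda>x. e k x - (\<Sum>j<k. a (e j) (e k) / a (e j) (e j) * biorth a e j x))"

declare biorth.simps [simp del]

text \<open>\<open>M\<close> bounds \<open>a\<close> relative to its own quadratic form, so it
  absorbs continuity and ellipticity at once. The form is only semidefinite because elements of
  \<open>V\<close> are functions, not classes modulo null sets. The primal form, its transpose and
  the coupled form are all instances.\<close>

locale bounded_form =
  fixes V :: "('x \<Rightarrow> real) set" and a :: "('x \<Rightarrow> real) \<Rightarrow> ('x \<Rightarrow> real) \<Rightarrow> real" and M :: real
  assumes zero_mem: "(\<lambda>x. 0) \<in> V"
    and add_mem: "v \<in> V \<Longrightarrow> w \<in> V \<Longrightarrow> (\<lambda>x. v x + w x) \<in> V"
    and scale_mem: "v \<in> V \<Longrightarrow> (\<lambda>x. r * v x) \<in> V"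
    and add_left: "v \<in> V \<Longrightarrow> v' \<in> V \<Longrightarrow> w \<in> V \<Longrightarrow> a (\<lambda>x. v x + v' x) w = a v w + a v' w"
    and add_right: "v \<in> V \<Longrightarrow> v' \<in> V \<Longrightarrow> w \<in> V \<Longrightarrow> a w (\<lambda>x. v x + v' x) = a w v + a w v'"
    and scale_left: "v \<in> V \<Longrightarrow> w \<in> V \<Longrightarrow> a (\<lambda>x. r * v x) w = r * a v w"
    and scale_right: "v \<in> V \<Longrightarrow> w \<in> V \<Longrightarrow> a w (\<lambda>x. r * v x) = r * a w v"
    and nonneg: "v \<in> V \<Longrightarrow> 0 \<le> a v v"
    and bounded: "v \<in> V \<Longrightarrow> w \<in> V \<Longrightarrow> (a v w)\<^sup>2 \<le> M\<^sup>2 * a v v * a w w"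
    and M_nonneg: "0 \<le> M"
begin

lemma diff_mem: "v \<in> V \<Longrightarrow> w \<in> V \<Longrightarrow> (\<lambda>x. v x - w x) \<in> V"
  using add_mem[of v "\<lambda>x. (-1) * w x"] scale_mem[of w "-1"] by simp

lemma diff_left: "v \<in> V \<Longrightarrow> v' \<in> V \<Longrightarrow> w \<in> V \<Longrightarrow> a (\<lambda>x. v x - v' x) w = a v w - a v' w"
  using add_left[of v "\<lambda>x. (-1) * v' x" w] scale_mem[of v' "-1"] scale_left[of v' w "-1"] by simp

lemma diff_right: "v \<in> V \<Longrightarrow> v' \<in> V \<Longrightarrow> w \<in> V \<Longrightarrow> a w (\<lambda>x. v x - v' x) = a w v - a w v'"
  using add_right[of v "\<lambda>x. (-1) * v' x" w] scale_mem[of v' "-1"] scale_right[of v' w "-1"] by simp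

lemma zero_left: "w \<in> V \<Longrightarrow> a (\<lambda>x. 0) w = 0"
  using scale_left[of w w 0] by simp

lemma zero_right: "w \<in> V \<Longrightarrow> a w (\<lambda>x. 0) = 0"
  using scale_right[of w w 0] by simp

lemma sum_mem: "(\<And>i. i \<in> I \<Longrightarrow> v i \<in> V) \<Longrightarrow> (\<lambda>x. \<Sum>i\<in>I. v i x) \<in> V"
  by (induction I rule: infinite_finite_induct) (auto simp: zero_mem intro: add_mem)

lemma sum_left: "(\<And>i. i \<in> I \<Longrightarrow> v i \<in> V) \<Longrightarrow> w \<in> V \<Longrightarrow> a (\<lambda>x. \<Sum>i\<in>I. v i x) w = (\<Sum>i\<in>I. a (v i) w)"
  by (induction I rule: infinite_finite_induct) (auto simp: zero_left add_left sum_mem)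

lemma sum_right: "(\<And>i. i \<in> I \<Longrightarrow> v i \<in> V) \<Longrightarrow> w \<in> V \<Longrightarrow> a w (\<lambda>x. \<Sum>i\<in>I. v i x) = (\<Sum>i\<in>I. a w (v i))"
  by (induction I rule: infinite_finite_induct) (auto simp: zero_right add_right sum_mem)

text \<open>\<open>2 + 3 * M\<^sup>2\<close> is the constant with which the squared distance of two
  one-sidedly orthogonal elements controls the sum of their squared norms; the parallelogram law
  subtracts its reciprocal from 2.\<close>

definition rho :: real where "rho = 2 - 1 / (2 + 3 * M\<^sup>2)"

lemma rho_bounds: "1 \<le> rho" "rho < 2"
proof -
  have "0 < 1 / (2 + 3 * M\<^sup>2)" "1 / (2 + 3 * M\<^sup>2) \<le> 1"
    using zero_le_power2[of M] by (auto simp: divide_le_eq intro: add_pos_nonneg)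
  then show "1 \<le> rho" "rho < 2" unfolding rho_def by linarith+
qed

text \<open>In the parallelogram law the sum loses \<open>d\<close>, the squared distance of
  \<open>p\<close> and \<open>r\<close>. Testing \<open>p - r\<close> against \<open>r\<close>
  leaves only \<open>- a r r\<close>, so boundedness gives \<open>a r r \<le> M\<^sup>2 * d\<close>,
  and then \<open>a p p\<close> is controlled by \<open>d\<close> as well.\<close>

lemma norm_add_le_of_orthogonal:
  assumes p: "p \<in> V" and r: "r \<in> V" and orth: "a p r = 0"
  shows "a (\<lambda>x. p x + r x) (\<lambda>x. p x + r x) \<le> rho * (a p p + a r r)"
proof -
  define d where "d = a (\<lambda>x. p x - r x) (\<lambda>x. p x - r x)"
  have d: "d = a p p - a r p + a r r"
    unfolding d_def using p r orth by (auto simp: diff_left diff_right diff_mem)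
  have d0: "0 \<le> d" unfolding d_def by (intro nonneg diff_mem p r)
  have "(a (\<lambda>x. p x - r x) r)\<^sup>2 \<le> M\<^sup>2 * d * a r r"
    unfolding d_def using bounded[OF diff_mem[OF p r] r] .
  then have "a r r * a r r \<le> (M\<^sup>2 * d) * a r r"
    using p r orth by (simp add: diff_left power2_eq_square)
  then have rr: "a r r \<le> M\<^sup>2 * d"
    using nonneg[OF r] d0 by (cases "a r r = 0") (auto simp: mult_le_cancel_right)
  \<comment> \<open>Positivity at \<open>p - 2 r\<close> is the inequality |x + y|^2 <= 2 |x|^2 + 2
    |y|^2 for \<open>p = (p - r) + r\<close>.\<close>
  have "0 \<le> a (\<lambda>x. p x - 2 * r x) (\<lambda>x. p x - 2 * r x)"
    by (intro nonneg diff_mem scale_mem p r)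
  also have "\<dots> = a p p - 2 * a r p + 4 * a r r"
    using p r orth by (simp add: diff_left diff_right diff_mem scale_mem scale_left scale_right)
  finally have pp: "a p p \<le> 2 * d + 2 * a r r" using d by linarith
  have "a p p + a r r \<le> (2 + 3 * M\<^sup>2) * d" using pp rr by (simp add: algebra_simps)
  then have "(a p p + a r r) / (2 + 3 * M\<^sup>2) \<le> d"
    by (subst pos_divide_le_eq) (auto simp: add_pos_nonneg mult.commute)
  moreover have "a (\<lambda>x. p x + r x) (\<lambda>x. p x + r x) = 2 * (a p p + a r r) - d"
    using p r orth d by (simp add: add_left add_right add_mem)
  ultimately show ?thesis unfolding rho_def by (simp add: algebra_simps)
qed

context
  fixes e :: "nat \<Rightarrow> 'x \<Rightarrow> real"
  assumes e_mem: "\<And>k. e k \<in> V" and e_tri: "\<And>j k. k < j \<Longrightarrow> a (e j) (e k) = 0"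
begin

lemma biorth_mem: "biorth a e k \<in> V"
proof (induction k rule: less_induct)
  case (less k)
  then show ?case
    by (subst biorth.simps) (intro diff_mem e_mem sum_mem scale_mem, auto)
qed

lemma biorth_right:
  "w \<in> V \<Longrightarrow> a w (biorth a e k) = a w (e k) - (\<Sum>j<k. a (e j) (e k) / a (e j) (e j) * a w (biorth a e j))"
  by (subst biorth.simps) (simp add: diff_right e_mem sum_mem scale_mem biorth_mem sum_right scale_right
    del: times_divide_eq_left)

lemma biorth_left:
  "w \<in> V \<Longrightarrow> a (biorth a e k) w = a (e k) w - (\<Sum>j<k. a (e j) (e k) / a (e j) (e j) * a (biorth a e j) w)"
  by (subst (1) biorth.simps) (simp add: diff_left e_mem sum_mem scale_mem biorth_mem sum_left scale_left
    del: times_divide_eq_left)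

text \<open>\<open>biorth a e k\<close> lies in the span of \<open>e 0\<close>, ...,
  \<open>e k\<close>, which \<open>e i\<close> annihilates from the left.\<close>

lemma biorth_above: "k < i \<Longrightarrow> a (e i) (biorth a e k) = 0"
proof (induction k rule: less_induct)
  case (less k)
  then show ?case by (subst biorth_right) (auto simp: e_mem e_tri)
qed

lemma biorth_diag: "a (e k) (biorth a e k) = a (e k) (e k)"
  by (subst biorth_right) (auto simp: e_mem biorth_above)

text \<open>By induction \<open>e i\<close> sees only the correction with \<open>j = i\<close>,
  whose coefficient is made to cancel \<open>a (e i) (e k)\<close>.\<close>

lemma biorth_below: "i < k \<Longrightarrow> a (e i) (biorth a e k) = 0"
proof (induction k arbitrary: i rule: less_induct)
  case (less k)
  have "(\<Sum>j<k. a (e j) (e k) / a (e j) (e j) * a (e i) (biorth a e j))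
      = (\<Sum>j<k. if j = i then a (e i) (e k) / a (e i) (e i) * a (e i) (e i) else 0)"
  proof (intro sum.cong refl)
    fix j assume "j \<in> {..<k}"
    then show "a (e j) (e k) / a (e j) (e j) * a (e i) (biorth a e j)
        = (if j = i then a (e i) (e k) / a (e i) (e i) * a (e i) (e i) else 0)"
      using less.IH[of j i] biorth_above[of j i] biorth_diag[of i] by (cases j i rule: linorder_cases) auto
  qed
  \<comment> \<open>If \<open>a (e i) (e i) = 0\<close>, the quotient is 0 by convention, and
    boundedness makes the right-hand side vanish too.\<close>
  also have "\<dots> = a (e i) (e k)"
    using bounded[OF e_mem[of i] e_mem[of k]] less.prems by (cases "a (e i) (e i) = 0") auto
  finally show ?case by (subst biorth_right) (auto simp: e_mem)
qed

text \<open>The first argument lies in the span of \<open>e 0\<close>, ..., \<open>e j\<close>, all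
  orthogonal to later dual elements. The dual family is thus triangular in the order opposite to
  that of \<open>e\<close>.\<close>

lemma biorth_tri: "j < k \<Longrightarrow> a (biorth a e j) (biorth a e k) = 0"
proof (induction j rule: less_induct)
  case (less j)
  then show ?case by (subst biorth_left) (auto simp: biorth_mem biorth_below)
qed

text \<open>The corrections in the first argument are earlier dual elements and drop out. Equal
  norms let a bound for sums of the dual family speak about the increments themselves.\<close>

lemma biorth_norm: "a (biorth a e k) (biorth a e k) = a (e k) (e k)"
  by (subst biorth_left) (auto simp: biorth_mem biorth_tri biorth_diag)

text \<open>Dyadic halving: the two half blocks are one-sidedly orthogonal, so each doubling of the
  length costs \<open>rho\<close> instead of the trivial factor 2.\<close>

lemma biorth_sum_le:
  "a (\<lambda>x. \<Sum>k\<in>{i..<i+2^n}. biorth a e k x) (\<lambda>x. \<Sum>k\<in>{i..<i+2^n}. biorth a e k x)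
     \<le> rho ^ n * (\<Sum>k\<in>{i..<i+2^n}. a (e k) (e k))"
proof (induction n arbitrary: i)
  case 0
  then show ?case by (simp add: biorth_norm)
next
  case (Suc n)
  define p where "p = (\<lambda>x. \<Sum>k\<in>{i..<i+2^n}. biorth a e k x)"
  define r where "r = (\<lambda>x. \<Sum>k\<in>{i+2^n..<i+2^n+2^n}. biorth a e k x)"
  have split: "{i..<i+2^Suc n} = {i..<i+2^n} \<union> {i+2^n..<i+2^n+2^n}" by auto
  have pr: "p \<in> V" "r \<in> V" unfolding p_def r_def by (auto intro: sum_mem biorth_mem)
  have "a p r = 0"
    unfolding p_def r_def
    by (subst sum_left, simp_all add: biorth_mem sum_mem sum_right)
       (intro sum.neutral ballI, auto intro!: biorth_tri)
  from norm_add_le_of_orthogonal[OF pr this]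
  have "a (\<lambda>x. p x + r x) (\<lambda>x. p x + r x) \<le> rho * (a p p + a r r)" .
  also have "\<dots> \<le> rho * (rho ^ n * (\<Sum>k\<in>{i..<i+2^n}. a (e k) (e k))
      + rho ^ n * (\<Sum>k\<in>{i+2^n..<i+2^n+2^n}. a (e k) (e k)))"
    using rho_bounds Suc.IH[of i] Suc.IH[of "i + 2^n"]
    by (intro mult_left_mono add_mono) (auto simp: p_def r_def)
  also have "\<dots> = rho ^ Suc n * (\<Sum>k\<in>{i..<i+2^Suc n}. a (e k) (e k))"
    unfolding split by (subst sum.union_disjoint) (auto simp: algebra_simps)
  also have "(\<lambda>x. p x + r x) = (\<lambda>x. \<Sum>k\<in>{i..<i+2^Suc n}. biorth a e k x)"
    unfolding split p_def r_def by (subst sum.union_disjoint) auto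
  finally show ?case .
qed

text \<open>Duality: pairing the sum \<open>E\<close> of the increments with the sum
  \<open>Y\<close> of the dual family gives exactly \<open>S\<close>, as all mixed terms vanish. In
  \<open>S\<^sup>2 \<le> M\<^sup>2 * a E E * a Y Y\<close> the last factor is at most
  \<open>rho ^ n * S\<close>, and one \<open>S\<close> cancels.\<close>

lemma sum_increments_le:
  "(\<Sum>k<2^n. a (e k) (e k)) \<le> M\<^sup>2 * rho ^ n * a (\<lambda>x. \<Sum>k<2^n. e k x) (\<lambda>x. \<Sum>k<2^n. e k x)"
proof -
  define E where "E = (\<lambda>x. \<Sum>k<2^n. e k x)"
  define Y where "Y = (\<lambda>x. \<Sum>k<2^n. biorth a e k x)"
  define S where "S = (\<Sum>k<2^n. a (e k) (e k))"
  have EY: "E \<in> V" "Y \<in> V" unfolding E_def Y_def by (auto intro: sum_mem biorth_mem e_mem)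
  have S0: "0 \<le> S" unfolding S_def by (auto intro: sum_nonneg nonneg e_mem)
  have "a E Y = (\<Sum>i<2^n. \<Sum>k<2^n. a (e i) (biorth a e k))"
    unfolding E_def Y_def by (simp add: sum_left sum_right e_mem biorth_mem sum_mem)
  also have "\<dots> = (\<Sum>i<2^n. \<Sum>k<2^n. if k = i then a (e i) (e i) else 0)"
  proof (intro sum.cong refl)
    fix i k show "a (e i) (biorth a e k) = (if k = i then a (e i) (e i) else 0)"
      using biorth_below[of i k] biorth_above[of k i] biorth_diag[of i] by (cases i k rule: linorder_cases) auto
  qed
  finally have aEY: "a E Y = S" by (simp add: S_def)
  have "a Y Y \<le> rho ^ n * S"
    using biorth_sum_le[of 0 n] by (simp add: Y_def S_def atLeast0LessThan)
  then have "S\<^sup>2 \<le> M\<^sup>2 * a E E * (rho ^ n * S)"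
    using bounded[OF EY] nonneg[OF EY(1)] unfolding aEY by (smt (verit) mult_left_mono zero_le_mult_iff zero_le_power2)
  then have "S * S \<le> (M\<^sup>2 * rho ^ n * a E E) * S" by (simp add: power2_eq_square algebra_simps)
  moreover have "0 \<le> M\<^sup>2 * rho ^ n * a E E" using rho_bounds nonneg[OF EY(1)] by simp
  ultimately have "S \<le> M\<^sup>2 * rho ^ n * a E E"
    using S0 by (cases "S = 0") (auto simp: mult_le_cancel_right)
  then show ?thesis unfolding S_def E_def .
qed

end

text \<open>This is stability of the Galerkin projection: the hypotheses give
  \<open>a (v - w) (v - w) = a (u - w) (v - w)\<close>. In its uses \<open>w\<close> is a discrete
  solution on a coarser mesh than \<open>v\<close>.\<close>

lemma cea:
  assumes "u \<in> V" "v \<in> V" "w \<in> V" and "a u v = a v v" "a u w = a v w"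
  shows "a (\<lambda>x. v x - w x) (\<lambda>x. v x - w x) \<le> M\<^sup>2 * a (\<lambda>x. u x - w x) (\<lambda>x. u x - w x)"
proof -
  define y where "y = (\<lambda>x. v x - w x)"
  define z where "z = (\<lambda>x. u x - w x)"
  have yz: "y \<in> V" "z \<in> V" unfolding y_def z_def using assms by (auto intro: diff_mem)
  have "a z y = a y y" unfolding y_def z_def using assms by (simp add: diff_left diff_right diff_mem)
  then have "a y y * a y y \<le> (M\<^sup>2 * a z z) * a y y"
    using bounded[OF yz(2,1)] by (simp add: power2_eq_square)
  then have "a y y \<le> M\<^sup>2 * a z z"
    using nonneg yz by (cases "a y y = 0") (auto simp: mult_le_cancel_right order_less_le)
  then show ?thesis unfolding y_def z_def .
qed

text \<open>The increments telescope, and \<open>cea\<close> replaces the distance of two discrete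
  solutions by the error of the coarser one. The duality bound and \<open>cea\<close> contribute a
  factor \<open>M\<^sup>2\<close> each.\<close>

lemma quasi_orthogonality:
  fixes W :: "nat \<Rightarrow> 'x \<Rightarrow> real"
  assumes U: "U \<in> V" and W: "\<And>k. W k \<in> V" and gal: "\<And>j k. k \<le> j \<Longrightarrow> a (W j) (W k) = a U (W k)"
  shows "(\<Sum>k<2^n. a (\<lambda>x. W (i + Suc k) x - W (i + k) x) (\<lambda>x. W (i + Suc k) x - W (i + k) x))
     \<le> M ^ 4 * rho ^ n * a (\<lambda>x. U x - W i x) (\<lambda>x. U x - W i x)"
proof -
  define e where "e = (\<lambda>k x. W (i + Suc k) x - W (i + k) x)"
  have e: "e k \<in> V" for k unfolding e_def by (intro diff_mem W)
  \<comment> \<open>\<open>W (i + j)\<close> and \<open>W (i + Suc j)\<close> act alike on every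
    \<open>W m\<close> with \<open>m \<le> i + j\<close>; since \<open>k < j\<close>, both functions
    in \<open>e k\<close> are of this kind.\<close>
  have tri: "a (e j) (e k) = 0" if "k < j" for j k
    using that gal[of "i+k" "i+j"] gal[of "i+k" "i+Suc j"] gal[of "i+Suc k" "i+j"] gal[of "i+Suc k" "i+Suc j"]
    by (simp add: e_def diff_left diff_right diff_mem W)
  have tele: "(\<lambda>x. \<Sum>k<m. e k x) = (\<lambda>x. W (i + m) x - W i x)" for m
  proof
    fix x show "(\<Sum>k<m. e k x) = W (i + m) x - W i x"
      unfolding e_def using sum_lessThan_telescope[of "\<lambda>k. W (i + k) x" m] by simp
  qed
  have "(\<Sum>k<2^n. a (e k) (e k)) \<le> M\<^sup>2 * rho ^ n * a (\<lambda>x. W (i+2^n) x - W i x) (\<lambda>x. W (i+2^n) x - W i x)"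
    using sum_increments_le[of e n, OF e tri] unfolding tele .
  also have "\<dots> \<le> M\<^sup>2 * rho ^ n * (M\<^sup>2 * a (\<lambda>x. U x - W i x) (\<lambda>x. U x - W i x))"
    using gal[of "i+2^n" "i+2^n"] gal[of i "i+2^n"] rho_bounds
    by (intro mult_left_mono cea) (auto simp: U W)
  also have "\<dots> = M ^ 4 * rho ^ n * a (\<lambda>x. U x - W i x) (\<lambda>x. U x - W i x)"
    by (simp add: algebra_simps power4_eq_xxxx power2_eq_square)
  finally show ?thesis unfolding e_def .
qed

end

section \<open>Linear convergence\<close>

text \<open>Full blocks gain 1/2 each, and the remainder, shorter than \<open>B\<close>, is bridged
  by quasi-monotonicity. The factor 2 pays for rounding \<open>m / B\<close> down.\<close>

lemma geometric_decay_of_block_contraction: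
  fixes s :: "nat \<Rightarrow> real"
  assumes B: "0 < (B::nat)" and C: "1 \<le> C"
    and s0: "\<And>k. 0 \<le> s k"
    and mono: "\<And>i j. i \<le> j \<Longrightarrow> j \<le> m \<Longrightarrow> s j \<le> C * s i"
    and contr: "\<And>i. i + B \<le> m \<Longrightarrow> s (i + B) \<le> s i / 2"
  shows "s m \<le> 2 * C * ((1/2) powr (1 / real B)) ^ m * s 0"
proof -
  have blocks: "j * B \<le> m \<Longrightarrow> s (j * B) \<le> (1/2) ^ j * s 0" for j
  proof (induction j)
    case (Suc j)
    then show ?case using contr[of "j * B"] by (simp add: add.commute)
  qed simp
  define j where "j = m div B"
  have jB: "j * B \<le> m" unfolding j_def by simp
  have "m < Suc j * B"
    unfolding j_def using B by (metis dividend_less_div_times mult.commute mult_Suc_right mult_Suc add.commute)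
  then have lt: "real m / real B \<le> real j + 1"
    using B by (simp add: pos_divide_le_eq del: mult_Suc) (metis less_imp_le of_nat_Suc of_nat_le_iff of_nat_mult add.commute)
  have "s m \<le> C * s (j * B)" using mono[OF jB] by simp
  also have "\<dots> \<le> C * ((1/2) ^ j * s 0)" using blocks[OF jB] C by (intro mult_left_mono) auto
  also have "(1/2) ^ j \<le> 2 * ((1/2) powr (1 / real B)) ^ m"
  proof -
    have "((1/2::real) powr (1 / real B)) ^ m = (1/2) powr (real m / real B)"
      by (simp add: powr_powr flip: powr_realpow)
    also have "\<dots> \<ge> (1/2) powr (real j + 1)" using lt by (intro powr_mono') auto
    also have "(1/2::real) powr (real j + 1) = (1/2) ^ Suc j"
      by (subst powr_realpow[symmetric]) (auto simp: add.commute)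
    finally show ?thesis by simp
  qed
  then have "C * ((1/2) ^ j * s 0) \<le> C * ((2 * ((1/2) powr (1 / real B)) ^ m) * s 0)"
    using C s0[of 0] by (intro mult_left_mono mult_right_mono) auto
  finally show ?thesis by (simp add: algebra_simps)
qed

text \<open>The increments \<open>D\<close> are only summable up to the sublinear factor \<open>\<rho> ^ n\<close> over blocks of length
  \<open>2 ^ n\<close>; a contraction results as soon as the block length beats this factor.\<close>

lemma linear_convergence_of_reduction:
  fixes q C1 C2 C3 \<rho> :: real
  assumes q: "0 < q" "q < 1" and C: "0 \<le> C1" "0 \<le> C2" "1 \<le> C3" and rho: "1 \<le> \<rho>" "\<rho> < 2"
  shows "\<exists>C r. 1 \<le> C \<and> 0 < r \<and> r < 1 \<and> (\<forall>(s :: nat \<Rightarrow> real) D m. (\<forall>k. 0 \<le> s k) \<longrightarrow>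
     (\<forall>k<m. s (Suc k) \<le> q * s k + C1 * D k) \<longrightarrow>
     (\<forall>i n. (\<Sum>k<2^n. D (i + k)) \<le> C2 * \<rho> ^ n * s i) \<longrightarrow>
     (\<forall>i j. i \<le> j \<longrightarrow> j \<le> m \<longrightarrow> s j \<le> C3 * s i) \<longrightarrow> s m \<le> C * r ^ m * s 0)"
proof -
  \<comment> \<open>The contraction factor over a block of length \<open>2 ^ n\<close> will be
    \<open>c * (\<rho> / 2) ^ n\<close>; \<open>n\<close> is taken so large that it drops below
    1/2.\<close>
  define c where "c = C3 * (q + C1 * C2) / (1 - q)"
  have c0: "0 < c" unfolding c_def using q C by (auto intro!: divide_pos_pos mult_pos_pos add_pos_nonneg)
  have "(\<lambda>n. c * (\<rho> / 2) ^ n) \<longlonglongrightarrow> c * 0"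
    using rho by (intro tendsto_mult tendsto_const LIMSEQ_power_zero) auto
  then have "eventually (\<lambda>n. c * (\<rho> / 2) ^ n < 1/2) sequentially"
    by (intro order_tendstoD(2)[where y = "c * 0"]) auto
  then obtain n where n: "c * (\<rho> / 2) ^ n < 1/2" by (auto simp: eventually_sequentially)
  define r where "r = (1/2::real) powr (1 / real (2^n))"
  have r: "0 < r" "r < 1" unfolding r_def using powr_less_mono2[of "1 / real (2^n)" "1/2" 1] by auto
  have "s m \<le> 2 * C3 * r ^ m * s 0"
    if s0: "\<forall>k. 0 \<le> s k" and red: "\<forall>k<m. s (Suc k) \<le> q * s k + C1 * D k"
      and orth: "\<forall>i n. (\<Sum>k<2^n. D (i + k)) \<le> C2 * \<rho> ^ n * s i"
      and mono: "\<forall>i j. i \<le> j \<longrightarrow> j \<le> m \<longrightarrow> s j \<le> C3 * s i" for s D :: "nat \<Rightarrow> real" and m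
  proof -
    have contr: "s (i + 2^n) \<le> s i / 2" if i: "i + 2^n \<le> m" for i
    proof -
      define S where "S = (\<Sum>k<2^n. s (i + Suc k))"
      have "S \<le> (\<Sum>k<2^n. q * s (i + k) + C1 * D (i + k))"
        unfolding S_def using red i by (intro sum_mono) auto
      also have "\<dots> = q * (\<Sum>k<2^n. s (i + k)) + C1 * (\<Sum>k<2^n. D (i + k))"
        by (simp add: sum.distrib sum_distrib_left)
      also have "(\<Sum>k<2^n. s (i + k)) = s i + S - s (i + 2^n)"
        unfolding S_def using sum_lessThan_telescope[of "\<lambda>k. s (i + k)" "2^n"] by (simp add: sum_subtractf)
      also have "q * (s i + S - s (i + 2^n)) + C1 * (\<Sum>k<2^n. D (i + k))
          \<le> q * (s i + S) + C1 * (C2 * \<rho> ^ n * s i)"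
        using q C s0 orth by (intro add_mono mult_left_mono) auto
      finally have "(1 - q) * S \<le> (q + C1 * C2 * \<rho> ^ n) * s i" by (simp add: algebra_simps)
      also have "\<dots> \<le> ((q + C1 * C2) * \<rho> ^ n) * s i"
        using q rho s0 by (intro mult_right_mono) (auto simp: algebra_simps)
      finally have S: "S \<le> (q + C1 * C2) * \<rho> ^ n * s i / (1 - q)" using q by (simp add: field_simps)
      \<comment> \<open>By quasi-monotonicity the last value of the block is at most
        \<open>C3\<close> times every value in it, hence at most \<open>C3\<close> times their mean.
        The mean brings the \<open>2 ^ n\<close> that beats \<open>\<rho> ^ n\<close>.\<close>
      have "2^n * s (i + 2^n) = (\<Sum>k<(2::nat)^n. s (i + 2^n))" by simp
      also have "\<dots> \<le> (\<Sum>k<2^n. C3 * s (i + Suc k))" using i mono by (intro sum_mono) auto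
      also have "\<dots> = C3 * S" by (simp add: S_def sum_distrib_left)
      also have "\<dots> \<le> C3 * ((q + C1 * C2) * \<rho> ^ n * s i / (1 - q))" using S C by (intro mult_left_mono) auto
      also have "\<dots> = 2^n * (c * (\<rho> / 2) ^ n * s i)" by (simp add: c_def power_divide)
      finally have "s (i + 2^n) \<le> c * (\<rho> / 2) ^ n * s i" by simp
      also have "\<dots> \<le> 1/2 * s i" using n s0 by (intro mult_right_mono) auto
      finally show ?thesis by simp
    qed
    show ?thesis
      unfolding r_def using geometric_decay_of_block_contraction[of "2^n" C3 s m] contr mono s0 C by simp
  qed
  then have "1 \<le> 2 * C3 \<and> 0 < r \<and> r < 1 \<and> (\<forall>(s :: nat \<Rightarrow> real) D m. (\<forall>k. 0 \<le> s k) \<longrightarrow>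
     (\<forall>k<m. s (Suc k) \<le> q * s k + C1 * D k) \<longrightarrow>
     (\<forall>i n. (\<Sum>k<2^n. D (i + k)) \<le> C2 * \<rho> ^ n * s i) \<longrightarrow>
     (\<forall>i j. i \<le> j \<longrightarrow> j \<le> m \<longrightarrow> s j \<le> C3 * s i) \<longrightarrow> s m \<le> 2 * C3 * r ^ m * s 0)"
    using r C by auto
  then show ?thesis by blast
qed

text \<open>One pair \<open>C\<close>, \<open>r\<close> serves all sequences with the given constants, so that the rate does not depend on
  the discretisation.\<close>

definition linear_rate :: "real \<Rightarrow> real \<Rightarrow> real \<Rightarrow> real \<Rightarrow> real \<Rightarrow> real \<Rightarrow> real \<Rightarrow> bool" where
  "linear_rate M Cs Cr q \<theta> C r \<longleftrightarrow> 1 \<le> C \<and> 0 < r \<and> r < 1 \<and>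
    (let Q = 1 - (1 - q\<^sup>2) * \<theta>; \<delta> = (1 - Q) / (2 * Q) in
    (\<forall>(s :: nat \<Rightarrow> real) D m. (\<forall>k. 0 \<le> s k) \<longrightarrow>
     (\<forall>k<m. s (Suc k) \<le> (1 + Q) / 2 * s k + (1 + 1 / \<delta>) * Cs\<^sup>2 * D k) \<longrightarrow>
     (\<forall>i n. (\<Sum>k<2^n. D (i + k)) \<le> M ^ 4 * Cr\<^sup>2 * (bounded_form.rho M) ^ n * s i) \<longrightarrow>
     (\<forall>i j. i \<le> j \<longrightarrow> j \<le> m \<longrightarrow> s j \<le> (1 + Cs * M * Cr)\<^sup>2 * s i) \<longrightarrow> s m \<le> C * r ^ m * s 0))"

text \<open>This factor is the one by which the squared estimator at a fixed discrete function
  shrinks when the refined elements satisfy the Doerfler criterion.\<close>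

lemma reduction_factor_bounds:
  fixes q \<theta> :: real
  assumes "0 < q" "q < 1" "0 < \<theta>" "\<theta> \<le> 1"
  shows "0 < 1 - (1 - q\<^sup>2) * \<theta>" "1 - (1 - q\<^sup>2) * \<theta> < 1"
proof -
  have q2: "0 < q\<^sup>2" "q\<^sup>2 < 1" using assms power_strict_mono[of q 1 2] by auto
  have "(1 - q\<^sup>2) * \<theta> \<le> 1 - q\<^sup>2" using q2 assms by (intro mult_left_le) auto
  then show "0 < 1 - (1 - q\<^sup>2) * \<theta>" using q2 by linarith
  show "1 - (1 - q\<^sup>2) * \<theta> < 1" using q2 assms by simp
qed

lemma linear_rate_exists:
  assumes "0 < q" "q < 1" "0 < \<theta>" "\<theta> \<le> 1" "0 \<le> Cs" "0 \<le> M" "0 \<le> Cr"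
    and rho: "1 \<le> bounded_form.rho M" "bounded_form.rho M < 2"
  shows "\<exists>C r. linear_rate M Cs Cr q \<theta> C r"
proof -
  define Q where "Q = 1 - (1 - q\<^sup>2) * \<theta>"
  have Q: "0 < Q" "Q < 1" unfolding Q_def using reduction_factor_bounds assms by auto
  have "1 \<le> (1 + Cs * M * Cr)\<^sup>2" using assms by (simp add: power2_eq_square algebra_simps)
  from linear_convergence_of_reduction[OF _ _ _ _ this rho,
      of "(1 + Q) / 2" "(1 + 1 / ((1 - Q) / (2 * Q))) * Cs\<^sup>2" "M ^ 4 * Cr\<^sup>2"]
  show ?thesis using Q assms unfolding linear_rate_def Let_def Q_def[symmetric] by auto
qed

lemma power2_add_le_young:
  fixes x y \<delta> :: real
  assumes "0 < \<delta>" shows "(x + y)\<^sup>2 \<le> (1 + \<delta>) * x\<^sup>2 + (1 + 1 / \<delta>) * y\<^sup>2"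
proof -
  have "0 \<le> (sqrt \<delta> * x - y / sqrt \<delta>)\<^sup>2" by simp
  also have "\<dots> = \<delta> * x\<^sup>2 - 2 * x * y + y\<^sup>2 / \<delta>" using assms by (simp add: power2_diff power_mult_distrib power_divide)
  finally show ?thesis by (simp add: power2_sum algebra_simps)
qed

text \<open>\<open>E\<close> is the whole estimator, \<open>R\<close> its part on refined elements
  and \<open>S\<close> its part on the others. If the criterion failed, then
  \<open>R < sqrt \<theta> * E\<close>, the two terms with \<open>L\<close> would cancel in favour
  of \<open>S \<le> sqrt (1 - \<theta>) * E\<close>, and \<open>R\<^sup>2 + S\<^sup>2\<close> would
  fall below \<open>E\<^sup>2\<close>.\<close>

lemma doerfler_of_reduction:
  fixes E R S L \<theta> :: real
  assumes "0 \<le> E" "0 \<le> R" "0 \<le> S" "0 \<le> L" "0 < \<theta>" and E: "E\<^sup>2 = R\<^sup>2 + S\<^sup>2"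
    and S: "S \<le> (sqrt (1 - \<theta>) - L * sqrt \<theta>) * E + L * R" and \<theta>: "\<theta> < 1"
  shows "\<theta> * E\<^sup>2 \<le> R\<^sup>2"
proof (rule ccontr)
  assume "\<not> \<theta> * E\<^sup>2 \<le> R\<^sup>2"
  then have less: "R\<^sup>2 < (sqrt \<theta> * E)\<^sup>2" using assms by (simp add: power_mult_distrib)
  then have "R < sqrt \<theta> * E" by (rule power2_less_imp_less) (use assms in auto)
  then have "L * R \<le> L * (sqrt \<theta> * E)" using assms by (intro mult_left_mono) auto
  then have "S \<le> sqrt (1 - \<theta>) * E" using S by (simp add: algebra_simps)
  then have "S\<^sup>2 \<le> (sqrt (1 - \<theta>) * E)\<^sup>2" using assms by (intro power_mono) auto
  then show False using less E \<theta> assms by (simp add: power_mult_distrib algebra_simps)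
qed

section \<open>Abstract Galerkin estimators over a family of meshes\<close>

locale mesh_family =
  fixes \<TT> :: "'e set set" and R :: "'e set \<Rightarrow> 'e set set"
  assumes R_refl: "H \<in> \<TT> \<Longrightarrow> H \<in> R H"
    and R_mesh: "H \<in> \<TT> \<Longrightarrow> h \<in> R H \<Longrightarrow> h \<in> \<TT>"
    and R_trans: "H \<in> \<TT> \<Longrightarrow> h \<in> R H \<Longrightarrow> k \<in> R h \<Longrightarrow> k \<in> R H"
    and finite_mesh: "H \<in> \<TT> \<Longrightarrow> finite H"

text \<open>\<open>ind H T v\<close> is the square of a refinement indicator.\<close>

locale galerkin_estimator = bounded_form V a M + mesh_family \<TT> R
  for V :: "('x \<Rightarrow> real) set" and a M and \<TT> :: "'e set set" and R +
  fixes X :: "'e set \<Rightarrow> ('x \<Rightarrow> real) set" and U :: "'x \<Rightarrow> real" and UH :: "'e set \<Rightarrow> 'x \<Rightarrow> real"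
    and ind :: "'e set \<Rightarrow> 'e \<Rightarrow> ('x \<Rightarrow> real) \<Rightarrow> real" and Cs Cr q :: real
  assumes X_sub: "H \<in> \<TT> \<Longrightarrow> X H \<subseteq> V"
    and X_nested: "H \<in> \<TT> \<Longrightarrow> h \<in> R H \<Longrightarrow> X H \<subseteq> X h"
    and U_mem: "U \<in> V" and UH_mem: "H \<in> \<TT> \<Longrightarrow> UH H \<in> X H"
    and galerkin: "H \<in> \<TT> \<Longrightarrow> v \<in> X H \<Longrightarrow> a (UH H) v = a U v"
    and ind_nonneg: "0 \<le> ind H T v"
    and Cs: "0 \<le> Cs" and Cr: "0 \<le> Cr" and q: "0 < q" "q < 1"
    and stability: "H \<in> \<TT> \<Longrightarrow> h \<in> R H \<Longrightarrow> v \<in> X h \<Longrightarrow> w \<in> X H \<Longrightarrow> S \<subseteq> h \<inter> H \<Longrightarrow>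
      \<bar>sqrt (\<Sum>T\<in>S. ind h T v) - sqrt (\<Sum>T\<in>S. ind H T w)\<bar>
        \<le> Cs * sqrt (a (\<lambda>x. v x - w x) (\<lambda>x. v x - w x))"
    and reduction: "H \<in> \<TT> \<Longrightarrow> h \<in> R H \<Longrightarrow> w \<in> X H \<Longrightarrow>
      (\<Sum>T\<in>h - H. ind h T w) \<le> q\<^sup>2 * (\<Sum>T\<in>H - h. ind H T w)"
    and reliability: "H \<in> \<TT> \<Longrightarrow>
      sqrt (a (\<lambda>x. U x - UH H x) (\<lambda>x. U x - UH H x)) \<le> Cr * sqrt (\<Sum>T\<in>H. ind H T (UH H))"
begin

definition est2 :: "'e set \<Rightarrow> real" where "est2 H = (\<Sum>T\<in>H. ind H T (UH H))"

lemma est2_nonneg: "0 \<le> est2 H"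
  unfolding est2_def by (intro sum_nonneg ind_nonneg)

lemma UH_V: "H \<in> \<TT> \<Longrightarrow> UH H \<in> V"
  using UH_mem X_sub by blast

lemma zero_diff [simp]: "a (\<lambda>x. 0) (\<lambda>x. 0) = 0"
  using zero_left[OF zero_mem] .

text \<open>Stability with the same function on both meshes has right-hand side zero, so indicators
  agree on common elements; reduction handles the rest.\<close>

lemma refined_le:
  assumes "H \<in> \<TT>" "h \<in> R H" "w \<in> X H"
  shows "(\<Sum>T\<in>h. ind h T w) \<le> (\<Sum>T\<in>H. ind H T w) - (1 - q\<^sup>2) * (\<Sum>T\<in>H - h. ind H T w)"
proof -
  have fin: "finite h" "finite H" using assms finite_mesh R_mesh by blast+
  have wh: "w \<in> X h" using assms X_nested by blast
  have "\<bar>sqrt (\<Sum>T\<in>h \<inter> H. ind h T w) - sqrt (\<Sum>T\<in>h \<inter> H. ind H T w)\<bar> \<le> 0"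
    using stability[OF assms(1,2) wh assms(3) order_refl] by simp
  then have common: "(\<Sum>T\<in>h \<inter> H. ind h T w) = (\<Sum>T\<in>h \<inter> H. ind H T w)" by simp
  have "(\<Sum>T\<in>h. ind h T w) = (\<Sum>T\<in>h \<inter> H. ind h T w) + (\<Sum>T\<in>h - H. ind h T w)"
    using sum.Int_Diff[OF fin(1)] .
  also have "\<dots> \<le> (\<Sum>T\<in>h \<inter> H. ind H T w) + q\<^sup>2 * (\<Sum>T\<in>H - h. ind H T w)"
    using common reduction assms by auto
  also have "(\<Sum>T\<in>h \<inter> H. ind H T w) = (\<Sum>T\<in>H. ind H T w) - (\<Sum>T\<in>H - h. ind H T w)"
    using sum.Int_Diff[OF fin(2), of "\<lambda>T. ind H T w" h] by (simp add: Int_commute)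
  finally show ?thesis by (simp add: algebra_simps)
qed

lemma est_le_add:
  assumes "H \<in> \<TT>" "h \<in> R H"
  shows "sqrt (est2 h) \<le> sqrt (\<Sum>T\<in>h. ind h T (UH H))
    + Cs * sqrt (a (\<lambda>x. UH h x - UH H x) (\<lambda>x. UH h x - UH H x))"
proof -
  have h: "h \<in> \<TT>" using assms R_mesh by blast
  have "UH H \<in> X h" using assms UH_mem X_nested by blast
  \<comment> \<open>With both meshes equal to \<open>h\<close>, stability measures the change of the
    discrete function alone.\<close>
  from stability[OF h R_refl[OF h] UH_mem[OF h] this, of h] show ?thesis
    unfolding est2_def by simp
qed

lemma discrete_cea:
  assumes "H \<in> \<TT>" "h \<in> R H"
  shows "a (\<lambda>x. UH h x - UH H x) (\<lambda>x. UH h x - UH H x) \<le> M\<^sup>2 * a (\<lambda>x. U x - UH H x) (\<lambda>x. U x - UH H x)"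
proof -
  have h: "h \<in> \<TT>" using assms R_mesh by blast
  have "UH H \<in> X h" using assms UH_mem X_nested by blast
  then show ?thesis using assms h by (intro cea) (auto simp: U_mem UH_V galerkin UH_mem)
qed

text \<open>Refinement does not increase the estimator at a fixed function. Exchanging the discrete
  solution costs \<open>Cs\<close> times an increment, which is at most \<open>M\<close> times the
  coarse error and thus at most \<open>M * Cr\<close> times the coarse estimator.\<close>

lemma quasi_monotone:
  assumes "H \<in> \<TT>" "h \<in> R H"
  shows "sqrt (est2 h) \<le> (1 + Cs * M * Cr) * sqrt (est2 H)"
proof -
  have q2: "q\<^sup>2 < 1" using q power_strict_mono[of q 1 2] by simp
  have "(\<Sum>T\<in>h. ind h T (UH H)) \<le> est2 H"
    using refined_le[OF assms UH_mem[OF assms(1)]] q2 sum_nonneg[of "H - h" "\<lambda>T. ind H T (UH H)"] ind_nonneg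
    unfolding est2_def by (smt (verit) mult_nonneg_nonneg)
  then have 1: "sqrt (\<Sum>T\<in>h. ind h T (UH H)) \<le> sqrt (est2 H)" by simp
  have "sqrt (a (\<lambda>x. UH h x - UH H x) (\<lambda>x. UH h x - UH H x))
      \<le> sqrt (M\<^sup>2 * a (\<lambda>x. U x - UH H x) (\<lambda>x. U x - UH H x))"
    using discrete_cea[OF assms] by simp
  also have "\<dots> = M * sqrt (a (\<lambda>x. U x - UH H x) (\<lambda>x. U x - UH H x))"
    using M_nonneg by (simp add: real_sqrt_mult)
  also have "\<dots> \<le> M * (Cr * sqrt (est2 H))"
    using reliability[OF assms(1)] M_nonneg unfolding est2_def by (intro mult_left_mono) auto
  finally have "Cs * sqrt (a (\<lambda>x. UH h x - UH H x) (\<lambda>x. UH h x - UH H x)) \<le> Cs * (M * (Cr * sqrt (est2 H)))"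
    using Cs by (intro mult_left_mono) auto
  then have "sqrt (est2 h) \<le> sqrt (est2 H) + Cs * (M * (Cr * sqrt (est2 H)))"
    using est_le_add[OF assms] 1 by linarith
  then show ?thesis by (simp add: algebra_simps)
qed

text \<open>Young's inequality inflates the factor \<open>Q\<close> to
  \<open>(1 + \<delta>) * Q\<close>; the chosen \<open>\<delta>\<close> puts this at
  \<open>(1 + Q) / 2\<close>, halfway between \<open>Q\<close> and 1.\<close>

lemma estimator_reduction:
  assumes "H \<in> \<TT>" "h \<in> R H" and \<theta>: "0 < \<theta>" "\<theta> \<le> 1"
    and doerfler: "\<theta> * est2 H \<le> (\<Sum>T\<in>H - h. ind H T (UH H))"
    and Q: "Q = 1 - (1 - q\<^sup>2) * \<theta>" and \<delta>: "\<delta> = (1 - Q) / (2 * Q)"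
  shows "est2 h \<le> (1 + Q) / 2 * est2 H
    + (1 + 1 / \<delta>) * Cs\<^sup>2 * a (\<lambda>x. UH h x - UH H x) (\<lambda>x. UH h x - UH H x)"
proof -
  have Qb: "0 < Q" "Q < 1" unfolding Q using reduction_factor_bounds q \<theta> by auto
  have d: "0 < \<delta>" unfolding \<delta> using Qb by auto
  have h: "h \<in> \<TT>" using assms R_mesh by blast
  define D where "D = a (\<lambda>x. UH h x - UH H x) (\<lambda>x. UH h x - UH H x)"
  have D: "0 \<le> D" unfolding D_def using assms(1) h by (intro nonneg diff_mem UH_V)
  have q2: "q\<^sup>2 < 1" using q power_strict_mono[of q 1 2] by simp
  have "(1 - q\<^sup>2) * (\<theta> * est2 H) \<le> (1 - q\<^sup>2) * (\<Sum>T\<in>H - h. ind H T (UH H))"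
    using doerfler q2 by (intro mult_left_mono) auto
  then have 1: "(\<Sum>T\<in>h. ind h T (UH H)) \<le> Q * est2 H"
    using refined_le[OF assms(1,2) UH_mem[OF assms(1)]] unfolding Q est2_def by (simp add: algebra_simps)
  have "est2 h = (sqrt (est2 h))\<^sup>2" using est2_nonneg by simp
  also have "\<dots> \<le> (sqrt (\<Sum>T\<in>h. ind h T (UH H)) + Cs * sqrt D)\<^sup>2"
    using est_le_add[OF assms(1,2)] unfolding D_def by (intro power_mono) (auto simp: est2_nonneg)
  also have "\<dots> \<le> (1 + \<delta>) * (sqrt (\<Sum>T\<in>h. ind h T (UH H)))\<^sup>2 + (1 + 1 / \<delta>) * (Cs * sqrt D)\<^sup>2"
    by (rule power2_add_le_young[OF d])
  also have "\<dots> = (1 + \<delta>) * (\<Sum>T\<in>h. ind h T (UH H)) + (1 + 1 / \<delta>) * Cs\<^sup>2 * D"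
    using D by (simp add: power_mult_distrib sum_nonneg ind_nonneg)
  also have "\<dots> \<le> (1 + \<delta>) * (Q * est2 H) + (1 + 1 / \<delta>) * Cs\<^sup>2 * D"
    using 1 d by (intro add_mono mult_left_mono) auto
  also have "(1 + \<delta>) * (Q * est2 H) = (1 + Q) / 2 * est2 H"
    unfolding \<delta> using Qb by (simp add: field_simps)
  finally show ?thesis unfolding D_def .
qed

text \<open>Reduction, quasi-orthogonality and quasi-monotonicity are exactly the hypotheses
  collected in \<open>linear_rate\<close>. The criterion is asked only for \<open>k < m\<close>, so
  that a finite list of meshes can be continued by repeating its last one.\<close>

lemma linear_convergence:
  fixes f :: "nat \<Rightarrow> 'e set"
  assumes rate: "linear_rate M Cs Cr q \<theta> C r" and \<theta>: "0 < \<theta>" "\<theta> \<le> 1"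
    and f: "\<And>k. f k \<in> \<TT>" and f_R: "\<And>i j. i \<le> j \<Longrightarrow> f j \<in> R (f i)"
    and doerfler: "\<And>k. k < m \<Longrightarrow> \<theta> * est2 (f k) \<le> (\<Sum>T\<in>f k - f (Suc k). ind (f k) T (UH (f k)))"
  shows "est2 (f m) \<le> C * r ^ m * est2 (f 0)"
proof -
  define Q where "Q = 1 - (1 - q\<^sup>2) * \<theta>"
  define \<delta> where "\<delta> = (1 - Q) / (2 * Q)"
  define s where "s k = est2 (f k)" for k
  define D where "D k = a (\<lambda>x. UH (f (Suc k)) x - UH (f k) x) (\<lambda>x. UH (f (Suc k)) x - UH (f k) x)" for k
  have s0: "\<forall>k. 0 \<le> s k" unfolding s_def by (simp add: est2_nonneg)
  have red: "\<forall>k<m. s (Suc k) \<le> (1 + Q) / 2 * s k + (1 + 1 / \<delta>) * Cs\<^sup>2 * D k"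
    unfolding s_def D_def using doerfler \<theta>
    by (intro allI impI estimator_reduction[OF _ _ _ _ _ Q_def \<delta>_def] f f_R) auto
  have orth: "\<forall>i n. (\<Sum>k<2^n. D (i + k)) \<le> M ^ 4 * Cr\<^sup>2 * rho ^ n * s i"
  proof (intro allI)
    fix i n
    have *: "a (UH (f j)) (UH (f k)) = a U (UH (f k))" if "k \<le> j" for j k
    proof -
      have "UH (f k) \<in> X (f j)" using X_nested[OF f f_R[OF that]] UH_mem[OF f] by blast
      then show ?thesis by (rule galerkin[OF f])
    qed
    have "a (\<lambda>x. U x - UH (f i) x) (\<lambda>x. U x - UH (f i) x) \<le> (Cr * sqrt (s i))\<^sup>2"
      using reliability[OF f[of i]] real_sqrt_le_iff sqrt_le_D unfolding s_def est2_def by blast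
    also have "\<dots> = Cr\<^sup>2 * s i" using s0 by (simp add: power_mult_distrib)
    finally have "M ^ 4 * rho ^ n * a (\<lambda>x. U x - UH (f i) x) (\<lambda>x. U x - UH (f i) x)
        \<le> M ^ 4 * rho ^ n * (Cr\<^sup>2 * s i)"
      using rho_bounds M_nonneg by (intro mult_left_mono) auto
    then show "(\<Sum>k<2^n. D (i + k)) \<le> M ^ 4 * Cr\<^sup>2 * rho ^ n * s i"
      using quasi_orthogonality[of U "\<lambda>k. UH (f k)" i n, OF U_mem UH_V[OF f] *]
      unfolding D_def by (simp add: algebra_simps)
  qed
  have mono: "\<forall>i j. i \<le> j \<longrightarrow> j \<le> m \<longrightarrow> s j \<le> (1 + Cs * M * Cr)\<^sup>2 * s i"
  proof (intro allI impI)
    fix i j :: nat assume "i \<le> j"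
    from quasi_monotone[OF f f_R[OF this]]
    have "(sqrt (s j))\<^sup>2 \<le> ((1 + Cs * M * Cr) * sqrt (s i))\<^sup>2"
      unfolding s_def by (intro power_mono) (auto simp: est2_nonneg)
    then show "s j \<le> (1 + Cs * M * Cr)\<^sup>2 * s i" using s0 by (simp add: power_mult_distrib)
  qed
  show ?thesis
    using rate s0 red orth mono unfolding linear_rate_def Let_def Q_def[symmetric] \<delta>_def[symmetric] s_def[symmetric]
    by blast
qed

text \<open>The hypothesis \<open>dstab\<close> is stability followed by discrete reliability, with
  \<open>L\<close> the product of their constants. The factor in \<open>small\<close> is positive
  only for small \<open>\<theta>\<close>, which is where the threshold on \<open>\<theta>\<close>
  originates.\<close>

lemma optimality_of_doerfler:
  assumes "H \<in> \<TT>" "h \<in> R H" and "0 < \<theta>" "\<theta> < 1" "0 \<le> L"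
    and dstab: "\<bar>sqrt (\<Sum>T\<in>h \<inter> H. ind h T (UH h)) - sqrt (\<Sum>T\<in>h \<inter> H. ind H T (UH H))\<bar>
      \<le> L * sqrt (\<Sum>T\<in>H - h. ind H T (UH H))"
    and small: "sqrt (est2 h) \<le> (sqrt (1 - \<theta>) - L * sqrt \<theta>) * sqrt (est2 H)"
  shows "\<theta> * est2 H \<le> (\<Sum>T\<in>H - h. ind H T (UH H))"
proof -
  have fin: "finite h" "finite H" using assms finite_mesh R_mesh by blast+
  have "(\<Sum>T\<in>h \<inter> H. ind h T (UH h)) \<le> est2 h"
    unfolding est2_def by (rule sum_mono2) (auto simp: fin ind_nonneg)
  then have "sqrt (\<Sum>T\<in>h \<inter> H. ind h T (UH h)) \<le> sqrt (est2 h)" by simp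
  then have "sqrt (\<Sum>T\<in>h \<inter> H. ind H T (UH H))
      \<le> (sqrt (1 - \<theta>) - L * sqrt \<theta>) * sqrt (est2 H) + L * sqrt (\<Sum>T\<in>H - h. ind H T (UH H))"
    using dstab small by linarith
  moreover have "est2 H = (\<Sum>T\<in>H - h. ind H T (UH H)) + (\<Sum>T\<in>h \<inter> H. ind H T (UH H))"
    unfolding est2_def using sum.Int_Diff[OF fin(2), of "\<lambda>T. ind H T (UH H)" h] by (simp add: Int_commute)
  ultimately have "\<theta> * (sqrt (est2 H))\<^sup>2 \<le> (sqrt (\<Sum>T\<in>H - h. ind H T (UH H)))\<^sup>2"
    using assms(3-5) by (intro doerfler_of_reduction) (auto simp: est2_nonneg sum_nonneg ind_nonneg)
  then show ?thesis by (simp add: est2_nonneg sum_nonneg ind_nonneg)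
qed

end

section \<open>Smooth functions\<close>

abbreviation smooth :: "(real ^ 'n \<Rightarrow> real) \<Rightarrow> bool" where "smooth \<phi> \<equiv> \<forall>k. C_k k \<phi>"

lemma partial_deriv_eq:
  assumes "(\<phi> has_derivative D) (at x)" shows "partial_deriv i \<phi> x = D (axis i 1)"
  using frechet_derivative_at[OF assms] by (simp add: partial_deriv_def)

lemma C_k_Suc_imp: "C_k (Suc k) \<phi> \<Longrightarrow> C_k k \<phi>"
proof (induction k arbitrary: \<phi>)
  case 0
  then show ?case
    by (auto intro!: continuous_at_imp_continuous_on differentiable_imp_continuous_within)
next
  case (Suc k)
  then show ?case by (metis C_k.simps(2))
qed

lemma C_k_const: "C_k k (\<lambda>x::real ^ 'n. c)"
proof (induction k arbitrary: c)
  case (Suc k)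
  have "partial_deriv i (\<lambda>x::real ^ 'n. c) = (\<lambda>x. 0)" for i by (auto simp: partial_deriv_def)
  with Suc show ?case by simp
qed simp

lemma partial_deriv_add:
  assumes "\<phi> differentiable (at x)" "\<psi> differentiable (at x)"
  shows "partial_deriv i (\<lambda>x. \<phi> x + \<psi> x) x = partial_deriv i \<phi> x + partial_deriv i \<psi> x"
proof -
  obtain D E where D: "(\<phi> has_derivative D) (at x)" and E: "(\<psi> has_derivative E) (at x)"
    using assms by (auto simp: differentiable_def)
  from has_derivative_add[OF D E] show ?thesis
    using partial_deriv_eq[OF D] partial_deriv_eq[OF E] partial_deriv_eq[OF has_derivative_add[OF D E]] by simp
qed

lemma C_k_add: "C_k k \<phi> \<Longrightarrow> C_k k \<psi> \<Longrightarrow> C_k k (\<lambda>x. \<phi> x + \<psi> x)"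
proof (induction k arbitrary: \<phi> \<psi>)
  case 0
  then show ?case by (auto intro: continuous_on_add)
next
  case (Suc k)
  have "partial_deriv i (\<lambda>x. \<phi> x + \<psi> x) = (\<lambda>x. partial_deriv i \<phi> x + partial_deriv i \<psi> x)" for i
    using Suc.prems by (auto simp: partial_deriv_add)
  with Suc show ?case by auto
qed

lemma partial_deriv_mult:
  assumes "\<phi> differentiable (at x)" "\<psi> differentiable (at x)"
  shows "partial_deriv i (\<lambda>x. \<phi> x * \<psi> x) x = \<phi> x * partial_deriv i \<psi> x + partial_deriv i \<phi> x * \<psi> x"
proof -
  obtain D E where D: "(\<phi> has_derivative D) (at x)" and E: "(\<psi> has_derivative E) (at x)"
    using assms by (auto simp: differentiable_def)
  show ?thesis
    using partial_deriv_eq[OF D] partial_deriv_eq[OF E] partial_deriv_eq[OF has_derivative_mult[OF D E]] by simp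
qed

lemma C_k_mult: "C_k k \<phi> \<Longrightarrow> C_k k \<psi> \<Longrightarrow> C_k k (\<lambda>x. \<phi> x * \<psi> x)"
proof (induction k arbitrary: \<phi> \<psi>)
  case 0
  then show ?case by (auto intro: continuous_on_mult)
next
  case (Suc k)
  have "partial_deriv i (\<lambda>x. \<phi> x * \<psi> x) = (\<lambda>x. \<phi> x * partial_deriv i \<psi> x + partial_deriv i \<phi> x * \<psi> x)" for i
    using Suc.prems by (auto simp: partial_deriv_mult)
  moreover have "C_k k \<phi>" "C_k k \<psi>" using Suc.prems C_k_Suc_imp by auto
  ultimately show ?case using Suc by (auto intro: C_k_add)
qed

lemma C_k_prod: "finite I \<Longrightarrow> (\<And>i. i \<in> I \<Longrightarrow> C_k k (\<phi> i)) \<Longrightarrow> C_k k (\<lambda>x. \<Prod>i\<in>I. \<phi> i x)"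
  by (induction I rule: finite_induct) (auto intro: C_k_const C_k_mult)

lemma has_derivative_component: "((\<lambda>x::real ^ 'n. x $ i) has_derivative (\<lambda>x. x $ i)) F"
  by (rule bounded_linear_imp_has_derivative) (rule bounded_linear_vec_nth)

lemma C_k_component: "C_k k (\<lambda>x::real ^ 'n. x $ i)"
proof (cases k)
  case (Suc k)
  have "partial_deriv j (\<lambda>x::real ^ 'n. x $ i) = (\<lambda>x. axis j 1 $ i)" for j
    by (auto simp: partial_deriv_eq[OF has_derivative_component])
  with Suc show ?thesis by (auto simp: differentiable_def C_k_const intro: has_derivative_component)
qed (auto intro: continuous_intros)

section \<open>Smooth bumps supported on boxes\<close>

text \<open>The polynomial factor makes the class closed under differentiation, so that smoothness
  follows by induction on the order, for all \<open>p\<close> simultaneously.\<close>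

definition flat :: "real poly \<Rightarrow> real \<Rightarrow> real" where
  "flat p t = (if t > 0 then poly p (1 / t) * exp (- (1 / t)) else 0)"

lemma tendsto_poly_div_exp: "((\<lambda>s::real. poly p s * exp (- s)) \<longlongrightarrow> 0) at_top"
proof -
  have "((\<lambda>s::real. \<Sum>i\<le>degree p. coeff p i * (s ^ i / exp s)) \<longlongrightarrow> (\<Sum>i\<le>degree p. coeff p i * 0)) at_top"
    by (intro tendsto_sum tendsto_mult tendsto_const tendsto_power_div_exp_0)
  then show ?thesis by (simp add: poly_altdef exp_minus field_simps sum_distrib_left)
qed

lemma has_real_derivative_flat:
  "(flat p has_real_derivative flat ([:0, 0, 1:] * (p - pderiv p)) t) (at t)"
proof (cases t "0::real" rule: linorder_cases)
  case less
  have "((\<lambda>t. 0) has_real_derivative 0) (at t)" by simp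
  then have "(flat p has_real_derivative 0) (at t)"
    by (rule has_field_derivative_transform_within_open[of _ _ _ "{..<0}"]) (use less in \<open>auto simp: flat_def\<close>)
  then show ?thesis using less by (simp add: flat_def)
next
  case greater
  have "((\<lambda>t. poly p (1 / t) * exp (- (1 / t))) has_real_derivative
      (poly p (1 / t) * (exp (- (1 / t)) * (1 / t\<^sup>2)) + poly (pderiv p) (1 / t) * (- 1 / t\<^sup>2) * exp (- (1 / t)))) (at t)"
    using greater
    by (auto intro!: derivative_eq_intros DERIV_chain2[OF poly_DERIV] simp: power2_eq_square field_simps)
  then have "(flat p has_real_derivative
      (poly p (1 / t) * (exp (- (1 / t)) * (1 / t\<^sup>2)) + poly (pderiv p) (1 / t) * (- 1 / t\<^sup>2) * exp (- (1 / t)))) (at t)"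
    by (rule has_field_derivative_transform_within_open[of _ _ _ "{0<..}"]) (use greater in \<open>auto simp: flat_def\<close>)
  then show ?thesis using greater by (simp add: flat_def power2_eq_square field_simps)
next
  case equal
  have "((\<lambda>h. flat p h / h) \<longlongrightarrow> 0) (at_left 0)"
    by (rule Lim_transform_eventually[OF tendsto_const[of 0]])
       (auto simp: eventually_at_filter flat_def)
  moreover have "((\<lambda>h. flat p h / h) \<longlongrightarrow> 0) (at_right 0)"
  proof (rule Lim_transform_eventually)
    \<comment> \<open>Dividing by \<open>h\<close> multiplies the polynomial in \<open>1 / h\<close>
      by its variable, which is \<open>pCons 0 p\<close>.\<close>
    show "((\<lambda>h::real. poly (pCons 0 p) (inverse h) * exp (- (inverse h))) \<longlongrightarrow> 0) (at_right 0)"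
      using filterlim_compose[OF tendsto_poly_div_exp[of "pCons 0 p"] filterlim_inverse_at_top_right] .
    show "\<forall>\<^sub>F h in at_right 0. poly (pCons 0 p) (inverse h) * exp (- (inverse h)) = flat p h / h"
      by (auto simp: eventually_at_filter flat_def field_simps)
  qed
  ultimately have "((\<lambda>h. flat p h / h) \<longlongrightarrow> 0) (at 0)" by (simp add: filterlim_split_at)
  then show ?thesis using equal by (simp add: has_field_derivative_iff flat_def)
qed

lemma C_k_flat_affine: "C_k k (\<lambda>x::real ^ 'n. flat p (c * x $ i + d))"
proof (induction k arbitrary: p)
  case 0
  have "continuous_on UNIV (flat p)"
    using has_real_derivative_flat DERIV_isCont by (blast intro: continuous_at_imp_continuous_on)
  then have "continuous_on UNIV (flat p \<circ> (\<lambda>x::real ^ 'n. c * x $ i + d))"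
    by (intro continuous_on_compose continuous_intros) (auto intro: continuous_on_subset)
  then show ?case by (simp add: o_def)
next
  case (Suc k)
  define q where "q = [:0, 0, 1:] * (p - pderiv p)"
  have D: "((\<lambda>x::real ^ 'n. flat p (c * x $ i + d)) has_derivative
      (\<lambda>h. flat q (c * x $ i + d) * (c * h $ i))) (at x)" for x
  proof -
    have "((\<lambda>x::real ^ 'n. c * x $ i + d) has_derivative (\<lambda>h. c * h $ i)) (at x)"
      by (auto intro!: derivative_eq_intros has_derivative_component)
    from has_derivative_compose[OF this has_real_derivative_flat[unfolded has_field_derivative_def, of p]]
    show ?thesis by (simp add: q_def)
  qed
  have "partial_deriv j (\<lambda>x::real ^ 'n. flat p (c * x $ i + d))
      = (\<lambda>x. flat q (c * x $ i + d) * (c * axis j 1 $ i))" for j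
    using partial_deriv_eq[OF D] by auto
  then show ?case using Suc[of q] D by (auto simp: differentiable_def intro: C_k_mult C_k_const)
qed

text \<open>Each factor is of the form exp (-1 / ((n + 1) * s)) for positive distance
  \<open>s\<close> from a face, and zero otherwise. The support is the closed box for every
  \<open>n\<close>, and the limit is the indicator of the open box. The affine arguments are spelled
  out to match \<open>C_k_flat_affine\<close>.\<close>

definition box_bump :: "real ^ 'n \<Rightarrow> real ^ 'n \<Rightarrow> nat \<Rightarrow> real ^ 'n \<Rightarrow> real" where
  "box_bump l r n x = (\<Prod>i\<in>UNIV. flat 1 (real (Suc n) * x $ i + - real (Suc n) * l $ i)
                          * flat 1 (- real (Suc n) * x $ i + real (Suc n) * r $ i))"

lemma flat_pos_iff: "flat 1 (real (Suc n) * s) \<noteq> 0 \<longleftrightarrow> 0 < s"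
  by (simp add: flat_def zero_less_mult_iff del: of_nat_Suc)

lemma box_bump_alt:
  "box_bump l r n x = (\<Prod>i\<in>UNIV. flat 1 (real (Suc n) * (x $ i - l $ i)) * flat 1 (real (Suc n) * (r $ i - x $ i)))"
  unfolding box_bump_def by (intro prod.cong refl) (simp add: algebra_simps)

lemma box_bump_nonzero_iff: "box_bump l r n x \<noteq> 0 \<longleftrightarrow> x \<in> box l r"
  unfolding box_bump_alt by (auto simp: mem_box_cart flat_pos_iff simp del: of_nat_Suc)

lemma flat_bounds: "0 \<le> flat 1 s" "flat 1 s \<le> 1"
  by (auto simp: flat_def)

lemma box_bump_bounds: "0 \<le> box_bump l r n x" "box_bump l r n x \<le> 1"
  unfolding box_bump_alt
  by (auto intro!: prod_nonneg prod_le_1 mult_nonneg_nonneg mult_le_one simp: flat_bounds simp del: of_nat_Suc)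

lemma box_bump_test_function:
  assumes "cbox l r \<subseteq> \<Omega>" shows "box_bump l r n \<in> test_functions \<Omega>"
proof -
  have *: "{x. box_bump l r n x \<noteq> 0} = box l r" using box_bump_nonzero_iff by blast
  have sub: "closure (box l r) \<subseteq> cbox l r" by (simp add: box_subset_cbox closure_minimal closed_cbox)
  have "C_k k (box_bump l r n)" for k
    unfolding box_bump_def by (intro C_k_prod C_k_mult C_k_flat_affine) auto
  moreover have "compact (closure (box l r))" using bounded_box by (simp add: compact_closure)
  ultimately show ?thesis using sub assms by (simp add: test_functions_def *)
qed

lemma flat_tendsto: "(\<lambda>n. flat 1 (real (Suc n) * s)) \<longlonglongrightarrow> (if 0 < s then 1 else 0)"
proof (cases "0 < s")
  case True
  have "(\<lambda>n. exp (- (1 / s * inverse (real (Suc n))))) \<longlonglongrightarrow> exp (- (1 / s * 0))"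
    by (intro tendsto_exp tendsto_minus tendsto_mult tendsto_const LIMSEQ_inverse_real_of_nat)
  moreover have "flat 1 (real (Suc n) * s) = exp (- (1 / s * inverse (real (Suc n))))" for n
    using True by (simp add: flat_def zero_less_mult_iff field_simps del: of_nat_Suc)
  ultimately show ?thesis using True by simp
next
  case False
  then have "flat 1 (real (Suc n) * s) = 0" for n using flat_pos_iff by blast
  with False show ?thesis by simp
qed

lemma box_bump_tendsto: "(\<lambda>n. box_bump l r n x) \<longlonglongrightarrow> indicator (box l r) x"
proof -
  have "(\<lambda>n. box_bump l r n x) \<longlonglongrightarrow>
      (\<Prod>i\<in>UNIV. (if 0 < x $ i - l $ i then 1 else 0) * (if 0 < r $ i - x $ i then 1 else 0))"
    unfolding box_bump_alt by (intro tendsto_prod tendsto_mult flat_tendsto)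
  also have "(\<Prod>i\<in>UNIV. (if 0 < x $ i - l $ i then 1 else 0) * (if 0 < r $ i - x $ i then 1 else 0))
      = (indicator (box l r) x :: real)"
  proof (cases "x \<in> box l r")
    case True
    then show ?thesis by (simp add: mem_box_cart)
  next
    case False
    then obtain i where "\<not> (l $ i < x $ i \<and> x $ i < r $ i)" by (auto simp: mem_box_cart)
    then have "\<exists>i. (if 0 < x $ i - l $ i then 1 else 0) * (if 0 < r $ i - x $ i then 1 else (0::real)) = 0" by auto
    then show ?thesis using False by (auto simp: prod_zero_iff)
  qed
  finally show ?thesis .
qed

section \<open>The fundamental lemma of the calculus of variations\<close>

text \<open>Boxes are an intersection-stable generator of the Borel sets, so a Dynkin argument
  extends vanishing integrals to all Borel sets; \<open>total\<close> serves the
  complements.\<close>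

lemma AE_zero_of_box_integrals:
  fixes f :: "'a::euclidean_space \<Rightarrow> real"
  assumes int: "integrable lborel f" and total: "integral\<^sup>L lborel f = 0"
    and box: "\<And>l r. (LINT x:box l r|lborel. f x) = 0"
  shows "AE x in lborel. f x = 0"
proof (rule sigma_finite_measure.density_zero[OF sigma_finite_lborel int])
  fix A assume "A \<in> sets (lborel :: 'a measure)"
  then have "Int_stable (range (\<lambda>(a, b). box a b :: 'a set))" "range (\<lambda>(a, b). box a b :: 'a set) \<subseteq> Pow UNIV"
      "A \<in> sigma_sets UNIV (range (\<lambda>(a, b). box a b :: 'a set))"
    by (auto simp: Int_stable_def box_Int_box borel_eq_box)
  then show "(LINT x:A|lborel. f x) = 0"
  proof (induction rule: sigma_sets_induct_disjoint)
    case (basic A)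
    then show ?case using box by auto
  next
    case (compl A)
    have A: "A \<in> sets lborel" using compl(1) by (simp add: borel_eq_box)
    have "(LINT x:(UNIV - A)|lborel. f x) = (LINT x|lborel. f x - indicator A x *\<^sub>R f x)"
      unfolding set_lebesgue_integral_def by (intro Bochner_Integration.integral_cong) (auto simp: indicator_def)
    also have "\<dots> = 0"
      using total compl(2) A int unfolding set_lebesgue_integral_def
      by (subst Bochner_Integration.integral_diff) (auto intro: integrable_mult_indicator[where f = f, simplified])
    finally show ?case .
  next
    case (union A)
    have A: "A i \<in> sets lborel" for i using union(2) by (auto simp: borel_eq_box)
    have "set_integrable lborel (\<Union>i. A i) f"
      unfolding set_integrable_def by (intro integrable_mult_indicator int sets.countable_UN) (use A in auto)
    then have "(LINT x:(\<Union>i. A i)|lborel. f x) = (\<Sum>i. (LINT x:(A i)|lborel. f x))"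
      using A union(1) by (intro lebesgue_integral_countable_add) (auto simp: disjoint_family_on_def)
    then show ?case using union(3) by simp
  qed (auto simp: set_lebesgue_integral_def)
qed

text \<open>Bumps increase the class of tests from smooth functions to box indicators, by dominated
  convergence with majorant \<open>\<bar>h\<bar>\<close>.\<close>

lemma integral_box_zero:
  fixes h :: "real ^ 'n \<Rightarrow> real"
  assumes \<Omega>: "open \<Omega>" and int: "integrable (lebesgue_on \<Omega>) h"
    and test: "\<And>\<phi>. \<phi> \<in> test_functions \<Omega> \<Longrightarrow> (LINT x|lebesgue_on \<Omega>. h x * \<phi> x) = 0"
    and lr: "cbox l r \<subseteq> \<Omega>"
  shows "(LINT x|lebesgue_on \<Omega>. h x * indicator (box l r) x) = 0"
proof -
  have meas: "\<phi> \<in> borel_measurable (lebesgue_on \<Omega>)" if "\<phi> \<in> borel_measurable borel" for \<phi> :: "real ^ 'n \<Rightarrow> real"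
    using that by (intro measurable_restrict_space1 measurable_completion) simp
  have bump: "box_bump l r n \<in> borel_measurable borel" for n
    using box_bump_test_function[OF lr, of n]
    by (auto simp: test_functions_def intro!: borel_measurable_continuous_onI dest: spec[of _ 0])
  have "(\<lambda>n. LINT x|lebesgue_on \<Omega>. h x * box_bump l r n x) \<longlonglongrightarrow> (LINT x|lebesgue_on \<Omega>. h x * indicator (box l r) x)"
  proof (rule integral_dominated_convergence[where w = "\<lambda>x. \<bar>h x\<bar>"])
    show "AE x in lebesgue_on \<Omega>. (\<lambda>n. h x * box_bump l r n x) \<longlonglongrightarrow> h x * indicat_real (box l r) x"
      by (auto intro!: tendsto_mult box_bump_tendsto)
    show "AE x in lebesgue_on \<Omega>. norm (h x * box_bump l r n x) \<le> \<bar>h x\<bar>" for n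
      using box_bump_bounds[of l r n] by (auto simp: abs_mult intro!: mult_left_le)
    show "(\<lambda>x. h x * box_bump l r n x) \<in> borel_measurable (lebesgue_on \<Omega>)" for n
      using borel_measurable_integrable[OF int] meas[OF bump] by (rule borel_measurable_times)
    show "(\<lambda>x. h x * indicat_real (box l r) x) \<in> borel_measurable (lebesgue_on \<Omega>)"
      using borel_measurable_integrable[OF int] by (rule borel_measurable_times) (intro meas, simp)
  qed (use int in auto)
  moreover have "(LINT x|lebesgue_on \<Omega>. h x * box_bump l r n x) = 0" for n
    using test box_bump_test_function[OF lr] by blast
  ultimately show ?thesis by (simp add: LIMSEQ_const_iff)
qed

text \<open>Only boxes with closure in \<open>\<Omega>\<close> are accessible to test functions. The
  function is therefore localised to one such box at a time, and countably many of them exhaust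
  \<open>\<Omega>\<close>.\<close>

lemma fundamental_lemma:
  fixes h :: "real ^ 'n \<Rightarrow> real"
  assumes \<Omega>: "open \<Omega>" and int: "integrable (lebesgue_on \<Omega>) h"
    and test: "\<And>\<phi>. \<phi> \<in> test_functions \<Omega> \<Longrightarrow> (LINT x|lebesgue_on \<Omega>. h x * \<phi> x) = 0"
  shows "AE x in lebesgue_on \<Omega>. h x = 0"
proof -
  have \<Omega>_sets: "\<Omega> \<inter> space lebesgue \<in> sets lebesgue" using \<Omega> by (auto intro: borel_open)
  define h0 where "h0 = (\<lambda>x. indicator \<Omega> x * h x)"
  have h0: "integrable lebesgue h0"
    unfolding h0_def using int integrable_restrict_space[OF \<Omega>_sets, of h] by simp
  \<comment> \<open>\<open>h0\<close> is Lebesgue measurable, while the box criterion is about Borel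
    sets; a Borel representative connects the two.\<close>
  then obtain g where g: "g \<in> borel_measurable lborel" and gh: "AE x in lborel. h0 x = g x"
    using completion_ex_borel_measurable_real[of h0 lborel] by auto
  have gh': "AE x in lebesgue. h0 x = g x" using gh by (rule AE_completion)
  have ae_box: "AE x in lebesgue. x \<in> box l r \<longrightarrow> h0 x = 0" if lr: "cbox l r \<subseteq> \<Omega>" for l r :: "real ^ 'n"
  proof -
    define f where "f = (\<lambda>x. indicator (box l r) x * g x)"
    have f_meas: "f \<in> borel_measurable lborel" unfolding f_def using g by simp
    have eq: "(LINT x:box l' r'|lborel. f x) = 0" for l' r'
    proof -
      \<comment> \<open>Intersecting an arbitrary box with \<open>box l r\<close> gives a box again,
        and its closure stays in \<open>\<Omega>\<close>.\<close>
      obtain c d where cd: "box l r \<inter> box l' r' = box c d" using box_Int_box[of l r l' r'] by blast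
      have sub: "cbox c d \<subseteq> \<Omega>" if "box c d \<noteq> {}"
      proof -
        have "box c d \<subseteq> cbox l r" using cd box_subset_cbox[of l r] by blast
        then have "closure (box c d) \<subseteq> cbox l r" by (rule closure_minimal) (rule closed_cbox)
        then show ?thesis using lr closure_box[OF that] by simp
      qed
      have "(LINT x:box l' r'|lborel. f x) = (LINT x|lborel. indicator (box c d) x * g x)"
        unfolding set_lebesgue_integral_def f_def cd[symmetric]
        by (intro Bochner_Integration.integral_cong) (auto simp: indicator_def)
      also have "\<dots> = (LINT x|lebesgue. indicator (box c d) x * g x)"
        using g by (intro integral_completion[symmetric]) auto
      also have "\<dots> = (LINT x|lebesgue. indicator (box c d) x * h0 x)"
      proof (rule integral_cong_AE)
        show "(\<lambda>x. indicator (box c d) x * g x) \<in> borel_measurable lebesgue"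
          using g by (intro measurable_completion) auto
        show "(\<lambda>x. indicator (box c d) x * h0 x) \<in> borel_measurable lebesgue"
          using borel_measurable_integrable[OF h0] by (rule borel_measurable_times[rotated]) (intro measurable_completion, simp)
        show "AE x in lebesgue. indicator (box c d) x * g x = indicator (box c d) x * h0 x"
          using gh' by eventually_elim simp
      qed
      also have "\<dots> = (LINT x|lebesgue_on \<Omega>. h x * indicator (box c d) x)"
        unfolding h0_def integral_restrict_space[OF \<Omega>_sets]
        by (intro Bochner_Integration.integral_cong refl) (simp add: indicator_def)
      also have "\<dots> = 0"
        using integral_box_zero[OF \<Omega> int test] sub by (cases "box c d = {}") auto
      finally show ?thesis .
    qed
    have "integrable lebesgue (\<lambda>x. indicator (box l r) x * g x)"
    proof -
      have "integrable lebesgue g"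
        using integrable_cong_AE[OF borel_measurable_integrable[OF h0] measurable_completion[OF g] gh'] h0 by blast
      then show ?thesis using integrable_mult_indicator[of "box l r" lebesgue g] by simp
    qed
    then have f_int: "integrable lborel f"
      unfolding f_def[symmetric] using integrable_completion[OF f_meas] by simp
    have "integral\<^sup>L lborel f = (LINT x:box l r|lborel. f x)"
      unfolding set_lebesgue_integral_def f_def by (intro Bochner_Integration.integral_cong) (auto simp: indicator_def)
    then have "AE x in lborel. f x = 0"
      using AE_zero_of_box_integrals[OF f_int] eq by simp
    then have "AE x in lebesgue. f x = 0" by (rule AE_completion)
    with gh' show ?thesis by eventually_elim (auto simp: f_def)
  qed
  have ae_cbox: "AE x in lebesgue. x \<in> cbox l r \<longrightarrow> h0 x = 0" if lr: "cbox l r \<subseteq> \<Omega>" for l r :: "real ^ 'n"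
  proof -
    have "AE x in lebesgue. x \<notin> cbox l r - box l r"
      using negligible_frontier_interval[of l r] by (intro AE_not_in) (simp add: negligible_iff_null_sets)
    with ae_box[OF lr] show ?thesis by eventually_elim auto
  qed
  \<comment> \<open>The countable cover consists of closed boxes with rational corners, hence the
    earlier passage from open to closed boxes through the negligible boundary.\<close>
  let ?a = "\<lambda>f :: real ^ 'n \<Rightarrow> real \<times> real. (\<Sum>i\<in>Basis. fst (f i) *\<^sub>R i)"
  let ?b = "\<lambda>f :: real ^ 'n \<Rightarrow> real \<times> real. (\<Sum>i\<in>Basis. snd (f i) *\<^sub>R i)"
  let ?I = "{f\<in>Basis \<rightarrow>\<^sub>E \<rat> \<times> \<rat>. cbox (?a f) (?b f) \<subseteq> \<Omega>}"
  have "countable (Basis \<rightarrow>\<^sub>E (\<rat> \<times> \<rat>) :: (real ^ 'n \<Rightarrow> real \<times> real) set)"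
    by (intro countable_PiE countable_SIGMA countable_rat) auto
  then have count: "countable ?I" by (rule countable_subset[rotated]) blast
  have cover: "\<Omega> = (\<Union>f\<in>?I. cbox (?a f) (?b f))" by (rule open_UNION_cbox[OF \<Omega>])
  have "AE x in lebesgue. \<forall>f\<in>?I. x \<in> cbox (?a f) (?b f) \<longrightarrow> h0 x = 0"
    unfolding AE_ball_countable[OF count] by (intro ballI ae_cbox) simp
  then have "AE x in lebesgue. x \<in> \<Omega> \<longrightarrow> h x = 0"
  proof eventually_elim
    case (elim x)
    show ?case
    proof
      assume x: "x \<in> \<Omega>"
      with cover obtain f where "f \<in> ?I" "x \<in> cbox (?a f) (?b f)" by (metis (no_types, lifting) UN_E)
      then have "h0 x = 0" using elim by blast
      with x show "h x = 0" by (simp add: h0_def)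
    qed
  qed
  then show ?thesis using AE_restrict_space_iff[OF \<Omega>_sets] by simp
qed

section \<open>Calculus of test functions\<close>

lemma test_function_C_k: "\<phi> \<in> test_functions \<Omega> \<Longrightarrow> C_k k \<phi>"
  by (simp add: test_functions_def)

lemma test_function_zero:
  assumes "\<phi> \<in> test_functions \<Omega>" "x \<notin> \<Omega>" shows "\<phi> x = 0"
  using assms closure_subset[of "{x. \<phi> x \<noteq> 0}"] unfolding test_functions_def by blast

lemma test_function_continuous: "\<phi> \<in> test_functions \<Omega> \<Longrightarrow> continuous_on UNIV \<phi>"
  using test_function_C_k[of \<phi> \<Omega> 0] by simp

lemma test_function_differentiable: "\<phi> \<in> test_functions \<Omega> \<Longrightarrow> \<phi> differentiable (at x)"
  using test_function_C_k[of \<phi> \<Omega> "Suc 0"] by simp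

lemma test_functionI:
  assumes "smooth \<psi>" "\<phi> \<in> test_functions \<Omega>" "{x. \<psi> x \<noteq> 0} \<subseteq> closure {x. \<phi> x \<noteq> 0}"
  shows "\<psi> \<in> test_functions \<Omega>"
proof -
  have sub: "closure {x. \<psi> x \<noteq> 0} \<subseteq> closure {x. \<phi> x \<noteq> 0}" using assms(3) by (rule closure_minimal) simp
  have \<phi>: "compact (closure {x. \<phi> x \<noteq> 0})" "closure {x. \<phi> x \<noteq> 0} \<subseteq> \<Omega>"
    using assms(2) unfolding test_functions_def by blast+
  have "compact (closure {x. \<psi> x \<noteq> 0})"
    using \<phi>(1) sub by (meson closed_closure compact_imp_bounded bounded_subset compact_eq_bounded_closed)
  then show ?thesis using assms(1) \<phi> sub unfolding test_functions_def by blast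
qed

lemma test_function_mult:
  assumes "smooth \<psi>" "\<phi> \<in> test_functions \<Omega>" shows "(\<lambda>x. \<psi> x * \<phi> x) \<in> test_functions \<Omega>"
proof (rule test_functionI[OF _ assms(2)])
  show "smooth (\<lambda>x. \<psi> x * \<phi> x)" using assms by (auto intro: C_k_mult test_function_C_k)
  show "{x. \<psi> x * \<phi> x \<noteq> 0} \<subseteq> closure {x. \<phi> x \<noteq> 0}"
    by (rule order_trans[OF _ closure_subset]) auto
qed

lemma test_function_add:
  assumes "\<phi> \<in> test_functions \<Omega>" "\<psi> \<in> test_functions \<Omega>" shows "(\<lambda>x. \<phi> x + \<psi> x) \<in> test_functions \<Omega>"
proof -
  let ?S = "closure {x. \<phi> x \<noteq> 0} \<union> closure {x. \<psi> x \<noteq> 0}"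
  have sub: "closure {x. \<phi> x + \<psi> x \<noteq> 0} \<subseteq> ?S"
    unfolding closure_Un[symmetric] by (intro closure_mono) auto
  have "compact ?S" "?S \<subseteq> \<Omega>" using assms unfolding test_functions_def by (blast intro: compact_Un)+
  moreover have "smooth (\<lambda>x. \<phi> x + \<psi> x)" using assms by (auto intro: C_k_add test_function_C_k)
  moreover have "compact (closure {x. \<phi> x + \<psi> x \<noteq> 0})"
    using \<open>compact ?S\<close> sub by (meson closed_closure compact_imp_bounded bounded_subset compact_eq_bounded_closed)
  ultimately show ?thesis using sub unfolding test_functions_def by blast
qed

lemma test_function_scale: "\<phi> \<in> test_functions \<Omega> \<Longrightarrow> (\<lambda>x. r * \<phi> x) \<in> test_functions \<Omega>"
  using test_function_mult[of "\<lambda>x. r" \<phi> \<Omega>] by (simp add: C_k_const)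

lemma test_function_partial_deriv:
  assumes "\<phi> \<in> test_functions \<Omega>" shows "partial_deriv i \<phi> \<in> test_functions \<Omega>"
proof (rule test_functionI[OF _ assms])
  show "smooth (partial_deriv i \<phi>)" using test_function_C_k[OF assms, of "Suc _"] by auto
  show "{x. partial_deriv i \<phi> x \<noteq> 0} \<subseteq> closure {x. \<phi> x \<noteq> 0}"
  proof (rule ccontr)
    assume "\<not> ?thesis"
    then obtain x where x: "partial_deriv i \<phi> x \<noteq> 0" "x \<in> - closure {x. \<phi> x \<noteq> 0}" by auto
    have "(\<phi> has_derivative (\<lambda>h. 0)) (at x)"
    proof (rule has_derivative_transform_within_open[of "\<lambda>x. 0"])
      show "open (- closure {x. \<phi> x \<noteq> 0})" by auto
      show "0 = \<phi> y" if "y \<in> - closure {x. \<phi> x \<noteq> 0}" for y using that closure_subset[of "{x. \<phi> x \<noteq> 0}"] by auto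
    qed (use x in auto)
    then show False using x(1) partial_deriv_eq[of \<phi> "\<lambda>h. 0" x i] by simp
  qed
qed

lemma test_function_bounded:
  assumes "\<phi> \<in> test_functions \<Omega>" obtains B where "0 \<le> B" "\<And>x. \<bar>\<phi> x\<bar> \<le> B"
proof -
  have "compact (\<phi> ` closure {x. \<phi> x \<noteq> 0})"
    using assms test_function_continuous[OF assms]
    by (intro compact_continuous_image) (auto simp: test_functions_def intro: continuous_on_subset)
  then obtain B where B: "\<forall>y\<in>\<phi> ` closure {x. \<phi> x \<noteq> 0}. norm y \<le> B"
    using compact_imp_bounded bounded_iff by metis
  have "\<bar>\<phi> x\<bar> \<le> max B 0" for x
  proof (cases "\<phi> x = 0")
    case False
    then have "x \<in> closure {x. \<phi> x \<noteq> 0}" using closure_subset[of "{x. \<phi> x \<noteq> 0}"] by blast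
    then have "\<bar>\<phi> x\<bar> \<le> B" using B by auto
    then show ?thesis by simp
  qed auto
  then show ?thesis using that[of "max B 0"] by auto
qed

lemma test_function_borel: "\<phi> \<in> test_functions \<Omega> \<Longrightarrow> \<phi> \<in> borel_measurable borel"
  using test_function_continuous by (rule borel_measurable_continuous_onI)

lemma test_function_integrable:
  assumes "\<phi> \<in> test_functions \<Omega>" shows "integrable lborel \<phi>"
proof -
  let ?S = "closure {x. \<phi> x \<noteq> 0}"
  have S: "compact ?S" using assms by (auto simp: test_functions_def)
  have "integrable lborel (\<lambda>x. indicator ?S x *\<^sub>R \<phi> x)"
    using S test_function_continuous[OF assms] borel_integrable_compact[of ?S \<phi>]
    by (auto intro: continuous_on_subset)
  also have "(\<lambda>x. indicator ?S x *\<^sub>R \<phi> x) = \<phi>"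
  proof
    fix x show "indicator ?S x *\<^sub>R \<phi> x = \<phi> x"
      using closure_subset[of "{x. \<phi> x \<noteq> 0}"] by (cases "\<phi> x = 0") (auto simp: indicator_def)
  qed
  finally show ?thesis .
qed

lemma integral_test_function:
  assumes "open \<Omega>" "\<phi> \<in> test_functions \<Omega>"
  shows "integral\<^sup>L (lebesgue_on \<Omega>) \<phi> = integral\<^sup>L lborel \<phi>" "integrable (lebesgue_on \<Omega>) \<phi>"
proof -
  have \<Omega>_sets: "\<Omega> \<inter> space lebesgue \<in> sets lebesgue" using assms(1) by (auto intro: borel_open)
  have eq: "(\<lambda>x. indicator \<Omega> x *\<^sub>R \<phi> x) = \<phi>"
  proof
    fix x show "indicator \<Omega> x *\<^sub>R \<phi> x = \<phi> x"
      using test_function_zero[OF assms(2), of x] by (cases "x \<in> \<Omega>") auto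
  qed
  show "integral\<^sup>L (lebesgue_on \<Omega>) \<phi> = integral\<^sup>L lborel \<phi>"
    using test_function_borel[OF assms(2)] unfolding integral_restrict_space[OF \<Omega>_sets] eq by (simp add: integral_completion)
  show "integrable (lebesgue_on \<Omega>) \<phi>"
    using test_function_borel[OF assms(2)] test_function_integrable[OF assms(2)]
    unfolding integrable_restrict_space[OF \<Omega>_sets] eq by (simp add: integrable_completion)
qed

section \<open>Weak gradients\<close>

lemma has_real_derivative_along_axis:
  fixes \<phi> :: "real ^ 'n \<Rightarrow> real"
  assumes "\<phi> differentiable (at (x + s *\<^sub>R axis i 1))"
  shows "((\<lambda>s. \<phi> (x + s *\<^sub>R axis i 1)) has_real_derivative partial_deriv i \<phi> (x + s *\<^sub>R axis i 1)) (at s)"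
proof -
  obtain D where D: "(\<phi> has_derivative D) (at (x + s *\<^sub>R axis i 1))" using assms by (auto simp: differentiable_def)
  have "((\<lambda>s. x + s *\<^sub>R axis i 1) has_derivative (\<lambda>h. h *\<^sub>R axis i 1)) (at s)"
    by (auto intro!: derivative_eq_intros)
  from has_derivative_compose[OF this D] have "((\<lambda>s. \<phi> (x + s *\<^sub>R axis i 1)) has_derivative (\<lambda>h. D (h *\<^sub>R axis i 1))) (at s)" .
  moreover have "D (h *\<^sub>R axis i 1) = partial_deriv i \<phi> (x + s *\<^sub>R axis i 1) * h" for h
    using partial_deriv_eq[OF D, of i] linear_cmul[OF has_derivative_linear[OF D]] by simp
  ultimately show ?thesis by (simp add: has_field_derivative_def)
qed

text \<open>By translation invariance the difference quotients of \<open>\<phi>\<close> have integral zero.\<close>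

lemma integral_partial_deriv_zero:
  assumes \<phi>: "\<phi> \<in> test_functions (\<Omega> :: (real ^ 'n) set)"
  shows "integral\<^sup>L lborel (partial_deriv i \<phi>) = 0"
proof -
  define e :: "real ^ 'n" where "e = axis i 1"
  define t where "t n = inverse (real (Suc n))" for n
  have t: "0 < t n" "t n \<le> 1" for n unfolding t_def by (auto simp: field_simps)
  have int: "integrable lborel \<phi>" by (rule test_function_integrable[OF \<phi>])
  have trans: "integrable lborel (\<lambda>x. \<phi> (c + x))" "(LINT x|lborel. \<phi> (c + x)) = integral\<^sup>L lborel \<phi>" for c
  proof -
    have m: "(+) c \<in> measurable lborel borel" by simp
    have "integrable (distr lborel borel ((+) c)) \<phi>" unfolding lborel_distr_plus by (rule int)
    then show "integrable lborel (\<lambda>x. \<phi> (c + x))"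
      using test_function_borel[OF \<phi>] by (subst (asm) integrable_distr_eq) auto
    have "integral\<^sup>L (distr lborel borel ((+) c)) \<phi> = (LINT x|lborel. \<phi> (c + x))"
      using test_function_borel[OF \<phi>] by (subst integral_distr) auto
    then show "(LINT x|lborel. \<phi> (c + x)) = integral\<^sup>L lborel \<phi>" unfolding lborel_distr_plus by simp
  qed
  define D where "D n x = (\<phi> (t n *\<^sub>R e + x) - \<phi> x) / t n" for n x
  have D0: "integral\<^sup>L lborel (D n) = 0" for n
    unfolding D_def using trans int by simp
  obtain B where B: "0 \<le> B" "\<And>x. \<bar>partial_deriv i \<phi> x\<bar> \<le> B"
    using test_function_bounded[OF test_function_partial_deriv[OF \<phi>]] by metis
  have "compact (closure {x. \<phi> x \<noteq> 0})" using \<phi> unfolding test_functions_def by blast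
  then obtain R where R: "\<forall>x\<in>closure {x. \<phi> x \<noteq> 0}. norm x \<le> R"
    using compact_imp_bounded bounded_iff by metis
  have zero: "\<phi> x = 0" if "R < norm x" for x
    using that R closure_subset[of "{x. \<phi> x \<noteq> 0}"] by force
  \<comment> \<open>All steps satisfy \<open>t n \<le> 1\<close>, so one ball of radius
    \<open>R + 1\<close> contains the supports of all difference quotients; inside it the mean value
    theorem bounds them by \<open>B\<close>.\<close>
  have bound: "\<bar>D n x\<bar> \<le> indicator (cball 0 (R + 1)) x * B" for n x
  proof (cases "x \<in> cball 0 (R + 1)")
    case True
    have "\<exists>z>0. z < t n \<and> \<phi> (x + t n *\<^sub>R e) - \<phi> (x + 0 *\<^sub>R e) = (t n - 0) * partial_deriv i \<phi> (x + z *\<^sub>R e)"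
      unfolding e_def using t[of n]
      by (intro MVT2 has_real_derivative_along_axis test_function_differentiable[OF \<phi>]) auto
    then obtain z where "\<phi> (x + t n *\<^sub>R e) - \<phi> x = t n * partial_deriv i \<phi> (x + z *\<^sub>R e)" by auto
    then have "D n x = partial_deriv i \<phi> (x + z *\<^sub>R e)" unfolding D_def using t[of n] by (simp add: add.commute)
    then show ?thesis using B True by simp
  next
    case False
    then have "R + 1 < norm x" by simp
    moreover have "norm x \<le> norm (t n *\<^sub>R e + x) + norm (t n *\<^sub>R e)"
      using norm_triangle_ineq4[of "t n *\<^sub>R e + x" "t n *\<^sub>R e"] by simp
    moreover have "norm (t n *\<^sub>R e) \<le> 1" unfolding e_def using t[of n] by simp
    ultimately have "\<phi> x = 0" "\<phi> (t n *\<^sub>R e + x) = 0" by (auto intro: zero)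
    then show ?thesis using False by (simp add: D_def)
  qed
  have "(\<lambda>n. integral\<^sup>L lborel (D n)) \<longlonglongrightarrow> integral\<^sup>L lborel (partial_deriv i \<phi>)"
  proof (rule integral_dominated_convergence[where w = "\<lambda>x. indicator (cball 0 (R + 1)) x * B"])
    show "partial_deriv i \<phi> \<in> borel_measurable lborel"
      using test_function_borel[OF test_function_partial_deriv[OF \<phi>]] by simp
    show "D n \<in> borel_measurable lborel" for n
      unfolding D_def using borel_measurable_integrable[OF trans(1)] borel_measurable_integrable[OF int] by auto
    show "integrable lborel (\<lambda>x::real ^ 'n. indicator (cball 0 (R + 1)) x * B)"
      using emeasure_bounded_finite[of "cball 0 (R + 1) :: (real ^ 'n) set"]
      by (intro integrable_mult_left integrable_real_indicator) auto
    show "AE x in lborel. norm (D n x) \<le> indicator (cball 0 (R + 1)) x * B" for n using bound by auto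
    have lim: "filterlim t (at 0) sequentially"
      unfolding t_def filterlim_at using LIMSEQ_inverse_real_of_nat by auto
    have "(\<lambda>n. D n x) \<longlonglongrightarrow> partial_deriv i \<phi> x" for x
    proof -
      have "((\<lambda>y. (\<phi> (x + y *\<^sub>R e) - \<phi> (x + 0 *\<^sub>R e)) / (y - 0)) \<longlongrightarrow> partial_deriv i \<phi> (x + 0 *\<^sub>R e)) (at 0)"
        using has_real_derivative_along_axis[of \<phi> x 0 i] test_function_differentiable[OF \<phi>]
        unfolding has_field_derivative_iff e_def by blast
      from filterlim_compose[OF this lim] show ?thesis by (simp add: D_def add.commute)
    qed
    then show "AE x in lborel. (\<lambda>n. D n x) \<longlonglongrightarrow> partial_deriv i \<phi> x" by simp
  qed
  then show ?thesis unfolding D0 by (simp add: LIMSEQ_const_iff)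
qed

lemma L2_inner_integrable:
  assumes "f \<in> L2 \<Omega>" "g \<in> L2 \<Omega>" shows "integrable (lebesgue_on \<Omega>) (\<lambda>x. f x \<bullet> g x)"
proof (rule Bochner_Integration.integrable_bound)
  show "integrable (lebesgue_on \<Omega>) (\<lambda>x. (norm (f x))\<^sup>2 + (norm (g x))\<^sup>2)" using assms by (auto simp: L2_def)
  show "(\<lambda>x. f x \<bullet> g x) \<in> borel_measurable (lebesgue_on \<Omega>)" using assms by (auto simp: L2_def)
  have "\<bar>f x \<bullet> g x\<bar> \<le> (norm (f x))\<^sup>2 + (norm (g x))\<^sup>2" for x
  proof -
    have "0 \<le> (norm (f x) - norm (g x))\<^sup>2" "0 \<le> norm (f x) * norm (g x)" by auto
    then show ?thesis using Cauchy_Schwarz_ineq2[of "f x" "g x"] by (simp add: power2_diff)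
  qed
  then show "AE x in lebesgue_on \<Omega>. norm (f x \<bullet> g x) \<le> norm ((norm (f x))\<^sup>2 + (norm (g x))\<^sup>2)" by auto
qed

lemma norm_add_power2_le: "(norm (x + y))\<^sup>2 \<le> 2 * (norm x)\<^sup>2 + 2 * (norm (y :: 'a::real_inner))\<^sup>2"
proof -
  have "0 \<le> (norm (x - y))\<^sup>2" by simp
  then show ?thesis by (simp add: power2_norm_eq_inner inner_add inner_diff inner_commute)
qed

lemma L2_add:
  assumes "f \<in> L2 \<Omega>" "g \<in> L2 \<Omega>" shows "(\<lambda>x. f x + g x) \<in> L2 \<Omega>"
proof -
  have meas: "(\<lambda>x. f x + g x) \<in> borel_measurable (lebesgue_on \<Omega>)" using assms by (auto simp: L2_def)
  have "integrable (lebesgue_on \<Omega>) (\<lambda>x. 2 * (norm (f x))\<^sup>2 + 2 * (norm (g x))\<^sup>2)"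
    using assms by (auto simp: L2_def)
  then have "integrable (lebesgue_on \<Omega>) (\<lambda>x. (norm (f x + g x))\<^sup>2)"
  proof (rule Bochner_Integration.integrable_bound)
    show "(\<lambda>x. (norm (f x + g x))\<^sup>2) \<in> borel_measurable (lebesgue_on \<Omega>)"
      using meas by measurable
    show "AE x in lebesgue_on \<Omega>. norm ((norm (f x + g x))\<^sup>2) \<le> norm (2 * (norm (f x))\<^sup>2 + 2 * (norm (g x))\<^sup>2)"
      using norm_add_power2_le by (intro AE_I2) simp
  qed
  then show ?thesis using meas by (simp add: L2_def)
qed

lemma L2_scale: "f \<in> L2 \<Omega> \<Longrightarrow> (\<lambda>x. r *\<^sub>R f x) \<in> L2 \<Omega>"
  by (auto simp: L2_def power_mult_distrib)

lemma L2_component: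
  fixes f :: "real ^ 'n \<Rightarrow> real ^ 'm"
  assumes "f \<in> L2 \<Omega>" shows "(\<lambda>x. f x $ i) \<in> L2 \<Omega>"
proof -
  have "(\<lambda>x. f x \<bullet> axis i 1) \<in> borel_measurable (lebesgue_on \<Omega>)"
    using assms by (intro borel_measurable_inner) (auto simp: L2_def)
  then have meas: "(\<lambda>x. f x $ i) \<in> borel_measurable (lebesgue_on \<Omega>)" by (simp add: cart_eq_inner_axis)
  have "integrable (lebesgue_on \<Omega>) (\<lambda>x. (norm (f x))\<^sup>2)" using assms by (auto simp: L2_def)
  then have "integrable (lebesgue_on \<Omega>) (\<lambda>x. (norm (f x $ i))\<^sup>2)"
  proof (rule Bochner_Integration.integrable_bound)
    show "(\<lambda>x. (norm (f x $ i))\<^sup>2) \<in> borel_measurable (lebesgue_on \<Omega>)" using meas by measurable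
    show "AE x in lebesgue_on \<Omega>. norm ((norm (f x $ i))\<^sup>2) \<le> norm ((norm (f x))\<^sup>2)"
    proof (rule AE_I2)
      fix x
      have "\<bar>f x $ i\<bar>\<^sup>2 \<le> (norm (f x))\<^sup>2" by (intro power_mono component_le_norm_cart) simp
      then show "norm ((norm (f x $ i))\<^sup>2) \<le> norm ((norm (f x))\<^sup>2)" by simp
    qed
  qed
  then show ?thesis using meas by (simp add: L2_def)
qed

lemma L2_mult_integrable:
  fixes f g :: "real ^ 'n \<Rightarrow> real"
  shows "f \<in> L2 \<Omega> \<Longrightarrow> g \<in> L2 \<Omega> \<Longrightarrow> integrable (lebesgue_on \<Omega>) (\<lambda>x. f x * g x)"
  using L2_inner_integrable[of f \<Omega> g] by simp

lemma test_function_lebesgue: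
  assumes "\<phi> \<in> test_functions \<Omega>" shows "\<phi> \<in> borel_measurable (lebesgue_on \<Omega>')"
  using test_function_borel[OF assms] by (intro measurable_restrict_space1 measurable_completion) simp

definition cgrad :: "(real ^ 'n \<Rightarrow> real) \<Rightarrow> real ^ 'n \<Rightarrow> real ^ 'n" where
  "cgrad \<phi> x = (\<chi> i. partial_deriv i \<phi> x)"

locale bounded_open =
  fixes \<Omega> :: "(real ^ 'n) set"
  assumes open_\<Omega>: "open \<Omega>" and bounded_\<Omega>: "bounded \<Omega>"
begin

lemma test_function_L2: "\<phi> \<in> test_functions \<Omega> \<Longrightarrow> \<phi> \<in> L2 \<Omega>"
  using integral_test_function(2)[OF open_\<Omega> test_function_mult[of \<phi> \<phi> \<Omega>]]
  by (auto simp: L2_def power2_eq_square test_function_lebesgue test_function_C_k)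

lemma L2_integrable:
  fixes h :: "real ^ 'n \<Rightarrow> real"
  assumes "h \<in> L2 \<Omega>" shows "integrable (lebesgue_on \<Omega>) h"
proof -
  have "\<Omega> \<in> lmeasurable" using open_\<Omega> bounded_\<Omega> by (rule lmeasurable_open[rotated])
  then have "finite_measure (lebesgue_on \<Omega>)" by (rule finite_measure_lebesgue_on)
  then have "integrable (lebesgue_on \<Omega>) (\<lambda>x. 1 + (norm (h x))\<^sup>2)"
    using assms by (auto simp: L2_def finite_measure.integrable_const)
  then show ?thesis
  proof (rule Bochner_Integration.integrable_bound)
    have "\<bar>h x\<bar> \<le> 1 + (h x)\<^sup>2" for x
    proof -
      have "0 \<le> (1 - \<bar>h x\<bar>)\<^sup>2" by simp
      then have "2 * \<bar>h x\<bar> \<le> 1 + (h x)\<^sup>2" by (simp add: power2_diff)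
      then show ?thesis by linarith
    qed
    then show "AE x in lebesgue_on \<Omega>. norm (h x) \<le> norm (1 + (norm (h x))\<^sup>2)" by auto
  qed (use assms in \<open>auto simp: L2_def\<close>)
qed

lemma test_function_parts:
  assumes \<phi>: "\<phi> \<in> test_functions \<Omega>" and \<psi>: "\<psi> \<in> test_functions \<Omega>"
  shows "(LINT x|lebesgue_on \<Omega>. \<phi> x * partial_deriv i \<psi> x) = - (LINT x|lebesgue_on \<Omega>. partial_deriv i \<phi> x * \<psi> x)"
proof -
  have "(\<lambda>x. \<phi> x * \<psi> x) \<in> test_functions \<Omega>"
    using test_function_mult[OF _ \<psi>, of \<phi>] test_function_C_k[OF \<phi>] by blast
  then have "(LINT x|lebesgue_on \<Omega>. partial_deriv i (\<lambda>x. \<phi> x * \<psi> x) x) = 0"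
    using integral_partial_deriv_zero integral_test_function(1)[OF open_\<Omega> test_function_partial_deriv] by metis
  also have "partial_deriv i (\<lambda>x. \<phi> x * \<psi> x) = (\<lambda>x. \<phi> x * partial_deriv i \<psi> x + partial_deriv i \<phi> x * \<psi> x)"
    using test_function_differentiable[OF \<phi>] test_function_differentiable[OF \<psi>] by (auto simp: partial_deriv_mult)
  finally show ?thesis
    using L2_mult_integrable[OF test_function_L2[OF \<phi>] test_function_L2[OF test_function_partial_deriv[OF \<psi>]]]
      L2_mult_integrable[OF test_function_L2[OF test_function_partial_deriv[OF \<phi>]] test_function_L2[OF \<psi>]]
    by (subst (asm) Bochner_Integration.integral_add) auto
qed

lemma cgrad_weak_gradient:
  assumes \<phi>: "\<phi> \<in> test_functions \<Omega>" shows "weak_gradient \<Omega> \<phi> (cgrad \<phi>)"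
proof -
  have d: "partial_deriv i \<phi> \<in> test_functions \<Omega>" for i using test_function_partial_deriv[OF \<phi>] .
  have "continuous_on UNIV (cgrad \<phi>)"
    unfolding cgrad_def[abs_def] using test_function_continuous[OF d] by (intro continuous_on_vec_lambda)
  then have meas: "cgrad \<phi> \<in> borel_measurable (lebesgue_on \<Omega>)"
    by (intro measurable_restrict_space1 measurable_completion) (simp add: borel_measurable_continuous_onI)
  have "(norm (cgrad \<phi> x))\<^sup>2 = (\<Sum>i\<in>UNIV. (partial_deriv i \<phi> x)\<^sup>2)" for x
    by (simp add: norm_vec_def L2_set_def cgrad_def sum_nonneg)
  then have "integrable (lebesgue_on \<Omega>) (\<lambda>x. (norm (cgrad \<phi> x))\<^sup>2)"
    using test_function_L2[OF d] by (auto simp: L2_def)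
  then have "cgrad \<phi> \<in> L2 \<Omega>" using meas by (simp add: L2_def)
  then show ?thesis unfolding weak_gradient_def using test_function_parts[OF \<phi>] by (simp add: cgrad_def)
qed

lemma test_function_H1: "\<phi> \<in> test_functions \<Omega> \<Longrightarrow> \<phi> \<in> H1 \<Omega>"
  using cgrad_weak_gradient test_function_L2 by (auto simp: H1_def)

text \<open>The fundamental lemma applied to each component. Since \<open>grad\<close> is an
  arbitrary choice, every algebraic rule for it holds only almost everywhere and passes through this
  lemma.\<close>

lemma weak_gradient_unique:
  assumes g: "weak_gradient \<Omega> v g" and g': "weak_gradient \<Omega> v g'"
  shows "AE x in lebesgue_on \<Omega>. g x = g' x"
proof -
  have L: "g \<in> L2 \<Omega>" "g' \<in> L2 \<Omega>" using assms by (auto simp: weak_gradient_def)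
  have "AE x in lebesgue_on \<Omega>. g x $ i - g' x $ i = 0" for i
  proof (rule fundamental_lemma[OF open_\<Omega>])
    show "integrable (lebesgue_on \<Omega>) (\<lambda>x. g x $ i - g' x $ i)"
      using L2_integrable[OF L2_component[OF L(1)]] L2_integrable[OF L2_component[OF L(2)]] by auto
    fix \<phi> assume \<phi>: "\<phi> \<in> test_functions \<Omega>"
    have int: "integrable (lebesgue_on \<Omega>) (\<lambda>x. g x $ i * \<phi> x)" "integrable (lebesgue_on \<Omega>) (\<lambda>x. g' x $ i * \<phi> x)"
      using L2_mult_integrable[OF L2_component test_function_L2[OF \<phi>]] L by auto
    have "(LINT x|lebesgue_on \<Omega>. g x $ i * \<phi> x) = (LINT x|lebesgue_on \<Omega>. g' x $ i * \<phi> x)"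
      using g[unfolded weak_gradient_def, THEN conjunct2, rule_format, OF \<phi>, of i]
        g'[unfolded weak_gradient_def, THEN conjunct2, rule_format, OF \<phi>, of i] by simp
    then show "(LINT x|lebesgue_on \<Omega>. (g x $ i - g' x $ i) * \<phi> x) = 0"
      using int by (simp add: left_diff_distrib)
  qed
  then have "AE x in lebesgue_on \<Omega>. \<forall>i\<in>UNIV. g x $ i - g' x $ i = 0" by (intro AE_finite_allI) auto
  then show ?thesis by eventually_elim (simp add: vec_eq_iff)
qed

lemma weak_gradient_add:
  assumes "v \<in> L2 \<Omega>" "w \<in> L2 \<Omega>" "weak_gradient \<Omega> v g" "weak_gradient \<Omega> w h"
  shows "weak_gradient \<Omega> (\<lambda>x. v x + w x) (\<lambda>x. g x + h x)"
  unfolding weak_gradient_def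
proof (intro conjI ballI allI)
  have L: "g \<in> L2 \<Omega>" "h \<in> L2 \<Omega>" using assms by (auto simp: weak_gradient_def)
  show "(\<lambda>x. g x + h x) \<in> L2 \<Omega>" using L by (rule L2_add)
  fix \<phi> i assume \<phi>: "\<phi> \<in> test_functions \<Omega>"
  have 1: "integrable (lebesgue_on \<Omega>) (\<lambda>x. v x * partial_deriv i \<phi> x)" "integrable (lebesgue_on \<Omega>) (\<lambda>x. w x * partial_deriv i \<phi> x)"
    using assms L2_mult_integrable[OF _ test_function_L2[OF test_function_partial_deriv[OF \<phi>]]] by auto
  have 2: "integrable (lebesgue_on \<Omega>) (\<lambda>x. g x $ i * \<phi> x)" "integrable (lebesgue_on \<Omega>) (\<lambda>x. h x $ i * \<phi> x)"
    using L2_mult_integrable[OF L2_component test_function_L2[OF \<phi>]] L by auto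
  show "(LINT x|lebesgue_on \<Omega>. (v x + w x) * partial_deriv i \<phi> x) = - (LINT x|lebesgue_on \<Omega>. (g x + h x) $ i * \<phi> x)"
    using 1 2 assms(3,4) \<phi> unfolding weak_gradient_def by (simp add: distrib_right)
qed

lemma weak_gradient_scale:
  assumes "weak_gradient \<Omega> v g" shows "weak_gradient \<Omega> (\<lambda>x. r * v x) (\<lambda>x. r *\<^sub>R g x)"
  using assms unfolding weak_gradient_def by (auto simp: mult.assoc L2_scale)

lemma H1_L2: "v \<in> H1 \<Omega> \<Longrightarrow> v \<in> L2 \<Omega>" by (simp add: H1_def)

lemma grad_weak_gradient: "v \<in> H1 \<Omega> \<Longrightarrow> weak_gradient \<Omega> v (grad \<Omega> v)"
  using someI_ex[of "weak_gradient \<Omega> v"] by (simp add: H1_def grad_def)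

lemma grad_L2: "v \<in> H1 \<Omega> \<Longrightarrow> grad \<Omega> v \<in> L2 \<Omega>"
  using grad_weak_gradient by (auto simp: weak_gradient_def)

lemma H1_add: "v \<in> H1 \<Omega> \<Longrightarrow> w \<in> H1 \<Omega> \<Longrightarrow> (\<lambda>x. v x + w x) \<in> H1 \<Omega>"
  using weak_gradient_add L2_add[of v \<Omega> w] unfolding H1_def by blast

lemma H1_scale: "v \<in> H1 \<Omega> \<Longrightarrow> (\<lambda>x. r * v x) \<in> H1 \<Omega>"
  using weak_gradient_scale[of v _ r] L2_scale[of v \<Omega> r] unfolding H1_def by auto

lemma grad_add:
  assumes "v \<in> H1 \<Omega>" "w \<in> H1 \<Omega>"
  shows "AE x in lebesgue_on \<Omega>. grad \<Omega> (\<lambda>x. v x + w x) x = grad \<Omega> v x + grad \<Omega> w x"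
  using assms by (intro weak_gradient_unique[OF grad_weak_gradient weak_gradient_add] H1_add H1_L2 grad_weak_gradient)

lemma grad_scale:
  assumes "v \<in> H1 \<Omega>"
  shows "AE x in lebesgue_on \<Omega>. grad \<Omega> (\<lambda>x. r * v x) x = r *\<^sub>R grad \<Omega> v x"
  using assms by (intro weak_gradient_unique[OF grad_weak_gradient weak_gradient_scale] H1_scale grad_weak_gradient)

end

section \<open>The space \<open>H\<^sup>1\<^sub>0\<close>\<close>

lemma integral_eq_add_AE:
  fixes f g h :: "'a \<Rightarrow> real"
  assumes "integrable M f" "integrable M g" "integrable M h" "AE x in M. f x = g x + h x"
  shows "integral\<^sup>L M f = integral\<^sup>L M g + integral\<^sup>L M h"
proof -
  have "integral\<^sup>L M f = (LINT x|M. g x + h x)" using assms by (intro integral_cong_AE) auto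
  then show ?thesis using assms by simp
qed

lemma integral_eq_scale_AE:
  fixes f g :: "'a \<Rightarrow> real"
  assumes "integrable M f" "integrable M g" "AE x in M. f x = r * g x"
  shows "integral\<^sup>L M f = r * integral\<^sup>L M g"
proof -
  have "integral\<^sup>L M f = (LINT x|M. r * g x)" using assms by (intro integral_cong_AE) auto
  then show ?thesis by simp
qed

lemma L2_norm_integrable: "f \<in> L2 \<Omega> \<Longrightarrow> integrable (lebesgue_on \<Omega>) (\<lambda>x. (norm (f x))\<^sup>2)"
  by (simp add: L2_def)

lemma L2_power2_integrable: "f \<in> L2 \<Omega> \<Longrightarrow> integrable (lebesgue_on \<Omega>) (\<lambda>x. (f x :: real)\<^sup>2)"
  by (simp add: L2_def)

lemma integral_norm_add_le:
  assumes "f \<in> L2 \<Omega>" "g \<in> L2 \<Omega>" "h \<in> L2 \<Omega>" "AE x in lebesgue_on \<Omega>. f x = g x + h x"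
  shows "(LINT x|lebesgue_on \<Omega>. (norm (f x))\<^sup>2)
    \<le> 2 * (LINT x|lebesgue_on \<Omega>. (norm (g x))\<^sup>2) + 2 * (LINT x|lebesgue_on \<Omega>. (norm (h x))\<^sup>2)"
proof -
  have "(LINT x|lebesgue_on \<Omega>. (norm (f x))\<^sup>2)
      \<le> (LINT x|lebesgue_on \<Omega>. 2 * (norm (g x))\<^sup>2 + 2 * (norm (h x))\<^sup>2)"
  proof (rule integral_mono_AE)
    show "AE x in lebesgue_on \<Omega>. (norm (f x))\<^sup>2 \<le> 2 * (norm (g x))\<^sup>2 + 2 * (norm (h x))\<^sup>2"
      using assms(4) by eventually_elim (simp add: norm_add_power2_le)
  qed (use assms(1-3) in \<open>auto simp: L2_norm_integrable\<close>)
  then show ?thesis using assms(2,3) by (simp add: L2_norm_integrable)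
qed

lemma H1_norm_nonneg: "0 \<le> H1_norm \<Omega> v"
  by (simp add: H1_norm_def)

lemma H1_norm_power2:
  "(H1_norm \<Omega> v)\<^sup>2 = (LINT x|lebesgue_on \<Omega>. (v x)\<^sup>2) + (LINT x|lebesgue_on \<Omega>. (norm (grad \<Omega> v x))\<^sup>2)"
  unfolding H1_norm_def by (simp add: integral_nonneg_AE)

lemma H10_sub_H1: "v \<in> H10 \<Omega> \<Longrightarrow> v \<in> H1 \<Omega>" by (simp add: H10_def)

context bounded_open
begin

text \<open>The squared form with factor 2 replaces the triangle inequality: it follows pointwise
  under the integral and suffices for limits tending to zero.\<close>

lemma H1_norm_add_le:
  assumes "v \<in> H1 \<Omega>" "w \<in> H1 \<Omega>"
  shows "(H1_norm \<Omega> (\<lambda>x. v x + w x))\<^sup>2 \<le> 2 * (H1_norm \<Omega> v)\<^sup>2 + 2 * (H1_norm \<Omega> w)\<^sup>2"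
proof -
  have "(LINT x|lebesgue_on \<Omega>. (norm (v x + w x))\<^sup>2)
    \<le> 2 * (LINT x|lebesgue_on \<Omega>. (norm (v x))\<^sup>2) + 2 * (LINT x|lebesgue_on \<Omega>. (norm (w x))\<^sup>2)"
    using assms by (intro integral_norm_add_le L2_add H1_L2) auto
  moreover have "(LINT x|lebesgue_on \<Omega>. (norm (grad \<Omega> (\<lambda>x. v x + w x) x))\<^sup>2)
    \<le> 2 * (LINT x|lebesgue_on \<Omega>. (norm (grad \<Omega> v x))\<^sup>2) + 2 * (LINT x|lebesgue_on \<Omega>. (norm (grad \<Omega> w x))\<^sup>2)"
    using assms by (intro integral_norm_add_le grad_L2 H1_add grad_add)
  ultimately show ?thesis unfolding H1_norm_power2 by simp
qed

lemma H1_norm_scale: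
  assumes v: "v \<in> H1 \<Omega>" shows "H1_norm \<Omega> (\<lambda>x. r * v x) = \<bar>r\<bar> * H1_norm \<Omega> v"
proof -
  have "(LINT x|lebesgue_on \<Omega>. (norm (grad \<Omega> (\<lambda>x. r * v x) x))\<^sup>2) = r\<^sup>2 * (LINT x|lebesgue_on \<Omega>. (norm (grad \<Omega> v x))\<^sup>2)"
  proof (rule integral_eq_scale_AE)
    show "AE x in lebesgue_on \<Omega>. (norm (grad \<Omega> (\<lambda>x. r * v x) x))\<^sup>2 = r\<^sup>2 * (norm (grad \<Omega> v x))\<^sup>2"
      using grad_scale[OF v, of r] by eventually_elim (simp add: power_mult_distrib)
  qed (use v in \<open>auto intro!: L2_norm_integrable grad_L2 H1_scale\<close>)
  then have "(H1_norm \<Omega> (\<lambda>x. r * v x))\<^sup>2 = (\<bar>r\<bar> * H1_norm \<Omega> v)\<^sup>2"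
    unfolding power_mult_distrib H1_norm_power2 by (simp add: power_mult_distrib algebra_simps)
  then show ?thesis by (rule power2_eq_imp_eq) (auto simp: H1_norm_nonneg)
qed

lemma H10_I:
  assumes "v \<in> H1 \<Omega>" "\<And>k. \<phi> k \<in> test_functions \<Omega>"
    and lim: "(\<lambda>k. (H1_norm \<Omega> (\<lambda>x. v x - \<phi> k x))\<^sup>2) \<longlonglongrightarrow> 0"
  shows "v \<in> H10 \<Omega>"
proof -
  have "(\<lambda>k. sqrt ((H1_norm \<Omega> (\<lambda>x. v x - \<phi> k x))\<^sup>2)) \<longlonglongrightarrow> sqrt 0" using lim by (rule tendsto_real_sqrt)
  then have "(\<lambda>k. H1_norm \<Omega> (\<lambda>x. v x - \<phi> k x)) \<longlonglongrightarrow> 0" by (simp add: H1_norm_nonneg)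
  then show ?thesis using assms unfolding H10_def by blast
qed

lemma H10_E:
  assumes "v \<in> H10 \<Omega>"
  obtains \<phi> where "\<And>k. \<phi> k \<in> test_functions \<Omega>" "(\<lambda>k. (H1_norm \<Omega> (\<lambda>x. v x - \<phi> k x))\<^sup>2) \<longlonglongrightarrow> 0"
proof -
  obtain \<phi> where \<phi>: "\<forall>k. \<phi> k \<in> test_functions \<Omega>" "(\<lambda>k. H1_norm \<Omega> (\<lambda>x. v x - \<phi> k x)) \<longlonglongrightarrow> 0"
    using assms unfolding H10_def by blast
  then show ?thesis using that[of \<phi>] tendsto_power[OF \<phi>(2), of 2] by simp
qed

lemma H1_diff: "v \<in> H1 \<Omega> \<Longrightarrow> w \<in> H1 \<Omega> \<Longrightarrow> (\<lambda>x. v x - w x) \<in> H1 \<Omega>"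
  using H1_add[of v "\<lambda>x. (-1) * w x"] H1_scale[of w "-1"] by simp

lemma H10_add:
  assumes "v \<in> H10 \<Omega>" "w \<in> H10 \<Omega>" shows "(\<lambda>x. v x + w x) \<in> H10 \<Omega>"
proof -
  obtain \<phi> where \<phi>: "\<And>k. \<phi> k \<in> test_functions \<Omega>" "(\<lambda>k. (H1_norm \<Omega> (\<lambda>x. v x - \<phi> k x))\<^sup>2) \<longlonglongrightarrow> 0"
    using H10_E[OF assms(1)] by blast
  obtain \<psi> where \<psi>: "\<And>k. \<psi> k \<in> test_functions \<Omega>" "(\<lambda>k. (H1_norm \<Omega> (\<lambda>x. w x - \<psi> k x))\<^sup>2) \<longlonglongrightarrow> 0"
    using H10_E[OF assms(2)] by blast
  have vw: "v \<in> H1 \<Omega>" "w \<in> H1 \<Omega>" using assms H10_sub_H1 by auto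
  show ?thesis
  proof (rule H10_I)
    show "(\<lambda>x. v x + w x) \<in> H1 \<Omega>" using vw by (rule H1_add)
    show "(\<lambda>x. \<phi> k x + \<psi> k x) \<in> test_functions \<Omega>" for k using \<phi> \<psi> by (intro test_function_add)
    have lim: "(\<lambda>k. 2 * (H1_norm \<Omega> (\<lambda>x. v x - \<phi> k x))\<^sup>2 + 2 * (H1_norm \<Omega> (\<lambda>x. w x - \<psi> k x))\<^sup>2) \<longlonglongrightarrow> 2 * 0 + 2 * 0"
      by (intro tendsto_intros \<phi> \<psi>)
    have "(H1_norm \<Omega> (\<lambda>x. v x + w x - (\<phi> k x + \<psi> k x)))\<^sup>2
        \<le> 2 * (H1_norm \<Omega> (\<lambda>x. v x - \<phi> k x))\<^sup>2 + 2 * (H1_norm \<Omega> (\<lambda>x. w x - \<psi> k x))\<^sup>2" for k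
    proof -
      have "(\<lambda>x. v x + w x - (\<phi> k x + \<psi> k x)) = (\<lambda>x. (v x - \<phi> k x) + (w x - \<psi> k x))" by auto
      then show ?thesis
        using H1_norm_add_le[OF H1_diff[OF vw(1) test_function_H1[OF \<phi>(1)[of k]]] H1_diff[OF vw(2) test_function_H1[OF \<psi>(1)[of k]]]] by simp
    qed
    then show "(\<lambda>k. (H1_norm \<Omega> (\<lambda>x. v x + w x - (\<phi> k x + \<psi> k x)))\<^sup>2) \<longlonglongrightarrow> 0"
      using lim by (intro tendsto_sandwich[OF _ _ tendsto_const lim[simplified]]) auto
  qed
qed

lemma H10_scale:
  assumes "v \<in> H10 \<Omega>" shows "(\<lambda>x. r * v x) \<in> H10 \<Omega>"
proof -
  obtain \<phi> where \<phi>: "\<And>k. \<phi> k \<in> test_functions \<Omega>" "(\<lambda>k. (H1_norm \<Omega> (\<lambda>x. v x - \<phi> k x))\<^sup>2) \<longlonglongrightarrow> 0"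
    using H10_E[OF assms(1)] by blast
  have v: "v \<in> H1 \<Omega>" using assms H10_sub_H1 by auto
  show ?thesis
  proof (rule H10_I)
    show "(\<lambda>x. r * v x) \<in> H1 \<Omega>" using v by (rule H1_scale)
    show "(\<lambda>x. r * \<phi> k x) \<in> test_functions \<Omega>" for k using \<phi> by (intro test_function_scale)
    have "(H1_norm \<Omega> (\<lambda>x. r * v x - r * \<phi> k x))\<^sup>2 = r\<^sup>2 * (H1_norm \<Omega> (\<lambda>x. v x - \<phi> k x))\<^sup>2" for k
      using H1_norm_scale[OF H1_diff[OF v test_function_H1[OF \<phi>(1)[of k]]], of r]
      by (simp add: right_diff_distrib power_mult_distrib)
    then show "(\<lambda>k. (H1_norm \<Omega> (\<lambda>x. r * v x - r * \<phi> k x))\<^sup>2) \<longlonglongrightarrow> 0"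
      using tendsto_mult[OF tendsto_const \<phi>(2), of "r\<^sup>2"] by simp
  qed
qed

lemma test_function_H10: assumes "\<phi> \<in> test_functions \<Omega>" shows "\<phi> \<in> H10 \<Omega>"
proof (rule H10_I)
  show "(\<lambda>k. (H1_norm \<Omega> (\<lambda>x. \<phi> x - \<phi> x))\<^sup>2) \<longlonglongrightarrow> 0"
    using H1_norm_scale[OF test_function_H1[OF assms], of 0] by simp
qed (use assms test_function_H1 in auto)

lemma H10_zero: "(\<lambda>x. 0) \<in> H10 \<Omega>"
  by (rule test_function_H10) (simp add: test_functions_def C_k_const)

text \<open>The function \<open>x $ i\<close> has derivative 1, so integrating the square of
  \<open>\<phi>\<close> by parts gives \<open>-2\<close> times the integral of
  \<open>x $ i * \<phi> x * d x\<close>. Young's inequality absorbs half of the left-hand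
  side.\<close>

lemma friedrichs_test_function:
  assumes \<phi>: "\<phi> \<in> test_functions \<Omega>" and R: "\<And>x. x \<in> \<Omega> \<Longrightarrow> norm x \<le> R" and R0: "0 \<le> R"
  shows "(LINT x|lebesgue_on \<Omega>. (\<phi> x)\<^sup>2) \<le> 4 * R\<^sup>2 * (LINT x|lebesgue_on \<Omega>. (norm (grad \<Omega> \<phi> x))\<^sup>2)"
proof -
  obtain i :: 'n where True by blast
  define d where "d = partial_deriv i \<phi>"
  have d: "d \<in> test_functions \<Omega>" unfolding d_def by (rule test_function_partial_deriv[OF \<phi>])
  define \<psi> where "\<psi> = (\<lambda>x. x $ i * \<phi> x)"
  have \<psi>: "\<psi> \<in> test_functions \<Omega>" unfolding \<psi>_def by (intro test_function_mult allI C_k_component \<phi>)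
  have "partial_deriv i \<psi> x = x $ i * d x + \<phi> x" for x
  proof -
    have "(\<lambda>x. x $ i) differentiable (at x)"
      using has_derivative_component by (auto simp: differentiable_def)
    then show ?thesis unfolding \<psi>_def d_def
      using test_function_differentiable[OF \<phi>] by (simp add: partial_deriv_mult partial_deriv_eq[OF has_derivative_component])
  qed
  then have "(LINT x|lebesgue_on \<Omega>. \<phi> x * (x $ i * d x + \<phi> x)) = - (LINT x|lebesgue_on \<Omega>. d x * \<psi> x)"
    using test_function_parts[OF \<phi> \<psi>, of i] by (simp add: d_def)
  moreover have int: "integrable (lebesgue_on \<Omega>) (\<lambda>x. d x * \<psi> x)" "integrable (lebesgue_on \<Omega>) (\<lambda>x. (\<phi> x)\<^sup>2)"
      "integrable (lebesgue_on \<Omega>) (\<lambda>x. (d x)\<^sup>2)"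
    using L2_mult_integrable[OF test_function_L2[OF d] test_function_L2[OF \<psi>]]
      L2_power2_integrable[OF test_function_L2[OF \<phi>]] L2_power2_integrable[OF test_function_L2[OF d]] by auto
  moreover have "(\<lambda>x. \<phi> x * (x $ i * d x + \<phi> x)) = (\<lambda>x. d x * \<psi> x + (\<phi> x)\<^sup>2)"
    by (auto simp: \<psi>_def algebra_simps power2_eq_square)
  ultimately have eq: "(LINT x|lebesgue_on \<Omega>. (\<phi> x)\<^sup>2) = (LINT x|lebesgue_on \<Omega>. - 2 * (d x * \<psi> x))" by simp
  also have "\<dots> \<le> (LINT x|lebesgue_on \<Omega>. 1/2 * (\<phi> x)\<^sup>2 + 2 * R\<^sup>2 * (d x)\<^sup>2)"
  proof (rule integral_mono)
    fix x assume "x \<in> space (lebesgue_on \<Omega>)"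
    then have "\<bar>x $ i\<bar> \<le> R" using R component_le_norm_cart[of x i] by (fastforce simp: space_restrict_space)
    then have "(x $ i)\<^sup>2 \<le> R\<^sup>2" using R0 by (simp add: abs_le_square_iff[symmetric])
    then have "(x $ i)\<^sup>2 * (d x)\<^sup>2 \<le> R\<^sup>2 * (d x)\<^sup>2" by (intro mult_right_mono) auto
    moreover have "0 \<le> (\<phi> x + 2 * (x $ i * d x))\<^sup>2" by simp
    ultimately show "- 2 * (d x * \<psi> x) \<le> 1/2 * (\<phi> x)\<^sup>2 + 2 * R\<^sup>2 * (d x)\<^sup>2"
      by (simp add: \<psi>_def power2_sum power_mult_distrib algebra_simps)
  qed (use int in auto)
  also have "\<dots> = 1/2 * (LINT x|lebesgue_on \<Omega>. (\<phi> x)\<^sup>2) + 2 * R\<^sup>2 * (LINT x|lebesgue_on \<Omega>. (d x)\<^sup>2)"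
    using int by simp
  finally have "(LINT x|lebesgue_on \<Omega>. (\<phi> x)\<^sup>2) \<le> 4 * R\<^sup>2 * (LINT x|lebesgue_on \<Omega>. (d x)\<^sup>2)" by simp
  also have "(LINT x|lebesgue_on \<Omega>. (d x)\<^sup>2) \<le> (LINT x|lebesgue_on \<Omega>. (norm (grad \<Omega> \<phi> x))\<^sup>2)"
  proof (rule integral_mono_AE)
    have "AE x in lebesgue_on \<Omega>. grad \<Omega> \<phi> x = cgrad \<phi> x"
      by (rule weak_gradient_unique[OF grad_weak_gradient[OF test_function_H1[OF \<phi>]] cgrad_weak_gradient[OF \<phi>]])
    then show "AE x in lebesgue_on \<Omega>. (d x)\<^sup>2 \<le> (norm (grad \<Omega> \<phi> x))\<^sup>2"
    proof eventually_elim
      case (elim x)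
      have "\<bar>d x\<bar>\<^sup>2 \<le> (norm (cgrad \<phi> x))\<^sup>2"
        using component_le_norm_cart[of "cgrad \<phi> x" i] by (intro power_mono) (auto simp: cgrad_def d_def)
      then show ?case using elim by simp
    qed
  qed (use int L2_norm_integrable[OF grad_L2[OF test_function_H1[OF \<phi>]]] in auto)
  finally show ?thesis using R0 by (simp add: mult_left_mono)
qed

text \<open>Density of test functions; the two squared triangle inequalities raise the constant from
  4 to 16. The energy norm sees only the gradient, and this bound makes it control the full H1
  norm.\<close>

lemma friedrichs:
  "\<exists>C\<ge>0. \<forall>v\<in>H10 \<Omega>. (LINT x|lebesgue_on \<Omega>. (v x)\<^sup>2) \<le> C * (LINT x|lebesgue_on \<Omega>. (norm (grad \<Omega> v x))\<^sup>2)"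
proof -
  obtain R0 where R0: "\<forall>x\<in>\<Omega>. norm x \<le> R0" using bounded_\<Omega> bounded_iff by blast
  define R where "R = max R0 0"
  have R: "\<And>x. x \<in> \<Omega> \<Longrightarrow> norm x \<le> R" "0 \<le> R" using R0 by (auto simp: R_def le_max_iff_disj)
  have "(LINT x|lebesgue_on \<Omega>. (v x)\<^sup>2) \<le> 16 * R\<^sup>2 * (LINT x|lebesgue_on \<Omega>. (norm (grad \<Omega> v x))\<^sup>2)"
    if v: "v \<in> H10 \<Omega>" for v
  proof -
    obtain \<phi> where \<phi>: "\<And>k. \<phi> k \<in> test_functions \<Omega>" and lim: "(\<lambda>k. (H1_norm \<Omega> (\<lambda>x. v x - \<phi> k x))\<^sup>2) \<longlonglongrightarrow> 0"
      using H10_E[OF v] by blast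
    let ?L = "\<lambda>v. LINT x|lebesgue_on \<Omega>. (v x)\<^sup>2" and ?G = "\<lambda>v. LINT x|lebesgue_on \<Omega>. (norm (grad \<Omega> v x))\<^sup>2"
    have v1: "v \<in> H1 \<Omega>" using v H10_sub_H1 by auto
    have "?L v \<le> 16 * R\<^sup>2 * ?G v + (2 + 16 * R\<^sup>2) * (H1_norm \<Omega> (\<lambda>x. v x - \<phi> k x))\<^sup>2" for k
    proof -
      define w where "w = (\<lambda>x. v x - \<phi> k x)"
      have p1: "\<phi> k \<in> H1 \<Omega>" using test_function_H1[OF \<phi>] .
      have w1: "w \<in> H1 \<Omega>" unfolding w_def using v1 p1 by (rule H1_diff)
      have "(LINT x|lebesgue_on \<Omega>. (norm (v x))\<^sup>2)
          \<le> 2 * (LINT x|lebesgue_on \<Omega>. (norm (w x))\<^sup>2) + 2 * (LINT x|lebesgue_on \<Omega>. (norm (\<phi> k x))\<^sup>2)"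
        by (intro integral_norm_add_le H1_L2 v1 w1 p1) (simp add: w_def)
      then have 1: "?L v \<le> 2 * ?L w + 2 * ?L (\<phi> k)" by simp
      have 2: "?L (\<phi> k) \<le> 4 * R\<^sup>2 * ?G (\<phi> k)" by (rule friedrichs_test_function[OF \<phi> R])
      have "AE x in lebesgue_on \<Omega>. grad \<Omega> (\<phi> k) x = grad \<Omega> v x + grad \<Omega> (\<lambda>x. - 1 * w x) x"
        using grad_add[OF v1 H1_scale[OF w1, of "-1"]] by (simp add: w_def)
      moreover have "AE x in lebesgue_on \<Omega>. grad \<Omega> (\<lambda>x. - 1 * w x) x = (- 1) *\<^sub>R grad \<Omega> w x"
        by (rule grad_scale[OF w1])
      ultimately have "AE x in lebesgue_on \<Omega>. grad \<Omega> (\<phi> k) x = grad \<Omega> v x + (- 1) *\<^sub>R grad \<Omega> w x"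
        by eventually_elim simp
      then have "?G (\<phi> k) \<le> 2 * ?G v + 2 * (LINT x|lebesgue_on \<Omega>. (norm ((- 1) *\<^sub>R grad \<Omega> w x))\<^sup>2)"
        by (intro integral_norm_add_le L2_scale grad_L2 v1 w1 p1)
      then have 3: "?G (\<phi> k) \<le> 2 * ?G v + 2 * ?G w" by simp
      have "?L v \<le> 2 * ?L w + 8 * R\<^sup>2 * ?G (\<phi> k)" using 1 2 by simp
      also have "\<dots> \<le> 2 * ?L w + 8 * R\<^sup>2 * (2 * ?G v + 2 * ?G w)"
        using 3 by (intro add_left_mono mult_left_mono) auto
      also have "\<dots> \<le> 16 * R\<^sup>2 * ?G v + (2 + 16 * R\<^sup>2) * (?L w + ?G w)"
      proof -
        have "0 \<le> ?L w" "0 \<le> ?G w" by (auto intro: integral_nonneg_AE)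
        then have "0 \<le> R\<^sup>2 * ?L w" by simp
        then show ?thesis using \<open>0 \<le> ?G w\<close> by (simp add: algebra_simps)
      qed
      finally show ?thesis unfolding w_def H1_norm_power2 .
    qed
    moreover have "(\<lambda>k. 16 * R\<^sup>2 * ?G v + (2 + 16 * R\<^sup>2) * (H1_norm \<Omega> (\<lambda>x. v x - \<phi> k x))\<^sup>2)
        \<longlonglongrightarrow> 16 * R\<^sup>2 * ?G v + (2 + 16 * R\<^sup>2) * 0"
      by (intro tendsto_intros lim)
    ultimately show ?thesis using LIMSEQ_le_const by fastforce
  qed
  then show ?thesis by (intro exI[of _ "16 * R\<^sup>2"]) auto
qed

end

section \<open>The bilinear form and the energy norm\<close>

lemma Linf_component:
  fixes f :: "real ^ 'n \<Rightarrow> ('b::euclidean_space) ^ 'm"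
  assumes "f \<in> Linf \<Omega>" shows "(\<lambda>x. f x $ i) \<in> Linf \<Omega>"
proof -
  have f: "f \<in> borel_measurable (lebesgue_on \<Omega>)" using assms by (auto simp: Linf_def)
  have "(\<lambda>y :: 'b ^ 'm. y $ i) \<in> borel_measurable borel"
    by (intro borel_measurable_continuous_onI continuous_intros)
  from measurable_compose[OF f this] have "(\<lambda>x. f x $ i) \<in> borel_measurable (lebesgue_on \<Omega>)" .
  moreover obtain B where B: "AE x in lebesgue_on \<Omega>. norm (f x) \<le> B" using assms by (auto simp: Linf_def)
  have "AE x in lebesgue_on \<Omega>. norm (f x $ i) \<le> B"
    using B by eventually_elim (meson Finite_Cartesian_Product.norm_nth_le order_trans)
  ultimately show ?thesis by (auto simp: Linf_def)
qed

lemma Linf_L2_mult: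
  fixes f g :: "real ^ 'n \<Rightarrow> real"
  assumes "f \<in> Linf \<Omega>" "g \<in> L2 \<Omega>" shows "(\<lambda>x. f x * g x) \<in> L2 \<Omega>"
proof -
  have meas: "(\<lambda>x. f x * g x) \<in> borel_measurable (lebesgue_on \<Omega>)" using assms by (auto simp: Linf_def L2_def)
  obtain B where B: "AE x in lebesgue_on \<Omega>. norm (f x) \<le> B" using assms by (auto simp: Linf_def)
  have "integrable (lebesgue_on \<Omega>) (\<lambda>x. B\<^sup>2 * (g x)\<^sup>2)" using L2_power2_integrable[OF assms(2)] by auto
  then have "integrable (lebesgue_on \<Omega>) (\<lambda>x. (f x * g x)\<^sup>2)"
  proof (rule Bochner_Integration.integrable_bound)
    show "(\<lambda>x. (f x * g x)\<^sup>2) \<in> borel_measurable (lebesgue_on \<Omega>)" using meas by measurable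
    show "AE x in lebesgue_on \<Omega>. norm ((f x * g x)\<^sup>2) \<le> norm (B\<^sup>2 * (g x)\<^sup>2)"
      using B
    proof eventually_elim
      case (elim x)
      then have "\<bar>f x\<bar>\<^sup>2 \<le> B\<^sup>2" by (intro power_mono) auto
      then have "(f x)\<^sup>2 * (g x)\<^sup>2 \<le> B\<^sup>2 * (g x)\<^sup>2" by (intro mult_right_mono) auto
      then show ?case by (simp add: power_mult_distrib)
    qed
  qed
  then show ?thesis using meas by (simp add: L2_def)
qed

lemma integrable_matrix_form:
  fixes A :: "real ^ 'n \<Rightarrow> real ^ 'n ^ 'n"
  assumes "A \<in> Linf \<Omega>" "g \<in> L2 \<Omega>" "h \<in> L2 \<Omega>"
  shows "integrable (lebesgue_on \<Omega>) (\<lambda>x. (A x *v g x) \<bullet> h x)"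
proof -
  have "(\<lambda>x. (A x *v g x) \<bullet> h x) = (\<lambda>x. \<Sum>i\<in>UNIV. \<Sum>j\<in>UNIV. (A x $ i $ j * g x $ j) * h x $ i)"
    by (simp add: inner_vec_def matrix_vector_mult_def sum_distrib_right)
  then show ?thesis
    using assms by (simp only:) (intro Bochner_Integration.integrable_sum L2_mult_integrable Linf_L2_mult L2_component Linf_component)
qed

lemma integrable_vector_form:
  fixes b :: "real ^ 'n \<Rightarrow> real ^ 'n"
  assumes "b \<in> Linf \<Omega>" "g \<in> L2 \<Omega>" "v \<in> L2 \<Omega>"
  shows "integrable (lebesgue_on \<Omega>) (\<lambda>x. (b x \<bullet> g x) * v x)"
proof -
  have "(\<lambda>x. (b x \<bullet> g x) * v x) = (\<lambda>x. \<Sum>i\<in>UNIV. (b x $ i * g x $ i) * v x)"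
    by (simp add: inner_vec_def sum_distrib_right)
  then show ?thesis
    using assms by (simp only:) (intro Bochner_Integration.integrable_sum L2_mult_integrable Linf_L2_mult L2_component Linf_component)
qed

lemma quadratic_form_le:
  fixes A :: "real ^ 'n ^ 'n"
  assumes "norm A \<le> B" shows "(A *v \<xi>) \<bullet> \<xi> \<le> (real CARD('n))\<^sup>2 * B * (norm \<xi>)\<^sup>2"
proof -
  have "(A *v \<xi>) \<bullet> \<xi> = (\<Sum>i\<in>UNIV. \<Sum>j\<in>UNIV. A $ i $ j * \<xi> $ j * \<xi> $ i)"
    by (simp add: inner_vec_def matrix_vector_mult_def sum_distrib_right)
  also have "\<dots> \<le> (\<Sum>i\<in>(UNIV::'n set). \<Sum>j\<in>(UNIV::'n set). B * norm \<xi> * norm \<xi>)"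
  proof (intro sum_mono)
    fix i j
    have "\<bar>A $ i $ j\<bar> \<le> norm (A $ i)" by (rule component_le_norm_cart)
    also have "\<dots> \<le> B" using assms Finite_Cartesian_Product.norm_nth_le[of A i] by linarith
    finally have "\<bar>A $ i $ j\<bar> * \<bar>\<xi> $ j\<bar> * \<bar>\<xi> $ i\<bar> \<le> B * norm \<xi> * norm \<xi>"
      by (intro mult_mono component_le_norm_cart) auto
    then show "A $ i $ j * \<xi> $ j * \<xi> $ i \<le> B * norm \<xi> * norm \<xi>"
      by (metis abs_le_D1 abs_mult)
  qed
  finally show ?thesis by (simp add: power2_eq_square algebra_simps)
qed

locale model =
  fixes \<Omega> :: "(real ^ 'n) set" and A b c
  assumes model_problem: "model_problem \<Omega> A b c"
begin

sublocale bounded_open \<Omega>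
  using model_problem by unfold_locales (auto simp: model_problem_def lipschitz_domain_def)

abbreviation "a \<equiv> a_form \<Omega> A b c"
abbreviation "E \<equiv> \<lambda>v. LINT x|lebesgue_on \<Omega>. (A x *v grad \<Omega> v x) \<bullet> grad \<Omega> v x"

lemma coefficients: "A \<in> Linf \<Omega>" "b \<in> Linf \<Omega>" "c \<in> Linf \<Omega>"
  using model_problem by (auto simp: model_problem_def)

lemma form_integrable:
  assumes "u \<in> H1 \<Omega>" "v \<in> H1 \<Omega>"
  shows "integrable (lebesgue_on \<Omega>) (\<lambda>x. (A x *v grad \<Omega> u x) \<bullet> grad \<Omega> v x)"
    "integrable (lebesgue_on \<Omega>) (\<lambda>x. (b x \<bullet> grad \<Omega> u x) * v x)"
    "integrable (lebesgue_on \<Omega>) (\<lambda>x. c x * u x * v x)"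
  using assms coefficients
    integrable_matrix_form[of A \<Omega> "grad \<Omega> u" "grad \<Omega> v"] integrable_vector_form[of b \<Omega> "grad \<Omega> u" v]
    L2_mult_integrable[OF Linf_L2_mult[of c \<Omega> u], of v]
  by (auto simp: grad_L2 H1_L2)

lemma a_add_left:
  assumes "u \<in> H1 \<Omega>" "u' \<in> H1 \<Omega>" "v \<in> H1 \<Omega>"
  shows "a (\<lambda>x. u x + u' x) v = a u v + a u' v"
proof -
  note int = form_integrable[OF assms(1,3)] form_integrable[OF assms(2,3)] form_integrable[OF H1_add[OF assms(1,2)] assms(3)]
  have "(LINT x|lebesgue_on \<Omega>. (A x *v grad \<Omega> (\<lambda>x. u x + u' x) x) \<bullet> grad \<Omega> v x)
      = (LINT x|lebesgue_on \<Omega>. (A x *v grad \<Omega> u x) \<bullet> grad \<Omega> v x) + (LINT x|lebesgue_on \<Omega>. (A x *v grad \<Omega> u' x) \<bullet> grad \<Omega> v x)"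
    using grad_add[OF assms(1,2)]
    by (intro integral_eq_add_AE int, eventually_elim) (simp add: matrix_vector_right_distrib inner_add_left)
  moreover have "(LINT x|lebesgue_on \<Omega>. (b x \<bullet> grad \<Omega> (\<lambda>x. u x + u' x) x) * v x)
      = (LINT x|lebesgue_on \<Omega>. (b x \<bullet> grad \<Omega> u x) * v x) + (LINT x|lebesgue_on \<Omega>. (b x \<bullet> grad \<Omega> u' x) * v x)"
    using grad_add[OF assms(1,2)]
    by (intro integral_eq_add_AE int, eventually_elim) (simp add: inner_add_right distrib_right)
  moreover have "(LINT x|lebesgue_on \<Omega>. c x * (u x + u' x) * v x)
      = (LINT x|lebesgue_on \<Omega>. c x * u x * v x) + (LINT x|lebesgue_on \<Omega>. c x * u' x * v x)"
    by (intro integral_eq_add_AE int) (simp add: algebra_simps)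
  ultimately show ?thesis unfolding a_form_def by simp
qed

lemma a_add_right:
  assumes "u \<in> H1 \<Omega>" "u' \<in> H1 \<Omega>" "v \<in> H1 \<Omega>"
  shows "a v (\<lambda>x. u x + u' x) = a v u + a v u'"
proof -
  note int = form_integrable[OF assms(3,1)] form_integrable[OF assms(3,2)] form_integrable[OF assms(3) H1_add[OF assms(1,2)]]
  have "(LINT x|lebesgue_on \<Omega>. (A x *v grad \<Omega> v x) \<bullet> grad \<Omega> (\<lambda>x. u x + u' x) x)
      = (LINT x|lebesgue_on \<Omega>. (A x *v grad \<Omega> v x) \<bullet> grad \<Omega> u x) + (LINT x|lebesgue_on \<Omega>. (A x *v grad \<Omega> v x) \<bullet> grad \<Omega> u' x)"
    using grad_add[OF assms(1,2)]
    by (intro integral_eq_add_AE int, eventually_elim) (simp add: inner_add_right)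
  moreover have "(LINT x|lebesgue_on \<Omega>. (b x \<bullet> grad \<Omega> v x) * (u x + u' x))
      = (LINT x|lebesgue_on \<Omega>. (b x \<bullet> grad \<Omega> v x) * u x) + (LINT x|lebesgue_on \<Omega>. (b x \<bullet> grad \<Omega> v x) * u' x)"
    by (intro integral_eq_add_AE int) (simp add: distrib_left)
  moreover have "(LINT x|lebesgue_on \<Omega>. c x * v x * (u x + u' x))
      = (LINT x|lebesgue_on \<Omega>. c x * v x * u x) + (LINT x|lebesgue_on \<Omega>. c x * v x * u' x)"
    by (intro integral_eq_add_AE int) (simp add: algebra_simps)
  ultimately show ?thesis unfolding a_form_def by simp
qed

lemma a_scale_left:
  assumes "u \<in> H1 \<Omega>" "v \<in> H1 \<Omega>" shows "a (\<lambda>x. r * u x) v = r * a u v"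
proof -
  note int = form_integrable[OF assms] form_integrable[OF H1_scale[OF assms(1), of r] assms(2)]
  have "(LINT x|lebesgue_on \<Omega>. (A x *v grad \<Omega> (\<lambda>x. r * u x) x) \<bullet> grad \<Omega> v x)
      = r * (LINT x|lebesgue_on \<Omega>. (A x *v grad \<Omega> u x) \<bullet> grad \<Omega> v x)"
    using grad_scale[OF assms(1), of r]
    by (intro integral_eq_scale_AE int, eventually_elim) (simp add: matrix_vector_mult_scaleR)
  moreover have "(LINT x|lebesgue_on \<Omega>. (b x \<bullet> grad \<Omega> (\<lambda>x. r * u x) x) * v x)
      = r * (LINT x|lebesgue_on \<Omega>. (b x \<bullet> grad \<Omega> u x) * v x)"
    using grad_scale[OF assms(1), of r]
    by (intro integral_eq_scale_AE int, eventually_elim) simp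
  moreover have "(LINT x|lebesgue_on \<Omega>. c x * (r * u x) * v x) = r * (LINT x|lebesgue_on \<Omega>. c x * u x * v x)"
    by (intro integral_eq_scale_AE int) simp
  ultimately show ?thesis unfolding a_form_def by (simp add: algebra_simps)
qed

lemma a_scale_right:
  assumes "u \<in> H1 \<Omega>" "v \<in> H1 \<Omega>" shows "a v (\<lambda>x. r * u x) = r * a v u"
proof -
  note int = form_integrable[OF assms(2,1)] form_integrable[OF assms(2) H1_scale[OF assms(1), of r]]
  have "(LINT x|lebesgue_on \<Omega>. (A x *v grad \<Omega> v x) \<bullet> grad \<Omega> (\<lambda>x. r * u x) x)
      = r * (LINT x|lebesgue_on \<Omega>. (A x *v grad \<Omega> v x) \<bullet> grad \<Omega> u x)"
    using grad_scale[OF assms(1), of r]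
    by (intro integral_eq_scale_AE int, eventually_elim) simp
  moreover have "(LINT x|lebesgue_on \<Omega>. (b x \<bullet> grad \<Omega> v x) * (r * u x))
      = r * (LINT x|lebesgue_on \<Omega>. (b x \<bullet> grad \<Omega> v x) * u x)"
    by (intro integral_eq_scale_AE int) simp
  moreover have "(LINT x|lebesgue_on \<Omega>. c x * v x * (r * u x)) = r * (LINT x|lebesgue_on \<Omega>. c x * v x * u x)"
    by (intro integral_eq_scale_AE int) simp
  ultimately show ?thesis unfolding a_form_def by (simp add: algebra_simps)
qed

lemma energy_bounds:
  "\<exists>\<alpha> \<beta>. 0 < \<alpha> \<and> 0 < \<beta> \<and> (\<forall>v\<in>H1 \<Omega>. (energy_norm \<Omega> A v)\<^sup>2 = E v \<and>
     \<alpha> * (LINT x|lebesgue_on \<Omega>. (norm (grad \<Omega> v x))\<^sup>2) \<le> E v \<and>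
     E v \<le> \<beta> * (LINT x|lebesgue_on \<Omega>. (norm (grad \<Omega> v x))\<^sup>2))"
proof -
  obtain \<alpha> where \<alpha>: "0 < \<alpha>" "AE x in lebesgue_on \<Omega>. \<forall>\<xi>. \<alpha> * (norm \<xi>)\<^sup>2 \<le> (A x *v \<xi>) \<bullet> \<xi>"
    using model_problem by (auto simp: model_problem_def)
  obtain B where B: "AE x in lebesgue_on \<Omega>. norm (A x) \<le> B" using coefficients(1) by (auto simp: Linf_def)
  define \<beta> where "\<beta> = (real CARD('n))\<^sup>2 * max B 1"
  have \<beta>: "0 < \<beta>" unfolding \<beta>_def by (simp add: zero_less_mult_iff)
  have "(energy_norm \<Omega> A v)\<^sup>2 = E v \<and> \<alpha> * (LINT x|lebesgue_on \<Omega>. (norm (grad \<Omega> v x))\<^sup>2) \<le> E v \<and>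
     E v \<le> \<beta> * (LINT x|lebesgue_on \<Omega>. (norm (grad \<Omega> v x))\<^sup>2)" if v: "v \<in> H1 \<Omega>" for v
  proof -
    note int = form_integrable(1)[OF v v] L2_norm_integrable[OF grad_L2[OF v]]
    have "(LINT x|lebesgue_on \<Omega>. \<alpha> * (norm (grad \<Omega> v x))\<^sup>2) \<le> E v"
      using \<alpha>(2) by (intro integral_mono_AE int integrable_mult_right, eventually_elim) auto
    then have lower: "\<alpha> * (LINT x|lebesgue_on \<Omega>. (norm (grad \<Omega> v x))\<^sup>2) \<le> E v" by simp
    have "E v \<le> (LINT x|lebesgue_on \<Omega>. \<beta> * (norm (grad \<Omega> v x))\<^sup>2)"
      unfolding \<beta>_def using B
      by (intro integral_mono_AE int integrable_mult_right, eventually_elim) (auto intro!: quadratic_form_le)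
    then have upper: "E v \<le> \<beta> * (LINT x|lebesgue_on \<Omega>. (norm (grad \<Omega> v x))\<^sup>2)" by simp
    have "0 \<le> \<alpha> * (LINT x|lebesgue_on \<Omega>. (norm (grad \<Omega> v x))\<^sup>2)"
      using \<alpha>(1) by (intro mult_nonneg_nonneg integral_nonneg_AE) auto
    then have "0 \<le> E v" using lower by linarith
    then show ?thesis using lower upper by (simp add: energy_norm_def)
  qed
  then show ?thesis using \<alpha>(1) \<beta> by blast
qed

lemma ellipticity: "\<exists>C>0. \<forall>v\<in>H10 \<Omega>. C * (H1_norm \<Omega> v)\<^sup>2 \<le> a v v"
  using model_problem by (simp add: model_problem_def)

lemma continuity: "\<exists>B>0. \<forall>v\<in>H10 \<Omega>. \<forall>w\<in>H10 \<Omega>. \<bar>a v w\<bar> \<le> B * H1_norm \<Omega> v * H1_norm \<Omega> w"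
proof -
  obtain B where B: "\<forall>v\<in>H10 \<Omega>. \<forall>w\<in>H10 \<Omega>. \<bar>a v w\<bar> \<le> B * H1_norm \<Omega> v * H1_norm \<Omega> w"
    using model_problem by (auto simp: model_problem_def)
  have "\<bar>a v w\<bar> \<le> max B 1 * H1_norm \<Omega> v * H1_norm \<Omega> w" if "v \<in> H10 \<Omega>" "w \<in> H10 \<Omega>" for v w
  proof -
    have "\<bar>a v w\<bar> \<le> B * H1_norm \<Omega> v * H1_norm \<Omega> w" using B that by blast
    also have "\<dots> \<le> max B 1 * H1_norm \<Omega> v * H1_norm \<Omega> w"
      by (intro mult_right_mono) (auto simp: H1_norm_nonneg)
    finally show ?thesis .
  qed
  then show ?thesis by (intro exI[of _ "max B 1"]) auto
qed

text \<open>Ellipticity exchanges each H1 norm for the quadratic form. It is applied to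
  \<open>a\<close> itself and to \<open>K\<close>.\<close>

lemma power2_le_of_H1_bound:
  assumes "0 < C" "\<And>v. v \<in> H10 \<Omega> \<Longrightarrow> C * (H1_norm \<Omega> v)\<^sup>2 \<le> a v v" "v \<in> H10 \<Omega>" "w \<in> H10 \<Omega>"
    and "\<bar>y\<bar> \<le> B * H1_norm \<Omega> v * H1_norm \<Omega> w"
  shows "y\<^sup>2 \<le> (B / C)\<^sup>2 * a v v * a w w"
proof -
  have "\<bar>y\<bar>\<^sup>2 \<le> (B * H1_norm \<Omega> v * H1_norm \<Omega> w)\<^sup>2" using assms(5) by (intro power_mono) auto
  then have "y\<^sup>2 \<le> (B / C)\<^sup>2 * ((C * (H1_norm \<Omega> v)\<^sup>2) * (C * (H1_norm \<Omega> w)\<^sup>2))"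
    using assms(1) by (simp add: power_mult_distrib power_divide) (simp add: power2_eq_square mult_ac)
  also have "\<dots> \<le> (B / C)\<^sup>2 * (a v v * a w w)"
  proof (intro mult_left_mono mult_mono)
    show "0 \<le> a v v" using assms(2)[OF assms(3)] assms(1) by (meson mult_nonneg_nonneg order_trans less_imp_le zero_le_power2)
  qed (use assms in auto)
  finally show ?thesis by (simp add: mult.assoc)
qed

lemma a_bounded_form: "\<exists>M\<ge>0. bounded_form (H10 \<Omega>) a M"
proof -
  obtain C where C: "0 < C" "\<And>v. v \<in> H10 \<Omega> \<Longrightarrow> C * (H1_norm \<Omega> v)\<^sup>2 \<le> a v v" using ellipticity by blast
  obtain B where B: "0 < B" "\<And>v w. v \<in> H10 \<Omega> \<Longrightarrow> w \<in> H10 \<Omega> \<Longrightarrow> \<bar>a v w\<bar> \<le> B * H1_norm \<Omega> v * H1_norm \<Omega> w"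
    using continuity by blast
  have "bounded_form (H10 \<Omega>) a (B / C)"
  proof
    show "0 \<le> a v v" if "v \<in> H10 \<Omega>" for v
      using C(2)[OF that] C(1) by (meson mult_nonneg_nonneg order_trans less_imp_le zero_le_power2)
    show "(a v w)\<^sup>2 \<le> (B / C)\<^sup>2 * a v v * a w w" if "v \<in> H10 \<Omega>" "w \<in> H10 \<Omega>" for v w
      using power2_le_of_H1_bound[OF C that B(2)[OF that]] .
    show "0 \<le> B / C" using B C by simp
  qed (auto intro: H10_zero H10_add H10_scale a_add_left a_add_right a_scale_left a_scale_right H10_sub_H1)
  then show ?thesis using B(1) C(1) by (intro exI[of _ "B / C"]) auto
qed

text \<open>Estimator properties are stated in the energy norm, quasi-orthogonality in the quadratic
  form of \<open>a\<close>, which also contains the lower-order terms; \<open>c1\<close> and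
  \<open>c2\<close> translate between them.\<close>

lemma energy_equivalent:
  "\<exists>c1 c2. 0 < c1 \<and> 0 < c2 \<and> (\<forall>v\<in>H10 \<Omega>. (energy_norm \<Omega> A v)\<^sup>2 \<le> c1 * a v v \<and> a v v \<le> c2 * (energy_norm \<Omega> A v)\<^sup>2)"
proof -
  obtain C where C: "0 < C" "\<And>v. v \<in> H10 \<Omega> \<Longrightarrow> C * (H1_norm \<Omega> v)\<^sup>2 \<le> a v v" using ellipticity by blast
  obtain B where B: "0 < B" "\<And>v w. v \<in> H10 \<Omega> \<Longrightarrow> w \<in> H10 \<Omega> \<Longrightarrow> \<bar>a v w\<bar> \<le> B * H1_norm \<Omega> v * H1_norm \<Omega> w"
    using continuity by blast
  let ?G = "\<lambda>v. LINT x|lebesgue_on \<Omega>. (norm (grad \<Omega> v x))\<^sup>2"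
  obtain \<alpha> \<beta> where e: "0 < \<alpha>" "0 < \<beta>" "\<forall>v\<in>H1 \<Omega>. (energy_norm \<Omega> A v)\<^sup>2 = E v \<and> \<alpha> * ?G v \<le> E v \<and> E v \<le> \<beta> * ?G v"
    using energy_bounds by blast
  obtain D where D: "0 \<le> D" "\<forall>v\<in>H10 \<Omega>. (LINT x|lebesgue_on \<Omega>. (v x)\<^sup>2) \<le> D * ?G v" using friedrichs by blast
  have "(energy_norm \<Omega> A v)\<^sup>2 \<le> \<beta> / C * a v v \<and> a v v \<le> B * (D + 1) / \<alpha> * (energy_norm \<Omega> A v)\<^sup>2" if v: "v \<in> H10 \<Omega>" for v
  proof
    have v1: "v \<in> H1 \<Omega>" using v H10_sub_H1 by auto
    have ev: "(energy_norm \<Omega> A v)\<^sup>2 = E v" "\<alpha> * ?G v \<le> E v" "E v \<le> \<beta> * ?G v" using e(3) v1 by blast+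
    have "?G v \<le> (H1_norm \<Omega> v)\<^sup>2" unfolding H1_norm_power2 by (simp add: integral_nonneg_AE)
    also have "\<dots> \<le> a v v / C" using C(1) C(2)[OF v] by (simp add: field_simps)
    finally have "\<beta> * ?G v \<le> \<beta> * (a v v / C)" using e(2) by (intro mult_left_mono) auto
    then show "(energy_norm \<Omega> A v)\<^sup>2 \<le> \<beta> / C * a v v" using ev by simp
    have "a v v \<le> B * (H1_norm \<Omega> v)\<^sup>2" using B(2)[OF v v] by (simp add: power2_eq_square mult.assoc)
    also have "\<dots> \<le> B * ((D + 1) * ?G v)"
      using D(2) v B(1) unfolding H1_norm_power2 by (intro mult_left_mono) (auto simp: algebra_simps)
    also have "\<dots> \<le> B * ((D + 1) * (E v / \<alpha>))"
      using ev(2) e(1) B(1) D(1) by (intro mult_left_mono) (auto simp: field_simps)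
    finally show "a v v \<le> B * (D + 1) / \<alpha> * (energy_norm \<Omega> A v)\<^sup>2" using ev(1) by simp
  qed
  moreover have "0 < \<beta> / C" "0 < B * (D + 1) / \<alpha>" using e B C D by auto
  ultimately show ?thesis by blast
qed

end

section \<open>Compact operators are bounded\<close>

context model
begin

text \<open>The bound by \<open>B\<close> makes the set below the supremum bounded; without this a
  real \<open>SUP\<close> says nothing about its elements.\<close>

lemma le_Hm1_norm:
  assumes B: "\<And>w. w \<in> H10 \<Omega> \<Longrightarrow> \<bar>f w\<bar> \<le> B * H1_norm \<Omega> w" and w: "w \<in> H10 \<Omega>" "H1_norm \<Omega> w \<le> 1"
  shows "\<bar>f w\<bar> \<le> Hm1_norm \<Omega> f"
  unfolding Hm1_norm_def
proof (rule cSUP_upper)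
  show "bdd_above ((\<lambda>w. \<bar>f w\<bar>) ` {w \<in> H10 \<Omega>. H1_norm \<Omega> w \<le> 1})"
  proof (rule bdd_aboveI2)
    fix w assume w: "w \<in> {w \<in> H10 \<Omega>. H1_norm \<Omega> w \<le> 1}"
    then have "\<bar>f w\<bar> \<le> B * H1_norm \<Omega> w" using B by blast
    also have "\<dots> \<le> \<bar>B\<bar> * 1" using w by (intro mult_mono) (auto simp: H1_norm_nonneg)
    finally show "\<bar>f w\<bar> \<le> \<bar>B\<bar>" by simp
  qed
qed (use w in auto)

text \<open>Otherwise some unit vectors give values above every \<open>n\<close>. Along a
  subsequence the functionals converge to a bounded \<open>\<psi>\<close> in the dual norm,
  uniformly over the unit ball and hence also at the moving second arguments, which keeps the values
  bounded.\<close>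

lemma compact_operator_bounded_on_unit_ball:
  assumes K: "compact_linear_operator \<Omega> K"
  shows "\<exists>n::nat. \<forall>v\<in>H10 \<Omega>. \<forall>w\<in>H10 \<Omega>. H1_norm \<Omega> v \<le> 1 \<longrightarrow> H1_norm \<Omega> w \<le> 1 \<longrightarrow> \<bar>K v w\<bar> \<le> real n"
proof (rule ccontr)
  assume "\<not> ?thesis"
  then have "\<forall>n::nat. \<exists>v w. v \<in> H10 \<Omega> \<and> w \<in> H10 \<Omega> \<and> H1_norm \<Omega> v \<le> 1 \<and> H1_norm \<Omega> w \<le> 1 \<and> real n < \<bar>K v w\<bar>"
    by (meson not_le)
  then obtain v w where vw: "\<And>n::nat. v n \<in> H10 \<Omega> \<and> w n \<in> H10 \<Omega> \<and> H1_norm \<Omega> (v n) \<le> 1 \<and> H1_norm \<Omega> (w n) \<le> 1 \<and> real n < \<bar>K (v n) (w n)\<bar>"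
    by metis
  have "(\<forall>k. v k \<in> H10 \<Omega>) \<and> (\<exists>B. \<forall>k. H1_norm \<Omega> (v k) \<le> B)" using vw by blast
  then obtain r \<psi> where r: "strict_mono r" and \<psi>: "\<psi> \<in> Hm1 \<Omega>"
    and lim: "(\<lambda>k. Hm1_norm \<Omega> (\<lambda>w. K (v (r k)) w - \<psi> w)) \<longlonglongrightarrow> 0"
    using K unfolding compact_linear_operator_def by blast
  obtain B where B: "\<And>w. w \<in> H10 \<Omega> \<Longrightarrow> \<bar>\<psi> w\<bar> \<le> B * H1_norm \<Omega> w" using \<psi> unfolding Hm1_def by blast
  have "eventually (\<lambda>k. Hm1_norm \<Omega> (\<lambda>w. K (v (r k)) w - \<psi> w) < 1) sequentially"
    using lim by (rule order_tendstoD) simp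
  moreover have "eventually (\<lambda>k. 1 + \<bar>B\<bar> \<le> real k) sequentially"
    by (rule eventually_sequentiallyI[of "nat \<lceil>1 + \<bar>B\<bar>\<rceil>"]) linarith
  ultimately have "eventually (\<lambda>k. Hm1_norm \<Omega> (\<lambda>w. K (v (r k)) w - \<psi> w) < 1 \<and> 1 + \<bar>B\<bar> \<le> real k) sequentially"
    by (rule eventually_conj)
  then obtain k where k: "Hm1_norm \<Omega> (\<lambda>w. K (v (r k)) w - \<psi> w) < 1" "1 + \<bar>B\<bar> \<le> real k"
    by (auto simp: eventually_sequentially)
  have wk: "w (r k) \<in> H10 \<Omega>" "H1_norm \<Omega> (w (r k)) \<le> 1" using vw by blast+
  have "K (v (r k)) \<in> Hm1 \<Omega>" using K vw unfolding compact_linear_operator_def by blast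
  then obtain B' where B': "\<And>w. w \<in> H10 \<Omega> \<Longrightarrow> \<bar>K (v (r k)) w\<bar> \<le> B' * H1_norm \<Omega> w" unfolding Hm1_def by blast
  have "\<bar>K (v (r k)) w - \<psi> w\<bar> \<le> (B' + B) * H1_norm \<Omega> w" if "w \<in> H10 \<Omega>" for w
    using B[OF that] B'[OF that] by (simp add: distrib_right)
  then have "\<bar>K (v (r k)) (w (r k)) - \<psi> (w (r k))\<bar> \<le> Hm1_norm \<Omega> (\<lambda>w. K (v (r k)) w - \<psi> w)"
    by (intro le_Hm1_norm[where f = "\<lambda>w. K (v (r k)) w - \<psi> w" and B = "B' + B"] wk) auto
  moreover have "\<bar>\<psi> (w (r k))\<bar> \<le> \<bar>B\<bar> * 1"
  proof -
    have "\<bar>\<psi> (w (r k))\<bar> \<le> B * H1_norm \<Omega> (w (r k))" using B wk by blast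
    also have "\<dots> \<le> \<bar>B\<bar> * 1" using wk by (intro mult_mono) (auto simp: H1_norm_nonneg)
    finally show ?thesis .
  qed
  ultimately have "\<bar>K (v (r k)) (w (r k))\<bar> < 1 + \<bar>B\<bar>" using k(1) by linarith
  moreover have "real k \<le> real (r k)" using strict_mono_imp_increasing[OF r] by simp
  moreover have "real (r k) < \<bar>K (v (r k)) (w (r k))\<bar>" using vw by blast
  ultimately show False using k(2) by linarith
qed

lemma compact_operator_linear:
  assumes K: "compact_linear_operator \<Omega> K" and "v \<in> H10 \<Omega>" "v' \<in> H10 \<Omega>" "w \<in> H10 \<Omega>"
  shows "K (\<lambda>x. v x + v' x) w = K v w + K v' w" "K w (\<lambda>x. v x + v' x) = K w v + K w v'"
    "K (\<lambda>x. r * v x) w = r * K v w" "K w (\<lambda>x. r * v x) = r * K w v"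
proof -
  have "K w \<in> Hm1 \<Omega>" using K assms(4) unfolding compact_linear_operator_def by blast
  then show "K w (\<lambda>x. v x + v' x) = K w v + K w v'" "K w (\<lambda>x. r * v x) = r * K w v"
    using assms(2,3) unfolding Hm1_def by blast+
  show "K (\<lambda>x. v x + v' x) w = K v w + K v' w" "K (\<lambda>x. r * v x) w = r * K v w"
    using assms unfolding compact_linear_operator_def by blast+
qed

text \<open>Both arguments are normalised to the unit ball and the value scales bilinearly.\<close>

lemma compact_operator_bounded:
  assumes K: "compact_linear_operator \<Omega> K"
  shows "\<exists>B\<ge>0. \<forall>v\<in>H10 \<Omega>. \<forall>w\<in>H10 \<Omega>. \<bar>K v w\<bar> \<le> B * H1_norm \<Omega> v * H1_norm \<Omega> w"
proof -
  obtain n :: nat where n: "\<And>v w. v \<in> H10 \<Omega> \<Longrightarrow> w \<in> H10 \<Omega> \<Longrightarrow> H1_norm \<Omega> v \<le> 1 \<Longrightarrow> H1_norm \<Omega> w \<le> 1 \<Longrightarrow> \<bar>K v w\<bar> \<le> real n"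
    using compact_operator_bounded_on_unit_ball[OF K] by blast
  have "\<bar>K v w\<bar> \<le> real n * H1_norm \<Omega> v * H1_norm \<Omega> w" if v: "v \<in> H10 \<Omega>" and w: "w \<in> H10 \<Omega>" for v w
  proof -
    have scaled: "\<bar>r * s * K v w\<bar> \<le> real n" if "\<bar>r\<bar> * H1_norm \<Omega> v \<le> 1" "\<bar>s\<bar> * H1_norm \<Omega> w \<le> 1" for r s
    proof -
      have "\<bar>K (\<lambda>x. r * v x) (\<lambda>x. s * w x)\<bar> \<le> real n"
        using that v w by (intro n H10_scale) (auto simp: H1_norm_scale H10_sub_H1)
      then show ?thesis
        using compact_operator_linear(3)[OF K v v H10_scale[OF w, of s], of r] compact_operator_linear(4)[OF K w w v, of s]
        by (simp add: mult.assoc)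
    qed
    show ?thesis
    proof (cases "H1_norm \<Omega> v = 0 \<or> H1_norm \<Omega> w = 0")
      \<comment> \<open>A function of norm zero cannot be normalised, but it can be scaled
        arbitrarily without leaving the unit ball, so a nonzero value would become too
        large.\<close>
      case True
      have "K v w = 0"
      proof (rule ccontr)
        assume nz: "K v w \<noteq> 0"
        define t where "t = (real n + 1) / K v w"
        have t: "\<bar>t * K v w\<bar> = real n + 1" using nz by (simp add: t_def)
        from True show False
        proof
          assume v0: "H1_norm \<Omega> v = 0"
          have s: "\<bar>1 / (H1_norm \<Omega> w + 1)\<bar> * H1_norm \<Omega> w \<le> 1" using H1_norm_nonneg[of \<Omega> w] by (simp add: field_simps)
          have "\<bar>(t * (H1_norm \<Omega> w + 1)) * (1 / (H1_norm \<Omega> w + 1)) * K v w\<bar> \<le> real n"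
            using v0 s by (intro scaled) auto
          then show False using t H1_norm_nonneg[of \<Omega> w] by simp
        next
          assume w0: "H1_norm \<Omega> w = 0"
          have s: "\<bar>1 / (H1_norm \<Omega> v + 1)\<bar> * H1_norm \<Omega> v \<le> 1" using H1_norm_nonneg[of \<Omega> v] by (simp add: field_simps)
          have "\<bar>(1 / (H1_norm \<Omega> v + 1)) * (t * (H1_norm \<Omega> v + 1)) * K v w\<bar> \<le> real n"
            using w0 s by (intro scaled) auto
          then show False using t H1_norm_nonneg[of \<Omega> v] by simp
        qed
      qed
      then show ?thesis by (simp add: H1_norm_nonneg)
    next
      case False
      then have pos: "0 < H1_norm \<Omega> v" "0 < H1_norm \<Omega> w" using H1_norm_nonneg[of \<Omega> v] H1_norm_nonneg[of \<Omega> w] by linarith+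
      have "\<bar>1 / H1_norm \<Omega> v * (1 / H1_norm \<Omega> w) * K v w\<bar> \<le> real n" using pos by (intro scaled) auto
      then show ?thesis using pos by (simp add: abs_mult field_simps)
    qed
  qed
  then show ?thesis by (intro exI[of _ "real n"]) auto
qed

lemma compact_operator_form_bounded:
  assumes K: "compact_linear_operator \<Omega> K"
  shows "\<exists>\<kappa>\<ge>0. \<forall>v\<in>H10 \<Omega>. \<forall>w\<in>H10 \<Omega>. (K v w)\<^sup>2 \<le> \<kappa>\<^sup>2 * a v v * a w w"
proof -
  obtain C where C: "0 < C" "\<And>v. v \<in> H10 \<Omega> \<Longrightarrow> C * (H1_norm \<Omega> v)\<^sup>2 \<le> a v v" using ellipticity by blast
  obtain B where B: "0 \<le> B" "\<And>v w. v \<in> H10 \<Omega> \<Longrightarrow> w \<in> H10 \<Omega> \<Longrightarrow> \<bar>K v w\<bar> \<le> B * H1_norm \<Omega> v * H1_norm \<Omega> w"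
    using compact_operator_bounded[OF K] by blast
  have "\<forall>v\<in>H10 \<Omega>. \<forall>w\<in>H10 \<Omega>. (K v w)\<^sup>2 \<le> (B / C)\<^sup>2 * a v v * a w w"
    using power2_le_of_H1_bound[OF C _ _ B(2)] by blast
  moreover have "0 \<le> B / C" using B C by simp
  ultimately show ?thesis by blast
qed

end

section \<open>Decay along selected steps, and counting of marked elements\<close>

text \<open>The enumeration is continued by the constant \<open>n\<close>, which lies above
  \<open>S\<close>; strict increase therefore includes the step from the last element of
  \<open>S\<close> to \<open>n\<close>.\<close>

lemma finite_set_enumeration:
  assumes "S \<subseteq> {l..<n::nat}"
  obtains g where "\<And>k. k < card S \<Longrightarrow> g k \<in> S" "\<And>i j. i < j \<Longrightarrow> i < card S \<Longrightarrow> g i < g j"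
    "\<And>j. card S \<le> j \<Longrightarrow> g j = n"
proof -
  define xs where "xs = sorted_list_of_set S"
  have fin: "finite S" using assms finite_subset by blast
  have xs: "set xs = S" "length xs = card S" "sorted_wrt (<) xs"
    unfolding xs_def using fin by auto
  define g where "g k = (if k < card S then xs ! k else n)" for k
  have mem: "g k \<in> S" if "k < card S" for k using that xs by (auto simp: g_def)
  have "g i < g j" if "i < j" "i < card S" for i j
  proof (cases "j < card S")
    case True
    then show ?thesis using that xs sorted_wrt_nth_less[of "(<)" xs i j] by (simp add: g_def)
  next
    case False
    then have "g j = n" by (simp add: g_def)
    then show ?thesis using mem[OF that(2)] assms by auto
  qed
  then show ?thesis using that[of g] mem by (auto simp: g_def)
qed

text \<open>The meshes with index in \<open>S\<close>, followed by the final mesh, form a refinement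
  sequence of their own. Elements refined right after step \<open>k\<close> never return, by
  \<open>gone\<close>, so the Doerfler criterion survives the skipping of meshes. The extra square
  covers the stretch from \<open>l\<close> to the first index.\<close>

lemma (in galerkin_estimator) linear_convergence_on_subset:
  fixes f :: "nat \<Rightarrow> 'e set"
  assumes rate: "linear_rate M Cs Cr q \<theta> C r" and \<theta>: "0 < \<theta>" "\<theta> \<le> 1"
    and f: "\<And>k. f k \<in> \<TT>" and f_R: "\<And>i j. i \<le> j \<Longrightarrow> f j \<in> R (f i)"
    and gone: "\<And>i j. i < j \<Longrightarrow> f i - f (Suc i) \<subseteq> f i - f j"
    and S: "S \<subseteq> {l..<n}" and "l \<le> n"
    and doerfler: "\<And>k. k \<in> S \<Longrightarrow> \<theta> * est2 (f k) \<le> (\<Sum>T\<in>f k - f (Suc k). ind (f k) T (UH (f k)))"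
  shows "est2 (f n) \<le> C * (1 + Cs * M * Cr)\<^sup>2 * r ^ card S * est2 (f l)"
proof -
  obtain g where g: "\<And>k. k < card S \<Longrightarrow> g k \<in> S" "\<And>i j. i < j \<Longrightarrow> i < card S \<Longrightarrow> g i < g j"
    "\<And>j. card S \<le> j \<Longrightarrow> g j = n"
    using finite_set_enumeration[OF S] by blast
  have mono: "g i \<le> g j" if "i \<le> j" for i j
  proof (cases "i < card S")
    case True
    then show ?thesis using g(2)[of i j] that by (cases "i = j") auto
  qed (use g(3) that in auto)
  have "l \<le> g 0"
  proof (cases "card S = 0")
    case True
    then show ?thesis using g(3)[of 0] \<open>l \<le> n\<close> by simp
  next
    case False
    then show ?thesis using g(1)[of 0] S by auto
  qed
  have "est2 (f (g (card S))) \<le> C * r ^ card S * est2 (f (g 0))"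
  proof (rule linear_convergence[OF rate \<theta>, of "\<lambda>k. f (g k)"])
    fix k assume k: "k < card S"
    have "\<theta> * est2 (f (g k)) \<le> (\<Sum>T\<in>f (g k) - f (Suc (g k)). ind (f (g k)) T (UH (f (g k))))"
      using g(1)[OF k] by (rule doerfler)
    also have "\<dots> \<le> (\<Sum>T\<in>f (g k) - f (g (Suc k)). ind (f (g k)) T (UH (f (g k))))"
      using g(2)[OF _ k, of "Suc k"] by (intro sum_mono2 gone) (auto simp: ind_nonneg finite_mesh f)
    finally show "\<theta> * est2 (f (g k)) \<le> (\<Sum>T\<in>f (g k) - f (g (Suc k)). ind (f (g k)) T (UH (f (g k))))" .
  qed (use f f_R mono in auto)
  also have "\<dots> \<le> C * r ^ card S * ((1 + Cs * M * Cr)\<^sup>2 * est2 (f l))"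
  proof (rule mult_left_mono)
    have "(sqrt (est2 (f (g 0))))\<^sup>2 \<le> ((1 + Cs * M * Cr) * sqrt (est2 (f l)))\<^sup>2"
      using quasi_monotone[OF f f_R[OF \<open>l \<le> g 0\<close>]] by (intro power_mono) (auto simp: est2_nonneg)
    then show "est2 (f (g 0)) \<le> (1 + Cs * M * Cr)\<^sup>2 * est2 (f l)" by (simp add: est2_nonneg power_mult_distrib)
    show "0 \<le> C * r ^ card S" using rate by (auto simp: linear_rate_def)
  qed
  finally show ?thesis using g(3)[of "card S"] by (simp add: mult_ac)
qed

lemma geometric_sum_le:
  fixes q :: real
  assumes "0 < q" "q < 1" shows "(\<Sum>j<l. q ^ (l - j)) \<le> 1 / (1 - q)"
proof -
  have "(\<Sum>j<l. q ^ (l - j)) = (\<Sum>j<l. q ^ Suc j)"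
    using sum.nat_diff_reindex[of "\<lambda>j. q ^ Suc j" l] by (simp add: Suc_diff_Suc)
  also have "\<dots> \<le> (\<Sum>j<l. q ^ j)" using assms by (intro sum_mono power_decreasing) auto
  also have "\<dots> = (1 - q ^ l) / (1 - q)" using assms by (simp add: sum_gp_strict)
  also have "\<dots> \<le> 1 / (1 - q)" using assms by (intro divide_right_mono) auto
  finally show ?thesis .
qed

text \<open>Linear convergence turns \<open>1 / p j\<close> into a multiple of
  \<open>q ^ (l - j) / p l\<close>, so the bounds on the \<open>m j\<close> form a geometric series
  dominated by its last terms. The constant is stated with \<open>\<alpha>max\<close> to be uniform
  in \<open>\<alpha>\<close>.\<close>

lemma optimal_rate_of_counting:
  fixes p m :: "nat \<Rightarrow> real" and q Clin Cm Cmesh D N \<alpha> \<alpha>max :: real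
  assumes lin: "\<And>j. j \<le> l \<Longrightarrow> p l \<le> Clin * q ^ (l - j) * p j" and q: "0 < q" "q < 1" and Clin: "0 < Clin"
    and \<alpha>: "0 < \<alpha>" "\<alpha> \<le> \<alpha>max" and D: "0 < D" and Cm: "0 \<le> Cm" and Cmesh: "0 \<le> Cmesh"
    and N: "0 \<le> N" "N \<le> Cmesh * (\<Sum>j<l. m j)"
    and m: "\<And>j. 0 < p j \<Longrightarrow> m j \<le> Cm * (D / p j) powr (1 / \<alpha>)" and p: "\<And>j. 0 \<le> p j" "0 < p l"
  shows "p l * N powr \<alpha> \<le> (max 1 (Cmesh * Cm) / (1 - q powr (1 / \<alpha>max))) powr \<alpha>max * Clin * D"
proof -
  define q' where "q' = q powr (1 / \<alpha>max)"
  have amax: "0 < \<alpha>max" using \<alpha> by linarith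
  have q': "0 < q'" "q' < 1" unfolding q'_def using q amax powr01_less_one[of q "1 / \<alpha>max"] by auto
  define W where "W = (D * Clin / p l) powr (1 / \<alpha>)"
  have W: "0 \<le> W" by (simp add: W_def)
  have mj: "m j \<le> Cm * W * q' ^ (l - j)" if j: "j < l" for j
  proof -
    have pl: "p l \<le> Clin * q ^ (l - j) * p j" using lin j by simp
    have pj: "0 < p j"
    proof (rule ccontr)
      assume "\<not> 0 < p j"
      then have "p j = 0" using p(1)[of j] by simp
      then show False using pl p(2) by simp
    qed
    have "D / p j \<le> D * Clin / p l * q ^ (l - j)"
      using pl pj p(2) D by (simp add: field_simps mult_left_mono)
    then have "(D / p j) powr (1 / \<alpha>) \<le> (D * Clin / p l * q ^ (l - j)) powr (1 / \<alpha>)"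
      using \<alpha> D pj by (intro powr_mono2) auto
    also have "\<dots> = W * (q ^ (l - j)) powr (1 / \<alpha>)"
      unfolding W_def by (rule powr_mult)
    also have "(q ^ (l - j)) powr (1 / \<alpha>) = (q powr (1 / \<alpha>)) ^ (l - j)"
      using q by (simp add: powr_powr mult.commute flip: powr_realpow)
    also have "(q powr (1 / \<alpha>)) ^ (l - j) \<le> q' ^ (l - j)"
      unfolding q'_def using q \<alpha> amax by (intro power_mono powr_mono') (auto simp: field_simps)
    finally have "(D / p j) powr (1 / \<alpha>) \<le> W * q' ^ (l - j)" using W by (simp add: mult_left_mono)
    then have "Cm * (D / p j) powr (1 / \<alpha>) \<le> Cm * (W * q' ^ (l - j))" using Cm by (rule mult_left_mono)
    then show ?thesis using m[OF pj] by (simp add: mult.assoc)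
  qed
  have "N \<le> Cmesh * (\<Sum>j<l. m j)" by (rule N(2))
  also have "\<dots> \<le> Cmesh * (\<Sum>j<l. Cm * W * q' ^ (l - j))" using Cmesh mj by (intro mult_left_mono sum_mono) auto
  also have "\<dots> = Cmesh * Cm * W * (\<Sum>j<l. q' ^ (l - j))" by (simp add: sum_distrib_left mult.assoc)
  also have "\<dots> \<le> Cmesh * Cm * W * (1 / (1 - q'))"
    using geometric_sum_le[OF q'] Cmesh Cm W by (intro mult_left_mono) auto
  \<comment> \<open>The maximum makes the base of the later power at least 1, so that
    \<open>\<alpha>\<close> may be replaced by \<open>\<alpha>max\<close>.\<close>
  also have "\<dots> \<le> max 1 (Cmesh * Cm) * W * (1 / (1 - q'))"
    using W q' by (intro mult_right_mono) auto
  finally have "N \<le> max 1 (Cmesh * Cm) / (1 - q') * W" by simp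
  then have "N powr \<alpha> \<le> (max 1 (Cmesh * Cm) / (1 - q') * W) powr \<alpha>" using N \<alpha> by (intro powr_mono2) auto
  also have "\<dots> = (max 1 (Cmesh * Cm) / (1 - q')) powr \<alpha> * W powr \<alpha>" by (rule powr_mult)
  also have "W powr \<alpha> = D * Clin / p l" unfolding W_def using \<alpha> D Clin p(2) by (simp add: powr_powr)
  also have "(max 1 (Cmesh * Cm) / (1 - q')) powr \<alpha> \<le> (max 1 (Cmesh * Cm) / (1 - q')) powr \<alpha>max"
  proof (rule powr_mono)
    have "1 / 1 \<le> max 1 (Cmesh * Cm) / (1 - q')" using q' by (intro frac_le) auto
    then show "1 \<le> max 1 (Cmesh * Cm) / (1 - q')" by simp
  qed (rule \<alpha>)
  then have "(max 1 (Cmesh * Cm) / (1 - q')) powr \<alpha> * (D * Clin / p l)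
      \<le> (max 1 (Cmesh * Cm) / (1 - q')) powr \<alpha>max * (D * Clin / p l)"
    using D Clin p(2) by (intro mult_right_mono) auto
  finally show ?thesis using p(2) unfolding q'_def by (simp add: field_simps)
qed

section \<open>Meshes\<close>

lemma refinements_trans:
  assumes "h \<in> refinements r H" "k \<in> refinements r h" shows "k \<in> refinements r H"
  using assms(2)
proof induction
  case base
  then show ?case using assms(1) .
next
  case (step k \<M>)
  then show ?case by (blast intro: refinements.step)
qed

lemma refinement_strategy_step:
  assumes "refinement_strategy \<Omega> T0 r" "H \<in> refinements r T0" "\<M> \<subseteq> H"
  shows "conforming_triangulation \<Omega> (r H \<M>)" "\<forall>T'\<in>r H \<M>. \<exists>T\<in>H. T' \<subseteq> T" "\<M> \<subseteq> H - r H \<M>"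
  using assms(1)[unfolded refinement_strategy_def, THEN conjunct2, rule_format, OF assms(2,3)] by simp_all

lemma refinements_conforming:
  assumes "refinement_strategy \<Omega> T0 r" "H \<in> refinements r T0" shows "conforming_triangulation \<Omega> H"
  using assms(2)
proof cases
  case base
  then show ?thesis using assms(1) by (simp add: refinement_strategy_def)
next
  case (step H' \<M>)
  then show ?thesis using refinement_strategy_step(1)[OF assms(1)] by simp
qed

lemma refinements_finite:
  assumes "refinement_strategy \<Omega> T0 r" "H \<in> refinements r T0" shows "finite H"
  using refinements_conforming[OF assms] by (simp add: conforming_triangulation_def triangulation_def)

lemma refinements_subset:
  assumes strat: "refinement_strategy \<Omega> T0 r" and H: "H \<in> refinements r T0" and h: "h \<in> refinements r H"
    and T: "T \<in> h"
  shows "\<exists>T'\<in>H. T \<subseteq> T'"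
  using h T
proof (induction arbitrary: T)
  case base
  then show ?case by blast
next
  case (step k \<M>)
  have "k \<in> refinements r T0" using refinements_trans[OF H step(1)] .
  then obtain T'' where "T'' \<in> k" "T \<subseteq> T''" using refinement_strategy_step(2)[OF strat _ step(2)] step(4) by blast
  with step(3)[of T''] show ?case by blast
qed

text \<open>Conformity makes the intersection \<open>T\<close> a face of \<open>T'\<close>; a proper
  face would have smaller dimension, but both simplices are full-dimensional.\<close>

lemma conforming_triangulation_subset_eq:
  fixes T T' :: "(real ^ 'n) set"
  assumes "conforming_triangulation \<Omega> H" "T \<in> H" "T' \<in> H" "T \<subseteq> T'" shows "T = T'"
proof (rule ccontr)
  assume ne: "T \<noteq> T'"
  have s: "int CARD('n) simplex T" "int CARD('n) simplex T'" and f: "(T' \<inter> T) face_of T'"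
    using assms unfolding conforming_triangulation_def triangulation_def by blast+
  have "T' \<inter> T = T" using assms(4) by blast
  then have "aff_dim T < aff_dim T'" using face_of_aff_dim_lt[of T' T] f ne convex_simplex[OF s(2)] by simp
  then show False using aff_dim_simplex[OF s(1)] aff_dim_simplex[OF s(2)] by simp
qed

text \<open>An element of \<open>H\<close> that reappears in \<open>k\<close> lies in some element
  of \<open>h\<close>, which lies in an element of \<open>H\<close>. The two elements of
  \<open>H\<close> coincide, so the one of \<open>h\<close> between them is the same set.\<close>

lemma refined_elements_gone:
  assumes strat: "refinement_strategy \<Omega> T0 r" and H: "H \<in> refinements r T0" and h: "h \<in> refinements r H"
    and k: "k \<in> refinements r h"
  shows "H - h \<subseteq> H - k"
proof
  fix T assume T: "T \<in> H - h"
  have "T \<notin> k"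
  proof
    assume "T \<in> k"
    then obtain T' where T': "T' \<in> h" "T \<subseteq> T'"
      using refinements_subset[OF strat refinements_trans[OF H h] k] by blast
    then obtain T'' where T'': "T'' \<in> H" "T' \<subseteq> T''" using refinements_subset[OF strat H h] by blast
    have "T = T''"
      using T T' T'' by (intro conforming_triangulation_subset_eq[OF refinements_conforming[OF strat H]]) auto
    then have "T = T'" using T' T'' by blast
    then show False using T T' by blast
  qed
  then show "T \<in> H - k" using T by blast
qed

lemma fe_space_nested:
  assumes strat: "refinement_strategy \<Omega> T0 r" and H: "H \<in> refinements r T0" and h: "h \<in> refinements r H" and "open \<Omega>"
  shows "fe_space \<Omega> p H \<subseteq> fe_space \<Omega> p h"
proof
  fix v assume v: "v \<in> fe_space \<Omega> p H"
  have sets: "T \<inter> \<Omega> \<inter> space lebesgue \<in> sets lebesgue" if "T \<in> k" "k \<in> refinements r T0" for T k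
  proof -
    have "closed T" using refinements_conforming[OF strat that(2)] that(1)
      unfolding conforming_triangulation_def using closed_simplex by blast
    then have "T \<inter> \<Omega> \<in> sets borel" using \<open>open \<Omega>\<close> by (intro sets.Int borel_closed borel_open)
    then show ?thesis by simp
  qed
  have "\<exists>q\<in>polynomials p. AE x in lebesgue_on (T \<inter> \<Omega>). v x = q x" if T: "T \<in> h" for T
  proof -
    obtain T' where T': "T' \<in> H" "T \<subseteq> T'" using refinements_subset[OF strat H h T] by blast
    then obtain q where q: "q \<in> polynomials p" "AE x in lebesgue_on (T' \<inter> \<Omega>). v x = q x"
      using v unfolding fe_space_def by blast
    have "AE x in lebesgue. x \<in> T' \<inter> \<Omega> \<longrightarrow> v x = q x"
      using q(2) AE_restrict_space_iff[OF sets[OF T'(1) H]] by simp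
    then have "AE x in lebesgue. x \<in> T \<inter> \<Omega> \<longrightarrow> v x = q x" by eventually_elim (use T'(2) in auto)
    then have "AE x in lebesgue_on (T \<inter> \<Omega>). v x = q x"
      using AE_restrict_space_iff[OF sets[OF T refinements_trans[OF H h]]] by simp
    then show ?thesis using q(1) by blast
  qed
  then show "v \<in> fe_space \<Omega> p h" using v unfolding fe_space_def by blast
qed

section \<open>The coupled primal-dual problem\<close>

lemma abs_le_of_power2_le:
  fixes y :: real
  assumes "y\<^sup>2 \<le> M\<^sup>2 * s * t" "0 \<le> M" "0 \<le> s" "0 \<le> t" shows "\<bar>y\<bar> \<le> M * sqrt s * sqrt t"
proof -
  have "\<bar>y\<bar> = sqrt (y\<^sup>2)" by simp
  also have "\<dots> \<le> sqrt (M\<^sup>2 * s * t)" using assms(1) by (rule real_sqrt_le_mono)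
  finally show ?thesis using assms by (simp add: real_sqrt_mult)
qed

lemma power2_form_bound:
  fixes x y x' y' :: real
  assumes "\<bar>z\<bar> \<le> l * M * x * x' + M * y' * y + 2 * k * x * y'" "0 \<le> x" "0 \<le> y" "0 \<le> x'" "0 \<le> y'" "0 \<le> l" "0 \<le> M" "0 \<le> k"
  shows "z\<^sup>2 \<le> (l * M + M + 2 * k)\<^sup>2 * (x\<^sup>2 + y\<^sup>2) * (x'\<^sup>2 + y'\<^sup>2)"
proof -
  define n where "n = sqrt (x\<^sup>2 + y\<^sup>2)"
  define n' where "n' = sqrt (x'\<^sup>2 + y'\<^sup>2)"
  have n: "x \<le> n" "y \<le> n" "x' \<le> n'" "y' \<le> n'" "0 \<le> n" "0 \<le> n'" by (auto simp: n_def n'_def intro: real_le_rsqrt)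
  have "x * x' \<le> n * n'" "y' * y \<le> n * n'" "x * y' \<le> n * n'"
    using n assms mult_mono[of x n x' n'] mult_mono[of y n y' n'] mult_mono[of x n y' n'] by (auto simp: mult.commute)
  then have "l * M * (x * x') \<le> l * M * (n * n')" "M * (y' * y) \<le> M * (n * n')" "2 * k * (x * y') \<le> 2 * k * (n * n')"
    using assms by (auto intro: mult_left_mono)
  then have "\<bar>z\<bar> \<le> (l * M + M + 2 * k) * (n * n')" using assms(1) by (simp add: algebra_simps)
  then have "\<bar>z\<bar>\<^sup>2 \<le> ((l * M + M + 2 * k) * (n * n'))\<^sup>2" by (intro power_mono) auto
  also have "\<dots> = (l * M + M + 2 * k)\<^sup>2 * (x\<^sup>2 + y\<^sup>2) * (x'\<^sup>2 + y'\<^sup>2)"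
    by (simp add: power_mult_distrib n_def n'_def)
  finally show ?thesis by simp
qed

text \<open>The constants are locale parameters, chosen once from \<open>a\<close> and
  \<open>K\<close> and shared by all discretisations.\<close>

locale goal_problem = model \<Omega> A b c
  for \<Omega> :: "(real ^ 'n) set" and A b c +
  fixes K :: "(real ^ 'n \<Rightarrow> real) \<Rightarrow> (real ^ 'n \<Rightarrow> real) \<Rightarrow> real" and M \<kappa> c1 c2 :: real
  assumes K: "compact_linear_operator \<Omega> K"
    and M: "0 \<le> M" "bounded_form (H10 \<Omega>) (a_form \<Omega> A b c) M"
    and \<kappa>: "0 \<le> \<kappa>" "\<And>v w. v \<in> H10 \<Omega> \<Longrightarrow> w \<in> H10 \<Omega> \<Longrightarrow> (K v w)\<^sup>2 \<le> \<kappa>\<^sup>2 * a_form \<Omega> A b c v v * a_form \<Omega> A b c w w"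
    and c1: "0 < c1" "\<And>v. v \<in> H10 \<Omega> \<Longrightarrow> (energy_norm \<Omega> A v)\<^sup>2 \<le> c1 * a_form \<Omega> A b c v v"
    and c2: "0 < c2" "\<And>v. v \<in> H10 \<Omega> \<Longrightarrow> a_form \<Omega> A b c v v \<le> c2 * (energy_norm \<Omega> A v)\<^sup>2"
begin

sublocale prim: bounded_form "H10 \<Omega>" "a_form \<Omega> A b c" M by (rule M(2))

text \<open>In dual problems the test function is the first argument of \<open>a\<close>, so they
  are Galerkin problems for the transposed form, which has the same quadratic form and the same
  bound.\<close>

lemma dual_form: "bounded_form (H10 \<Omega>) (\<lambda>v w. a_form \<Omega> A b c w v) M"
proof
  fix v w assume "v \<in> H10 \<Omega>" "w \<in> H10 \<Omega>"
  then show "(a w v)\<^sup>2 \<le> M\<^sup>2 * a v v * a w w" using prim.bounded[of w v] by (simp add: mult_ac)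
qed (auto simp: prim.zero_mem prim.add_mem prim.scale_mem prim.add_left prim.add_right prim.scale_left
  prim.scale_right prim.nonneg prim.M_nonneg)

sublocale dual: bounded_form "H10 \<Omega>" "\<lambda>v w. a_form \<Omega> A b c w v" M by (rule dual_form)

definition nrm :: "(real ^ 'n \<Rightarrow> real) \<Rightarrow> real" where "nrm v = sqrt (a v v)"

lemma nrm_nonneg: "v \<in> H10 \<Omega> \<Longrightarrow> 0 \<le> nrm v"
  by (simp add: nrm_def prim.nonneg)

lemma nrm_power2: "v \<in> H10 \<Omega> \<Longrightarrow> (nrm v)\<^sup>2 = a v v"
  by (simp add: nrm_def prim.nonneg)

lemma a_le: "v \<in> H10 \<Omega> \<Longrightarrow> w \<in> H10 \<Omega> \<Longrightarrow> \<bar>a v w\<bar> \<le> M * nrm v * nrm w"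
  unfolding nrm_def by (intro abs_le_of_power2_le prim.bounded prim.nonneg M)

lemma K_le: "v \<in> H10 \<Omega> \<Longrightarrow> w \<in> H10 \<Omega> \<Longrightarrow> \<bar>K v w\<bar> \<le> \<kappa> * nrm v * nrm w"
  unfolding nrm_def by (intro abs_le_of_power2_le \<kappa> prim.nonneg)

lemma energy_le_nrm: "v \<in> H10 \<Omega> \<Longrightarrow> energy_norm \<Omega> A v \<le> sqrt c1 * nrm v"
  unfolding nrm_def using c1(2)[of v] by (simp add: real_le_rsqrt flip: real_sqrt_mult)

lemma energy_nonneg: assumes "v \<in> H10 \<Omega>" shows "0 \<le> energy_norm \<Omega> A v"
proof -
  have "(energy_norm \<Omega> A v)\<^sup>2 = E v" using energy_bounds H10_sub_H1[OF assms] by blast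
  then have "0 \<le> E v" by (metis zero_le_power2)
  then show ?thesis by (simp add: energy_norm_def)
qed

lemma nrm_le_energy: assumes "v \<in> H10 \<Omega>" shows "nrm v \<le> sqrt c2 * energy_norm \<Omega> A v"
proof -
  have "nrm v \<le> sqrt (c2 * (energy_norm \<Omega> A v)\<^sup>2)" unfolding nrm_def using c2(2)[OF assms] by simp
  then show ?thesis using energy_nonneg[OF assms] by (simp add: real_sqrt_mult)
qed

text \<open>With this weight, \<open>2 * a2 f f\<close> exceeds the sum of the squared norms of the
  components \<open>v\<close> and \<open>w\<close> by at least
  \<open>(2 * \<kappa> * nrm v - nrm w)\<^sup>2\<close>.\<close>

definition lam :: real where "lam = 2 * \<kappa>\<^sup>2 + 1/2"
definition M2 :: real where "M2 = lam * M + M + 2 * \<kappa>"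

text \<open>Pairs are encoded as functions on a disjoint sum, so that they are real functions with
  pointwise operations and \<open>bounded_form\<close> applies to them.\<close>

definition V2 :: "((real ^ 'n) + (real ^ 'n) \<Rightarrow> real) set" where
  "V2 = {f. (\<lambda>x. f (Inl x)) \<in> H10 \<Omega> \<and> (\<lambda>x. f (Inr x)) \<in> H10 \<Omega>}"

text \<open>The pair of primal and dual solution solves a variational problem for \<open>a2\<close>, and likewise the pair of
  discrete solutions; a large weight \<open>lam\<close> of the primal part makes \<open>a2\<close> elliptic.\<close>

definition a2 :: "((real ^ 'n) + (real ^ 'n) \<Rightarrow> real) \<Rightarrow> ((real ^ 'n) + (real ^ 'n) \<Rightarrow> real) \<Rightarrow> real" where
  "a2 f g = lam * a (\<lambda>x. f (Inl x)) (\<lambda>x. g (Inl x)) + a (\<lambda>x. g (Inr x)) (\<lambda>x. f (Inr x))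
     - K (\<lambda>x. g (Inr x)) (\<lambda>x. f (Inl x)) - K (\<lambda>x. f (Inl x)) (\<lambda>x. g (Inr x))"

lemma lam_pos: "0 < lam" unfolding lam_def by (simp add: add_nonneg_pos)

lemma M2_nonneg: "0 \<le> M2" unfolding M2_def using lam_pos M \<kappa> by simp

lemma a2_lower:
  assumes "f \<in> V2"
  shows "a (\<lambda>x. f (Inl x)) (\<lambda>x. f (Inl x)) + a (\<lambda>x. f (Inr x)) (\<lambda>x. f (Inr x)) \<le> 2 * a2 f f"
proof -
  define v where "v = (\<lambda>x. f (Inl x))"
  define w where "w = (\<lambda>x. f (Inr x))"
  have vw: "v \<in> H10 \<Omega>" "w \<in> H10 \<Omega>" using assms by (auto simp: V2_def v_def w_def)
  have "K w v + K v w \<le> 2 * \<kappa> * nrm v * nrm w" using K_le[OF vw] K_le[OF vw(2,1)] by (simp add: mult_ac)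
  moreover have "0 \<le> (2 * \<kappa> * nrm v - nrm w)\<^sup>2" by simp
  ultimately have "a v v + a w w \<le> 2 * (lam * a v v + a w w - K w v - K v w)"
    using nrm_power2 vw by (simp add: lam_def power2_diff power_mult_distrib algebra_simps)
  then show ?thesis unfolding a2_def v_def w_def .
qed

lemma a2_bound:
  assumes "f \<in> V2" "g \<in> V2"
  shows "(a2 f g)\<^sup>2 \<le> M2\<^sup>2 * (a (\<lambda>x. f (Inl x)) (\<lambda>x. f (Inl x)) + a (\<lambda>x. f (Inr x)) (\<lambda>x. f (Inr x)))
     * (a (\<lambda>x. g (Inl x)) (\<lambda>x. g (Inl x)) + a (\<lambda>x. g (Inr x)) (\<lambda>x. g (Inr x)))"
proof -
  define v where "v = (\<lambda>x. f (Inl x))"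
  define w where "w = (\<lambda>x. f (Inr x))"
  define v' where "v' = (\<lambda>x. g (Inl x))"
  define w' where "w' = (\<lambda>x. g (Inr x))"
  have vw: "v \<in> H10 \<Omega>" "w \<in> H10 \<Omega>" "v' \<in> H10 \<Omega>" "w' \<in> H10 \<Omega>"
    using assms by (auto simp: V2_def v_def w_def v'_def w'_def)
  have "lam * \<bar>a v v'\<bar> \<le> lam * (M * nrm v * nrm v')" using a_le[OF vw(1,3)] lam_pos by (intro mult_left_mono) auto
  moreover have "\<bar>lam * a v v'\<bar> = lam * \<bar>a v v'\<bar>" using lam_pos by (simp add: abs_mult)
  ultimately have "\<bar>lam * a v v' + a w' w - K w' v - K v w'\<bar>
      \<le> lam * M * nrm v * nrm v' + M * nrm w' * nrm w + 2 * \<kappa> * nrm v * nrm w'"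
    using a_le[OF vw(4,2)] K_le[OF vw(4,1)] K_le[OF vw(1,4)] by (simp add: mult_ac)
  then have "(lam * a v v' + a w' w - K w' v - K v w')\<^sup>2
      \<le> (lam * M + M + 2 * \<kappa>)\<^sup>2 * ((nrm v)\<^sup>2 + (nrm w)\<^sup>2) * ((nrm v')\<^sup>2 + (nrm w')\<^sup>2)"
    using vw nrm_nonneg lam_pos M \<kappa> by (intro power2_form_bound) auto
  then show ?thesis unfolding a2_def v_def w_def v'_def w'_def M2_def
    using vw by (simp add: nrm_power2 v_def w_def v'_def w'_def)
qed

lemma a2_nonneg: assumes "f \<in> V2" shows "0 \<le> a2 f f"
proof -
  have "0 \<le> a (\<lambda>x. f (Inl x)) (\<lambda>x. f (Inl x)) + a (\<lambda>x. f (Inr x)) (\<lambda>x. f (Inr x))"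
    using assms by (intro add_nonneg_nonneg prim.nonneg) (auto simp: V2_def)
  then show ?thesis using a2_lower[OF assms] by linarith
qed

text \<open>\<open>M2\<close> bounds \<open>a2\<close> by the norms of the components; each of them
  is at most twice \<open>a2\<close> on the diagonal, whence \<open>2 * M2\<close>.\<close>

lemma pair_form: "bounded_form V2 a2 (2 * M2)"
proof
  show "(a2 f g)\<^sup>2 \<le> (2 * M2)\<^sup>2 * a2 f f * a2 g g" if fg: "f \<in> V2" "g \<in> V2" for f g
  proof -
    have "(a2 f g)\<^sup>2 \<le> M2\<^sup>2 * (2 * a2 f f) * (2 * a2 g g)"
      using a2_bound[OF fg] a2_lower[OF fg(1)] a2_lower[OF fg(2)] fg
      by (elim order_trans) (intro mult_mono, auto simp: V2_def prim.nonneg a2_nonneg)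
    then show ?thesis by (simp add: power_mult_distrib)
  qed
  show "(\<lambda>x. 0) \<in> V2" by (simp add: V2_def prim.zero_mem)
  show "0 \<le> a2 f f" if "f \<in> V2" for f using that by (rule a2_nonneg)
qed (auto simp: V2_def a2_def prim.add_mem prim.scale_mem prim.add_left prim.add_right prim.scale_left
  prim.scale_right compact_operator_linear[OF K] algebra_simps M2_nonneg)

sublocale pair: bounded_form V2 a2 "2 * M2" by (rule pair_form)

text \<open>Translation between the quadratic form of \<open>a2\<close> and the component energy
  norms of the estimator axioms: this direction serves stability, the next one reliability.\<close>

lemma pair_energy_le:
  assumes "f \<in> V2"
  shows "energy_norm \<Omega> A (\<lambda>x. f (Inl x)) + energy_norm \<Omega> A (\<lambda>x. f (Inr x)) \<le> 2 * sqrt c1 * sqrt (a2 f f)"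
proof -
  let ?v = "\<lambda>x. f (Inl x)" and ?w = "\<lambda>x. f (Inr x)"
  have vw: "?v \<in> H10 \<Omega>" "?w \<in> H10 \<Omega>" using assms by (auto simp: V2_def)
  have "(nrm ?v + nrm ?w)\<^sup>2 \<le> 2 * ((nrm ?v)\<^sup>2 + (nrm ?w)\<^sup>2)"
    using zero_le_power2[of "nrm ?v - nrm ?w"] by (simp add: power2_sum power2_diff)
  also have "\<dots> \<le> 2\<^sup>2 * a2 f f" using a2_lower[OF assms] nrm_power2 vw by simp
  finally have "nrm ?v + nrm ?w \<le> sqrt (2\<^sup>2 * a2 f f)" by (rule real_le_rsqrt)
  then have "sqrt c1 * (nrm ?v + nrm ?w) \<le> sqrt c1 * (2 * sqrt (a2 f f))"
    using c1 by (intro mult_left_mono) (auto simp: real_sqrt_mult)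
  then show ?thesis using energy_le_nrm[OF vw(1)] energy_le_nrm[OF vw(2)] by (simp add: algebra_simps)
qed

lemma pair_le_energy:
  assumes "f \<in> V2"
  shows "sqrt (a2 f f) \<le> sqrt (M2 * c2) * (energy_norm \<Omega> A (\<lambda>x. f (Inl x)) + energy_norm \<Omega> A (\<lambda>x. f (Inr x)))"
proof -
  let ?v = "\<lambda>x. f (Inl x)" and ?w = "\<lambda>x. f (Inr x)"
  have vw: "?v \<in> H10 \<Omega>" "?w \<in> H10 \<Omega>" using assms by (auto simp: V2_def)
  define n where "n = a ?v ?v + a ?w ?w"
  have n0: "0 \<le> n" unfolding n_def by (intro add_nonneg_nonneg prim.nonneg vw)
  have "(a2 f f)\<^sup>2 \<le> M2\<^sup>2 * n * n" unfolding n_def by (rule a2_bound[OF assms assms])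
  also have "\<dots> = (M2 * n)\<^sup>2" by (simp add: power2_eq_square)
  finally have "a2 f f \<le> M2 * n" by (rule power2_le_imp_le) (intro mult_nonneg_nonneg M2_nonneg n0)
  also have "n \<le> (nrm ?v + nrm ?w)\<^sup>2"
    unfolding n_def power2_sum nrm_power2[OF vw(1)] nrm_power2[OF vw(2)] using nrm_nonneg vw by simp
  then have "M2 * n \<le> M2 * (nrm ?v + nrm ?w)\<^sup>2" using M2_nonneg by (rule mult_left_mono)
  finally have "sqrt (a2 f f) \<le> sqrt (M2 * (nrm ?v + nrm ?w)\<^sup>2)" by simp
  also have "\<dots> = sqrt M2 * (nrm ?v + nrm ?w)" using nrm_nonneg vw by (simp add: real_sqrt_mult)
  also have "\<dots> \<le> sqrt M2 * (sqrt c2 * energy_norm \<Omega> A ?v + sqrt c2 * energy_norm \<Omega> A ?w)"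
    using nrm_le_energy vw M2_nonneg by (intro mult_left_mono add_mono) auto
  finally show ?thesis by (simp add: real_sqrt_mult algebra_simps)
qed

end

section \<open>The three error estimators\<close>

lemma eta_power2: "(eta P H S v)\<^sup>2 = (\<Sum>T\<in>S. (ind_eta P H T v)\<^sup>2)"
  by (simp add: eta_def sum_nonneg)

lemma zeta_power2: "(zeta P H S v)\<^sup>2 = (\<Sum>T\<in>S. (ind_zeta P H T v)\<^sup>2)"
  by (simp add: zeta_def sum_nonneg)

lemma eta_nonneg: "0 \<le> eta P H S v"
  by (simp add: eta_def sum_nonneg)

lemma zeta_nonneg: "0 \<le> zeta P H S v"
  by (simp add: zeta_def sum_nonneg)

locale adaptive = goal_problem \<Omega> A b c K M \<kappa> c1 c2
  for \<Omega> :: "(real ^ 'n) set" and A b c K M \<kappa> c1 c2 +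
  fixes P :: "'n goafem" and Cmesh qred Cstab Crel Cdrel :: real
  assumes adm: "admissible \<Omega> A b c K Cmesh qred Cstab Crel Cdrel P"
begin

abbreviation "X \<equiv> fe_space \<Omega> (fe_deg P)"
abbreviation "R \<equiv> refinements (mesh_refine P)"
abbreviation "d \<equiv> \<lambda>v w. energy_norm \<Omega> A (\<lambda>x. v x - w x)"

lemma strat: "refinement_strategy \<Omega> (mesh0 P) (mesh_refine P)"
  using adm by (simp add: admissible_def)

lemma ref_assms: "refinement_assumptions (mesh0 P) (mesh_refine P) Cmesh"
  using adm by (simp add: admissible_def)

lemma sol: "solution_data \<Omega> A b c K P"
  using adm by (simp add: admissible_def)

lemma ax: "estimator_axioms \<Omega> A qred Cstab Crel Cdrel P"
  using adm by (simp add: admissible_def)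

lemma const_bounds: "0 < Cstab" "0 < Crel" "0 < Cdrel" "0 < qred" "qred < 1"
  using ax by (simp_all add: estimator_axioms_def)

lemma mesh_R: "H \<in> meshes P \<Longrightarrow> h \<in> R H \<Longrightarrow> h \<in> meshes P"
  unfolding meshes_def by (rule refinements_trans)

lemma mesh_self: "H \<in> R H"
  by (rule refinements.base)

lemma mesh_finite: "H \<in> meshes P \<Longrightarrow> finite H"
  unfolding meshes_def by (rule refinements_finite[OF strat])

lemma X_nested: "H \<in> meshes P \<Longrightarrow> h \<in> R H \<Longrightarrow> X H \<subseteq> X h"
  unfolding meshes_def by (intro fe_space_nested[OF strat] open_\<Omega>)

lemma X_H10: "X H \<subseteq> H10 \<Omega>"
  by (auto simp: fe_space_def)

lemma X_memD: "v \<in> X H \<Longrightarrow> v \<in> H10 \<Omega>"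
  using X_H10 by blast

lemma exact:
  "sol_u P \<in> H10 \<Omega>" "v \<in> H10 \<Omega> \<Longrightarrow> a (sol_u P) v = F_form \<Omega> (rhs_f P) (rhs_ff P) v"
  "w \<in> H10 \<Omega> \<Longrightarrow> sol_z P w \<in> H10 \<Omega>" "w \<in> H10 \<Omega> \<Longrightarrow> v \<in> H10 \<Omega> \<Longrightarrow> a v (sol_z P w) = K v w + K w v"
  using sol by (simp_all add: solution_data_def)

lemma discrete:
  assumes "H \<in> meshes P"
  shows "disc_u P H \<in> X H" "v \<in> X H \<Longrightarrow> a (disc_u P H) v = F_form \<Omega> (rhs_f P) (rhs_ff P) v"
    "w \<in> H10 \<Omega> \<Longrightarrow> disc_z P H w \<in> X H" "w \<in> H10 \<Omega> \<Longrightarrow> v \<in> X H \<Longrightarrow> a v (disc_z P H w) = K v w + K w v"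
  using sol assms by (simp_all add: solution_data_def Let_def)

lemma disc_u_H10: "H \<in> meshes P \<Longrightarrow> disc_u P H \<in> H10 \<Omega>"
  using discrete(1) X_H10 by blast

lemma disc_z_H10: "H \<in> meshes P \<Longrightarrow> w \<in> H10 \<Omega> \<Longrightarrow> disc_z P H w \<in> H10 \<Omega>"
  using discrete(3) X_H10 by blast

lemmas axH = bspec[OF bspec[OF ax[unfolded estimator_axioms_def Let_def, THEN conjunct2, THEN conjunct2,
  THEN conjunct2, THEN conjunct2, THEN conjunct2, THEN conjunct2]]]
lemmas ax0 = axH[THEN conjunct1] and ax0' = axH[THEN conjunct2]
lemmas ax1 = ax0'[THEN conjunct1] and ax1' = ax0'[THEN conjunct2]
lemmas ax2 = ax1'[THEN conjunct1] and ax2' = ax1'[THEN conjunct2]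
lemmas ax3 = ax2'[THEN conjunct1] and ax3' = ax2'[THEN conjunct2]
lemmas ax4 = ax3'[THEN conjunct1] and ax4' = ax3'[THEN conjunct2, THEN conjunct2]
lemmas ax6 = ax4'[THEN conjunct1] and ax6' = ax4'[THEN conjunct2]
lemmas ax7 = ax6'[THEN conjunct1] and ax8 = ax6'[THEN conjunct2]

lemma est_ax:
  assumes "H \<in> meshes P" "h \<in> R H"
  shows "\<forall>v\<in>X h. \<forall>w\<in>X H. \<forall>S. S \<subseteq> h \<inter> H \<longrightarrow>
             \<bar>eta P h S v - eta P H S w\<bar> + \<bar>zeta P h S v - zeta P H S w\<bar> \<le> Cstab * d v w"
    "\<forall>w\<in>X H. eta P h (h - H) w \<le> qred * eta P H (H - h) w \<and> zeta P h (h - H) w \<le> qred * zeta P H (H - h) w"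
    "d (sol_u P) (disc_u P H) \<le> Crel * eta P H H (disc_u P H)"
    "\<forall>w\<in>H10 \<Omega>. d (sol_z P w) (disc_z P H w) \<le> Crel * zeta P H H (disc_z P H w)"
    "d (disc_u P h) (disc_u P H) \<le> Cdrel * eta P H (H - h) (disc_u P H)"
    "\<forall>v\<in>X h. \<forall>w\<in>X h. \<forall>v'\<in>X H. \<forall>w'\<in>X H. \<forall>S. S \<subseteq> h \<inter> H \<longrightarrow>
             \<bar>eta_zeta P h S v w - eta_zeta P H S v' w'\<bar> \<le> Cstab * (d v v' + d w w')"
    "d (sol_u P) (disc_u P H) + d (sol_z P (sol_u P)) (disc_z P H (disc_u P H)) +
       d (sol_z P (disc_u P H)) (disc_z P H (disc_u P H))
       \<le> Crel * eta_zeta P H H (disc_u P H) (disc_z P H (disc_u P H))"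
    "d (disc_u P h) (disc_u P H) + d (disc_z P h (disc_u P h)) (disc_z P H (disc_u P H))
       \<le> Cdrel * eta_zeta P H (H - h) (disc_u P H) (disc_z P H (disc_u P H))"
  by (rule ax0 ax1 ax2 ax3 ax4 ax6 ax7 ax8, rule assms, rule assms)+

lemma reduction_power2:
  fixes x y :: real
  assumes "x \<le> qred * y" "0 \<le> x" shows "x\<^sup>2 \<le> qred\<^sup>2 * y\<^sup>2"
  using power_mono[OF assms, of 2] by (simp add: power_mult_distrib)

sublocale fam: mesh_family "meshes P" R
  by unfold_locales (auto intro: mesh_self mesh_R mesh_finite refinements_trans)

sublocale est_u: galerkin_estimator "H10 \<Omega>" "a_form \<Omega> A b c" M "meshes P" "refinements (mesh_refine P)"
  "fe_space \<Omega> (fe_deg P)" "sol_u P" "disc_u P" "\<lambda>H T v. (ind_eta P H T v)\<^sup>2" "Cstab * sqrt c1" "sqrt c2 * Crel" qred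
proof
  fix H h :: "'n mesh" and v w S
  assume H: "H \<in> meshes P"
  show "X H \<subseteq> H10 \<Omega>" by (rule X_H10)
  show "disc_u P H \<in> X H" using discrete(1)[OF H] .
  show "a (disc_u P H) v = a (sol_u P) v" if "v \<in> X H"
    using discrete(2)[OF H that] exact(2)[OF X_memD[OF that]] by simp
  have "disc_u P H \<in> H10 \<Omega>" by (rule disc_u_H10[OF H])
  then have D: "(\<lambda>x. sol_u P x - disc_u P H x) \<in> H10 \<Omega>" by (intro prim.diff_mem exact)
  have "sqrt (a (\<lambda>x. sol_u P x - disc_u P H x) (\<lambda>x. sol_u P x - disc_u P H x)) \<le> sqrt c2 * d (sol_u P) (disc_u P H)"
    using nrm_le_energy[OF D] by (simp add: nrm_def)
  also have "\<dots> \<le> sqrt c2 * (Crel * eta P H H (disc_u P H))"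
    using est_ax(3)[OF H mesh_self] c2 by (intro mult_left_mono) auto
  finally show "sqrt (a (\<lambda>x. sol_u P x - disc_u P H x) (\<lambda>x. sol_u P x - disc_u P H x))
      \<le> sqrt c2 * Crel * sqrt (\<Sum>T\<in>H. (ind_eta P H T (disc_u P H))\<^sup>2)" by (simp add: eta_def mult.assoc)
  assume h: "h \<in> R H"
  show "X H \<subseteq> X h" by (rule X_nested[OF H h])
  show "(\<Sum>T\<in>h - H. (ind_eta P h T w)\<^sup>2) \<le> qred\<^sup>2 * (\<Sum>T\<in>H - h. (ind_eta P H T w)\<^sup>2)" if "w \<in> X H"
    by (rule reduction_power2[OF est_ax(2)[OF H h, rule_format, OF that, THEN conjunct1] eta_nonneg, unfolded eta_power2])
  assume vw: "v \<in> X h" "w \<in> X H" and S: "S \<subseteq> h \<inter> H"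
  have "\<bar>eta P h S v - eta P H S w\<bar> \<le> Cstab * d v w" using est_ax(1)[OF H h, rule_format, OF vw S] by linarith
  also have "\<dots> \<le> Cstab * (sqrt c1 * nrm (\<lambda>x. v x - w x))"
    using const_bounds by (intro mult_left_mono energy_le_nrm prim.diff_mem X_memD[OF vw(1)] X_memD[OF vw(2)]) auto
  finally show "\<bar>sqrt (\<Sum>T\<in>S. (ind_eta P h T v)\<^sup>2) - sqrt (\<Sum>T\<in>S. (ind_eta P H T w)\<^sup>2)\<bar>
      \<le> Cstab * sqrt c1 * sqrt (a (\<lambda>x. v x - w x) (\<lambda>x. v x - w x))" by (simp add: eta_def nrm_def mult.assoc)
qed (use const_bounds c1 c2 exact in auto)

text \<open>Here the functional is frozen at the exact primal solution, as in the approximation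
  class of the dual solution. The instance supplies quasi-monotonicity for that class; the link to
  the computed dual solution is \<open>dual_perturbation\<close>.\<close>

sublocale est_z: galerkin_estimator "H10 \<Omega>" "\<lambda>v w. a_form \<Omega> A b c w v" M "meshes P" "refinements (mesh_refine P)"
  "fe_space \<Omega> (fe_deg P)" "sol_z P (sol_u P)" "\<lambda>H. disc_z P H (sol_u P)" "\<lambda>H T v. (ind_zeta P H T v)\<^sup>2"
  "Cstab * sqrt c1" "sqrt c2 * Crel" qred
proof
  fix H h :: "'n mesh" and v w S
  assume H: "H \<in> meshes P"
  let ?z = "sol_z P (sol_u P)" and ?zH = "disc_z P H (sol_u P)"
  show "X H \<subseteq> H10 \<Omega>" by (rule X_H10)
  show "?zH \<in> X H" using discrete(3)[OF H exact(1)] .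
  show "a v ?zH = a v ?z" if "v \<in> X H"
    using discrete(4)[OF H exact(1) that] exact(4)[OF exact(1) X_memD[OF that]] by simp
  have "?zH \<in> H10 \<Omega>" by (rule disc_z_H10[OF H exact(1)])
  then have D: "(\<lambda>x. ?z x - ?zH x) \<in> H10 \<Omega>" by (intro prim.diff_mem exact)
  have "sqrt (a (\<lambda>x. ?z x - ?zH x) (\<lambda>x. ?z x - ?zH x)) \<le> sqrt c2 * d ?z ?zH"
    using nrm_le_energy[OF D] by (simp add: nrm_def)
  also have "\<dots> \<le> sqrt c2 * (Crel * zeta P H H ?zH)"
    using est_ax(4)[OF H mesh_self] exact(1) c2 by (intro mult_left_mono) auto
  finally show "sqrt (a (\<lambda>x. ?z x - ?zH x) (\<lambda>x. ?z x - ?zH x))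
      \<le> sqrt c2 * Crel * sqrt (\<Sum>T\<in>H. (ind_zeta P H T ?zH)\<^sup>2)" by (simp add: zeta_def mult.assoc)
  assume h: "h \<in> R H"
  show "X H \<subseteq> X h" by (rule X_nested[OF H h])
  show "(\<Sum>T\<in>h - H. (ind_zeta P h T w)\<^sup>2) \<le> qred\<^sup>2 * (\<Sum>T\<in>H - h. (ind_zeta P H T w)\<^sup>2)" if "w \<in> X H"
    by (rule reduction_power2[OF est_ax(2)[OF H h, rule_format, OF that, THEN conjunct2] zeta_nonneg, unfolded zeta_power2])
  assume vw: "v \<in> X h" "w \<in> X H" and S: "S \<subseteq> h \<inter> H"
  have "\<bar>zeta P h S v - zeta P H S w\<bar> \<le> Cstab * d v w" using est_ax(1)[OF H h, rule_format, OF vw S] by linarith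
  also have "\<dots> \<le> Cstab * (sqrt c1 * nrm (\<lambda>x. v x - w x))"
    using const_bounds by (intro mult_left_mono energy_le_nrm prim.diff_mem X_memD[OF vw(1)] X_memD[OF vw(2)]) auto
  finally show "\<bar>sqrt (\<Sum>T\<in>S. (ind_zeta P h T v)\<^sup>2) - sqrt (\<Sum>T\<in>S. (ind_zeta P H T w)\<^sup>2)\<bar>
      \<le> Cstab * sqrt c1 * sqrt (a (\<lambda>x. v x - w x) (\<lambda>x. v x - w x))" by (simp add: zeta_def nrm_def mult.assoc)
qed (use const_bounds c1 c2 exact in auto)

definition X2 :: "'n mesh \<Rightarrow> ((real ^ 'n) + (real ^ 'n) \<Rightarrow> real) set" where
  "X2 H = {f. (\<lambda>x. f (Inl x)) \<in> X H \<and> (\<lambda>x. f (Inr x)) \<in> X H}"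

definition U2 :: "(real ^ 'n) + (real ^ 'n) \<Rightarrow> real" where "U2 = case_sum (sol_u P) (sol_z P (sol_u P))"

definition UH2 :: "'n mesh \<Rightarrow> (real ^ 'n) + (real ^ 'n) \<Rightarrow> real" where
  "UH2 H = case_sum (disc_u P H) (disc_z P H (disc_u P H))"

definition ind2 :: "'n mesh \<Rightarrow> (real ^ 'n) set \<Rightarrow> ((real ^ 'n) + (real ^ 'n) \<Rightarrow> real) \<Rightarrow> real" where
  "ind2 H T f = (ind_eta P H T (\<lambda>x. f (Inl x)))\<^sup>2 + (ind_zeta P H T (\<lambda>x. f (Inr x)))\<^sup>2"

lemma sum_ind2: "(\<Sum>T\<in>S. ind2 H T f) = (eta P H S (\<lambda>x. f (Inl x)))\<^sup>2 + (zeta P H S (\<lambda>x. f (Inr x)))\<^sup>2"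
  by (simp add: ind2_def sum.distrib eta_power2 zeta_power2)

lemma sqrt_sum_ind2: "sqrt (\<Sum>T\<in>S. ind2 H T f) = eta_zeta P H S (\<lambda>x. f (Inl x)) (\<lambda>x. f (Inr x))"
  by (simp add: sum_ind2 eta_zeta_def)

text \<open>The combined estimator belongs to the pair of computed solutions. Its stability and
  reliability are those of the combined convention, with the norm changes of
  \<open>pair_energy_le\<close> and \<open>pair_le_energy\<close>.\<close>

sublocale est_uz: galerkin_estimator V2 a2 "2 * M2" "meshes P" "refinements (mesh_refine P)"
  X2 U2 UH2 ind2 "2 * sqrt c1 * Cstab" "sqrt (M2 * c2) * Crel" qred
proof
  fix H h :: "'n mesh" and f g S
  show "U2 \<in> V2" using exact by (simp add: U2_def V2_def)
  show "0 \<le> ind2 H T f" for H T and f by (simp add: ind2_def)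
  assume H: "H \<in> meshes P"
  show sub: "X2 H \<subseteq> V2" by (auto simp: X2_def V2_def intro: X_memD)
  show mem: "UH2 H \<in> X2 H" using discrete[OF H] disc_u_H10[OF H] by (simp add: UH2_def X2_def)
  show "a2 (UH2 H) f = a2 U2 f" if "f \<in> X2 H"
  proof -
    have f: "(\<lambda>x. f (Inl x)) \<in> X H" "(\<lambda>x. f (Inr x)) \<in> X H" using that by (auto simp: X2_def)
    then have f': "(\<lambda>x. f (Inl x)) \<in> H10 \<Omega>" "(\<lambda>x. f (Inr x)) \<in> H10 \<Omega>" by (auto intro: X_memD)
    show ?thesis
      \<comment> \<open>The dual term cancels against the two terms with \<open>K\<close>, for exact
        and for discrete solutions, and both sides reduce to \<open>lam\<close> times the primal
        right-hand side.\<close>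
      using discrete(2)[OF H f(1)] discrete(4)[OF H disc_u_H10[OF H] f(2)] exact(2)[OF f'(1)] exact(4)[OF exact(1) f'(2)]
      by (simp add: a2_def UH2_def U2_def)
  qed
  have "U2 \<in> V2" using exact by (simp add: U2_def V2_def)
  then have D: "(\<lambda>x. U2 x - UH2 H x) \<in> V2" using mem sub by (intro pair.diff_mem) auto
  have nn: "0 \<le> d (sol_z P (disc_u P H)) (disc_z P H (disc_u P H))"
    using exact disc_u_H10[OF H] disc_z_H10[OF H] by (intro energy_nonneg prim.diff_mem) auto
  have "sqrt (a2 (\<lambda>x. U2 x - UH2 H x) (\<lambda>x. U2 x - UH2 H x))
      \<le> sqrt (M2 * c2) * (d (sol_u P) (disc_u P H) + d (sol_z P (sol_u P)) (disc_z P H (disc_u P H)))"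
    using pair_le_energy[OF D] by (simp add: U2_def UH2_def)
  also have "\<dots> \<le> sqrt (M2 * c2) * (Crel * eta_zeta P H H (disc_u P H) (disc_z P H (disc_u P H)))"
    using est_ax(7)[OF H mesh_self] nn M2_nonneg c2 by (intro mult_left_mono) auto
  finally show "sqrt (a2 (\<lambda>x. U2 x - UH2 H x) (\<lambda>x. U2 x - UH2 H x))
      \<le> sqrt (M2 * c2) * Crel * sqrt (\<Sum>T\<in>H. ind2 H T (UH2 H))" by (simp add: sqrt_sum_ind2 UH2_def mult.assoc)
  assume h: "h \<in> R H"
  show "X2 H \<subseteq> X2 h" using X_nested[OF H h] by (auto simp: X2_def)
  show "(\<Sum>T\<in>h - H. ind2 h T g) \<le> qred\<^sup>2 * (\<Sum>T\<in>H - h. ind2 H T g)" if "g \<in> X2 H"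
  proof -
    have g: "(\<lambda>x. g (Inl x)) \<in> X H" "(\<lambda>x. g (Inr x)) \<in> X H" using that by (auto simp: X2_def)
    have "(eta P h (h - H) (\<lambda>x. g (Inl x)))\<^sup>2 \<le> qred\<^sup>2 * (eta P H (H - h) (\<lambda>x. g (Inl x)))\<^sup>2"
      "(zeta P h (h - H) (\<lambda>x. g (Inr x)))\<^sup>2 \<le> qred\<^sup>2 * (zeta P H (H - h) (\<lambda>x. g (Inr x)))\<^sup>2"
      using reduction_power2[OF est_ax(2)[OF H h, rule_format, OF g(1), THEN conjunct1] eta_nonneg]
        reduction_power2[OF est_ax(2)[OF H h, rule_format, OF g(2), THEN conjunct2] zeta_nonneg] by blast+
    then show ?thesis by (simp add: sum_ind2 distrib_left)
  qed
  assume fg: "f \<in> X2 h" "g \<in> X2 H" and S: "S \<subseteq> h \<inter> H"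
  have D: "(\<lambda>x. f x - g x) \<in> V2" using fg by (intro pair.diff_mem) (auto simp: X2_def V2_def intro: X_memD)
  have "\<bar>sqrt (\<Sum>T\<in>S. ind2 h T f) - sqrt (\<Sum>T\<in>S. ind2 H T g)\<bar>
      \<le> Cstab * (d (\<lambda>x. f (Inl x)) (\<lambda>x. g (Inl x)) + d (\<lambda>x. f (Inr x)) (\<lambda>x. g (Inr x)))"
    using est_ax(6)[OF H h] fg S by (simp add: sqrt_sum_ind2 X2_def)
  also have "\<dots> \<le> Cstab * (2 * sqrt c1 * sqrt (a2 (\<lambda>x. f x - g x) (\<lambda>x. f x - g x)))"
    using pair_energy_le[OF D] const_bounds by (intro mult_left_mono) auto
  finally show "\<bar>sqrt (\<Sum>T\<in>S. ind2 h T f) - sqrt (\<Sum>T\<in>S. ind2 H T g)\<bar>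
      \<le> 2 * sqrt c1 * Cstab * sqrt (a2 (\<lambda>x. f x - g x) (\<lambda>x. f x - g x))" by (simp add: mult_ac)
qed (use const_bounds c1 c2 M2_nonneg in auto)

lemma est_u_eq: "sqrt (est_u.est2 H) = eta P H H (disc_u P H)"
  by (simp add: est_u.est2_def eta_def)

lemma est_uz_eq: "sqrt (est_uz.est2 H) = eta_zeta P H H (disc_u P H) (disc_z P H (disc_u P H))"
  by (simp add: est_uz.est2_def sqrt_sum_ind2 UH2_def)

lemma product_eq: "estimator_product P H = sqrt (est_u.est2 H) * sqrt (est_uz.est2 H)"
  by (simp add: estimator_product_def Let_def est_u_eq est_uz_eq eta_zeta_def)

lemma product_nonneg: "0 \<le> estimator_product P H"
  by (simp add: product_eq est_u.est2_nonneg est_uz.est2_nonneg)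

end

section \<open>Linear convergence of the estimator product\<close>

context adaptive
begin

definition doerfler_u :: "real \<Rightarrow> 'n mesh \<Rightarrow> 'n mesh \<Rightarrow> bool" where
  "doerfler_u \<theta> H S \<longleftrightarrow> \<theta> * est_u.est2 H \<le> (\<Sum>T\<in>S. (ind_eta P H T (disc_u P H))\<^sup>2)"

definition doerfler_uz :: "real \<Rightarrow> 'n mesh \<Rightarrow> 'n mesh \<Rightarrow> bool" where
  "doerfler_uz \<theta> H S \<longleftrightarrow> \<theta> * est_uz.est2 H \<le> (\<Sum>T\<in>S. ind2 H T (UH2 H))"

lemma doerfler_mono:
  assumes "S \<subseteq> S'" "finite S'"
  shows "doerfler_u \<theta> H S \<Longrightarrow> doerfler_u \<theta> H S'" "doerfler_uz \<theta> H S \<Longrightarrow> doerfler_uz \<theta> H S'"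
proof -
  have "(\<Sum>T\<in>S. (ind_eta P H T (disc_u P H))\<^sup>2) \<le> (\<Sum>T\<in>S'. (ind_eta P H T (disc_u P H))\<^sup>2)"
    "(\<Sum>T\<in>S. ind2 H T (UH2 H)) \<le> (\<Sum>T\<in>S'. ind2 H T (UH2 H))"
    using assms by (auto intro!: sum_mono2 simp: ind2_def)
  then show "doerfler_u \<theta> H S \<Longrightarrow> doerfler_u \<theta> H S'" "doerfler_uz \<theta> H S \<Longrightarrow> doerfler_uz \<theta> H S'"
    by (auto simp: doerfler_u_def doerfler_uz_def)
qed

lemma doerfler_u_eq:
  "doerfler_u \<theta> H S \<longleftrightarrow> \<theta> * (eta P H H (disc_u P H))\<^sup>2 \<le> (eta P H S (disc_u P H))\<^sup>2"
  by (simp add: doerfler_u_def est_u.est2_def eta_power2)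

lemma doerfler_uz_eq:
  "doerfler_uz \<theta> H S \<longleftrightarrow>
    \<theta> * ((eta P H H (disc_u P H))\<^sup>2 + (zeta P H H (disc_z P H (disc_u P H)))\<^sup>2)
      \<le> (eta P H S (disc_u P H))\<^sup>2 + (zeta P H S (disc_z P H (disc_u P H)))\<^sup>2"
  by (simp add: doerfler_uz_def est_uz.est2_def sum_ind2 UH2_def)

context
  fixes \<theta> Cmark :: real and \<T> :: "nat \<Rightarrow> 'n mesh"
  assumes \<theta>: "0 < \<theta>" "\<theta> \<le> 1" and Cmark: "1 \<le> Cmark" and alg: "algorithm_A P \<theta> Cmark \<T>"
begin

lemma algorithm_start: "\<T> 0 = mesh0 P"
  using alg by (simp add: algorithm_A_def)

text \<open>The smaller of the two Doerfler sets is marked completely, so one criterion holds. At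
  most twice its cardinality is marked in total, and either set is minimal up to
  \<open>Cmark\<close> for its own criterion, so any competitor for either criterion may be
  used.\<close>

lemma algorithm_step:
  assumes fin: "finite (\<T> l)"
  shows "\<exists>\<M>. \<M> \<subseteq> \<T> l \<and> \<T> (Suc l) = mesh_refine P (\<T> l) \<M> \<and>
    (doerfler_u \<theta> (\<T> l) \<M> \<or> doerfler_uz \<theta> (\<T> l) \<M>) \<and>
    (\<forall>S. S \<subseteq> \<T> l \<longrightarrow> doerfler_u \<theta> (\<T> l) S \<or> doerfler_uz \<theta> (\<T> l) S \<longrightarrow> real (card \<M>) \<le> 2 * Cmark * real (card S))"
proof -
  let ?H = "\<T> l"
  obtain Bu Buz Mu Muz where
    Bu: "quasi_minimal Cmark {M. M \<subseteq> ?H \<and> doerfler_u \<theta> ?H M} Bu" and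
    Buz: "quasi_minimal Cmark {M. M \<subseteq> ?H \<and> doerfler_uz \<theta> ?H M} Buz" and
    sub: "Mu \<subseteq> Bu" "Muz \<subseteq> Buz" and
    card: "card Mu = min (card Bu) (card Buz)" "card Muz = min (card Bu) (card Buz)" and
    next_mesh: "\<T> (Suc l) = mesh_refine P ?H (Mu \<union> Muz)"
    using alg[unfolded algorithm_A_def Let_def, THEN conjunct2, THEN spec[of _ l]]
    unfolding doerfler_u_eq[symmetric] doerfler_uz_eq[symmetric] by blast
  have B: "Bu \<subseteq> ?H" "doerfler_u \<theta> ?H Bu" "Buz \<subseteq> ?H" "doerfler_uz \<theta> ?H Buz"
    using Bu Buz by (auto simp: quasi_minimal_def)
  have finB: "finite Bu" "finite Buz" using B fin finite_subset by blast+
  have M_sub: "Mu \<union> Muz \<subseteq> ?H" using sub B by blast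
  have finM: "finite (Mu \<union> Muz)" using M_sub fin finite_subset by blast
  have "doerfler_u \<theta> ?H (Mu \<union> Muz) \<or> doerfler_uz \<theta> ?H (Mu \<union> Muz)"
  proof (cases "card Bu \<le> card Buz")
    case True
    then have "Mu = Bu" using card sub finB by (intro card_subset_eq) auto
    then show ?thesis using doerfler_mono(1)[OF _ finM, of Bu \<theta> ?H] B(2) by auto
  next
    case False
    then have "Muz = Buz" using card sub finB by (intro card_subset_eq) auto
    then show ?thesis using doerfler_mono(2)[OF _ finM, of Buz \<theta> ?H] B(4) by auto
  qed
  moreover have "real (card (Mu \<union> Muz)) \<le> 2 * Cmark * real (card S)"
    if S: "S \<subseteq> ?H" "doerfler_u \<theta> ?H S \<or> doerfler_uz \<theta> ?H S" for S
  proof -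
    have "card (Mu \<union> Muz) \<le> 2 * min (card Bu) (card Buz)" using card_Un_le[of Mu Muz] card by simp
    then have "real (card (Mu \<union> Muz)) \<le> 2 * min (real (card Bu)) (real (card Buz))" by linarith
    moreover have "real (card Bu) \<le> Cmark * real (card S) \<or> real (card Buz) \<le> Cmark * real (card S)"
      using S Bu Buz by (auto simp: quasi_minimal_def)
    ultimately show ?thesis by linarith
  qed
  ultimately show ?thesis using M_sub next_mesh by blast
qed

lemma algorithm_mesh: "\<T> l \<in> meshes P"
proof (induction l)
  case 0
  then show ?case unfolding algorithm_start meshes_def by (rule refinements.base)
next
  case (Suc l)
  then show ?case using algorithm_step[OF mesh_finite[OF Suc]] unfolding meshes_def by (metis refinements.step)
qed

lemma algorithm_next: "\<T> (Suc l) \<in> R (\<T> l)"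
  using algorithm_step[OF mesh_finite[OF algorithm_mesh[of l]]] refinements.step[OF mesh_self] by metis

lemma algorithm_R: "i \<le> j \<Longrightarrow> \<T> j \<in> R (\<T> i)"
  by (induction rule: dec_induct) (auto intro: mesh_self refinements_trans algorithm_next)

lemma algorithm_gone: assumes "i < j" shows "\<T> i - \<T> (Suc i) \<subseteq> \<T> i - \<T> j"
  using assms algorithm_mesh[of i] algorithm_next[of i] algorithm_R[of "Suc i" j] unfolding meshes_def
  by (intro refined_elements_gone[OF strat]) auto

lemma algorithm_doerfler:
  "doerfler_u \<theta> (\<T> l) (\<T> l - \<T> (Suc l)) \<or> doerfler_uz \<theta> (\<T> l) (\<T> l - \<T> (Suc l))"
proof -
  obtain \<M> where \<M>: "\<M> \<subseteq> \<T> l" "\<T> (Suc l) = mesh_refine P (\<T> l) \<M>"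
    "doerfler_u \<theta> (\<T> l) \<M> \<or> doerfler_uz \<theta> (\<T> l) \<M>"
    using algorithm_step[OF mesh_finite[OF algorithm_mesh]] by blast
  have "\<M> \<subseteq> \<T> l - \<T> (Suc l)"
    using refinement_strategy_step(3)[OF strat algorithm_mesh[unfolded meshes_def] \<M>(1)] \<M>(2) by simp
  then show ?thesis using \<M>(3) doerfler_mono mesh_finite[OF algorithm_mesh[of l]] finite_Diff by metis
qed

text \<open>Every step lies in \<open>S\<close> or in \<open>S'\<close>, so the two squared
  estimators together collect at least \<open>n - l\<close> contraction factors; in the remaining
  steps each grows by a fixed factor at most. Taking roots at the end explains the square roots in
  both constants.\<close>

lemma product_linear_convergence:
  assumes rate: "linear_rate M (Cstab * sqrt c1) (sqrt c2 * Crel) qred \<theta> C r"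
    and rate2: "linear_rate (2 * M2) (2 * sqrt c1 * Cstab) (sqrt (M2 * c2) * Crel) qred \<theta> C' r'"
    and D: "D = C * (1 + (Cstab * sqrt c1) * M * (sqrt c2 * Crel))\<^sup>2"
    and D': "D' = C' * (1 + (2 * sqrt c1 * Cstab) * (2 * M2) * (sqrt (M2 * c2) * Crel))\<^sup>2"
    and ln: "l \<le> n"
  shows "estimator_product P (\<T> n) \<le> sqrt (D * D') * sqrt (max r r') ^ (n - l) * estimator_product P (\<T> l)"
proof -
  define S where "S = {k\<in>{l..<n}. doerfler_u \<theta> (\<T> k) (\<T> k - \<T> (Suc k))}"
  define S' where "S' = {k\<in>{l..<n}. doerfler_uz \<theta> (\<T> k) (\<T> k - \<T> (Suc k))}"
  have u: "est_u.est2 (\<T> n) \<le> D * r ^ card S * est_u.est2 (\<T> l)"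
    unfolding D using rate \<theta> algorithm_mesh algorithm_R algorithm_gone ln
    by (intro est_u.linear_convergence_on_subset) (auto simp: S_def doerfler_u_def)
  have uz: "est_uz.est2 (\<T> n) \<le> D' * r' ^ card S' * est_uz.est2 (\<T> l)"
    unfolding D' using rate2 \<theta> algorithm_mesh algorithm_R algorithm_gone ln
    by (intro est_uz.linear_convergence_on_subset) (auto simp: S'_def doerfler_uz_def)
  have r: "0 < r" "r < 1" "0 < r'" "r' < 1" "1 \<le> C" "1 \<le> C'" using rate rate2 by (auto simp: linear_rate_def)
  have D0: "0 \<le> D" "0 \<le> D'" unfolding D D' using r by auto
  let ?r = "max r r'"
  have "{l..<n} \<subseteq> S \<union> S'" using algorithm_doerfler by (auto simp: S_def S'_def)
  then have "card {l..<n} \<le> card (S \<union> S')" by (intro card_mono) (auto simp: S_def S'_def)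
  also have "\<dots> \<le> card S + card S'" by (rule card_Un_le)
  finally have cards: "n - l \<le> card S + card S'" by simp
  have "r ^ card S * r' ^ card S' \<le> ?r ^ card S * ?r ^ card S'"
    using r by (intro mult_mono power_mono) auto
  also have "\<dots> = ?r ^ (card S + card S')" by (simp add: power_add)
  also have "\<dots> \<le> ?r ^ (n - l)" using r cards by (intro power_decreasing) auto
  finally have rr: "r ^ card S * r' ^ card S' \<le> ?r ^ (n - l)" .
  have "est_u.est2 (\<T> n) * est_uz.est2 (\<T> n)
      \<le> (D * r ^ card S * est_u.est2 (\<T> l)) * (D' * r' ^ card S' * est_uz.est2 (\<T> l))"
    using u uz by (intro mult_mono) (auto intro: order_trans[OF est_u.est2_nonneg u] est_uz.est2_nonneg)
  also have "\<dots> = (D * D') * (est_u.est2 (\<T> l) * est_uz.est2 (\<T> l)) * (r ^ card S * r' ^ card S')" by (simp add: mult_ac)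
  also have "\<dots> \<le> (D * D') * (est_u.est2 (\<T> l) * est_uz.est2 (\<T> l)) * ?r ^ (n - l)"
    using rr D0 by (intro mult_left_mono) (auto simp: est_u.est2_nonneg est_uz.est2_nonneg)
  finally have "sqrt (est_u.est2 (\<T> n) * est_uz.est2 (\<T> n))
      \<le> sqrt ((D * D') * (est_u.est2 (\<T> l) * est_uz.est2 (\<T> l)) * ?r ^ (n - l))" by (rule real_sqrt_le_mono)
  then show ?thesis by (simp add: product_eq real_sqrt_mult real_sqrt_power mult_ac)
qed

end

section \<open>Optimal rates\<close>

lemma mesh_card:
  assumes "H \<in> meshes P" "h \<in> R H" shows "card (H - h) + card H \<le> card h"
  using ref_assms assms unfolding refinement_assumptions_def meshes_def by blast

lemma mesh_overlay:
  assumes "H \<in> meshes P" "h \<in> meshes P"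
  shows "\<exists>k\<in>R H \<inter> R h. card k + card (mesh0 P) \<le> card H + card h"
  using ref_assms assms unfolding refinement_assumptions_def meshes_def by blast

lemma mesh0_mesh: "mesh0 P \<in> meshes P"
  unfolding meshes_def by (rule refinements.base)

lemma mesh0_card: "H \<in> meshes P \<Longrightarrow> card (mesh0 P) \<le> card H"
  using mesh_card[OF mesh0_mesh, of H] unfolding meshes_def by simp

text \<open>For \<open>N = 0\<close> the infimum in an approximation norm thus ranges over the
  initial mesh alone.\<close>

lemma mesh0_minimal:
  assumes "H \<in> meshes P" "card H - card (mesh0 P) \<le> 0" shows "H = mesh0 P"
proof -
  have "card (mesh0 P - H) + card (mesh0 P) \<le> card H"
    using mesh_card[OF mesh0_mesh, of H] assms(1) unfolding meshes_def by simp
  then have "card (mesh0 P - H) = 0" "card (mesh0 P) = card H" using assms(2) by linarith+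
  then have "mesh0 P \<subseteq> H" using mesh_finite[OF mesh0_mesh] by auto
  then show ?thesis using \<open>card (mesh0 P) = card H\<close> card_subset_eq[OF mesh_finite[OF assms(1)]] by auto
qed

text \<open>The slack \<open>C < C'\<close> yields a mesh from the infimum without attaining it. For
  \<open>C = 0\<close> such a slack is not a bound by zero, so the case \<open>N = 0\<close> is read
  off directly. The generic \<open>e\<close> covers both approximation norms.\<close>

lemma approx_le:
  assumes f: "F = (SUP N::nat. ennreal ((real N + 1) powr s) * (INF H\<in>{H \<in> meshes P. card H - card (mesh0 P) \<le> N}. ennreal (e H)))"
    and F: "F = ennreal C" "0 \<le> C"
  shows "C < C' \<Longrightarrow> \<exists>H\<in>meshes P. card H - card (mesh0 P) \<le> N \<and> e H \<le> C' * (real N + 1) powr (- s)"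
    "C = 0 \<Longrightarrow> e (mesh0 P) \<le> 0"
proof -
  let ?I = "\<lambda>N. INF H\<in>{H \<in> meshes P. card H - card (mesh0 P) \<le> N}. ennreal (e H)"
  have le: "ennreal ((real N + 1) powr s) * ?I N \<le> ennreal C" for N
    unfolding F(1)[symmetric] f by (rule SUP_upper) simp
  show "\<exists>H\<in>meshes P. card H - card (mesh0 P) \<le> N \<and> e H \<le> C' * (real N + 1) powr (- s)" if C: "C < C'"
  proof (rule ccontr)
    let ?b = "C' * (real N + 1) powr (- s)"
    assume "\<not> ?thesis"
    then have "ennreal ?b \<le> ?I N" by (intro INF_greatest ennreal_leI) (auto simp: not_le)
    then have "ennreal ((real N + 1) powr s) * ennreal ?b \<le> ennreal ((real N + 1) powr s) * ?I N"
      by (rule mult_left_mono) simp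
    also have "\<dots> \<le> ennreal C" by (rule le)
    finally have "ennreal ((real N + 1) powr s * ?b) \<le> ennreal C" using F C by (simp add: ennreal_mult'')
    moreover have "(real N + 1) powr s * ?b = C'" by (simp add: powr_minus field_simps)
    ultimately show False using C F by (simp add: ennreal_le_iff)
  qed
  show "e (mesh0 P) \<le> 0" if "C = 0"
  proof -
    have "{H \<in> meshes P. card H - card (mesh0 P) \<le> 0} = {mesh0 P}" using mesh0_minimal mesh0_mesh by auto
    then have "ennreal (e (mesh0 P)) \<le> 0" using le[of 0] that by simp
    then show ?thesis by (simp add: ennreal_eq_0_iff)
  qed
qed

text \<open>The two discrete dual solutions live on the same mesh and differ by the response to
  \<open>u - u_H\<close> in the functional. Testing with this difference \<open>y\<close> bounds it
  by \<open>2 * \<kappa>\<close> times the primal error, which reliability bounds by the primal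
  estimator.\<close>

lemma dual_perturbation:
  assumes H: "H \<in> meshes P"
  shows "zeta P H H (disc_z P H (disc_u P H)) \<le> zeta P H H (disc_z P H (sol_u P))
    + Cstab * sqrt c1 * (2 * \<kappa>) * (sqrt c2 * Crel) * eta P H H (disc_u P H)"
proof -
  let ?u = "sol_u P" and ?uH = "disc_u P H"
  let ?zu = "disc_z P H ?u" and ?zuH = "disc_z P H ?uH"
  define y where "y = (\<lambda>x. ?zuH x - ?zu x)"
  define w where "w = (\<lambda>x. ?u x - ?uH x)"
  have uH: "?uH \<in> H10 \<Omega>" by (rule disc_u_H10[OF H])
  have z: "?zu \<in> X H" "?zuH \<in> X H" using discrete(3)[OF H exact(1)] discrete(3)[OF H uH] .
  have z': "?zu \<in> H10 \<Omega>" "?zuH \<in> H10 \<Omega>" using z X_memD by auto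
  have y: "y \<in> H10 \<Omega>" and w: "w \<in> H10 \<Omega>" unfolding y_def w_def using z' uH exact(1) by (auto intro: prim.diff_mem)
  have K_diff: "K (\<lambda>x. v x - v' x) v'' = K v v'' - K v' v''" "K v'' (\<lambda>x. v x - v' x) = K v'' v - K v'' v'"
    if "v \<in> H10 \<Omega>" "v' \<in> H10 \<Omega>" "v'' \<in> H10 \<Omega>" for v v' v''
    using compact_operator_linear(1,2)[OF K that(1) prim.scale_mem[OF that(2), of "-1"] that(3)]
      compact_operator_linear(3,4)[OF K that(2) that(2) that(3), of "-1"] by simp_all
  have "a y y = (a ?zuH ?zuH - a ?zuH ?zu) - (a ?zu ?zuH - a ?zu ?zu)"
    unfolding y_def using z' by (simp add: prim.diff_left prim.diff_right prim.diff_mem)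
  also have "\<dots> = - (K y w + K w y)"
    unfolding discrete(4)[OF H uH z(2)] discrete(4)[OF H uH z(1)] discrete(4)[OF H exact(1) z(1)] discrete(4)[OF H exact(1) z(2)]
    unfolding y_def w_def using z' uH exact(1) by (simp add: K_diff prim.diff_mem)
  finally have "nrm y * nrm y \<le> (2 * \<kappa> * nrm w) * nrm y"
    using K_le[OF y w] K_le[OF w y] nrm_power2[OF y] by (simp add: power2_eq_square mult_ac)
  then have "nrm y \<le> 2 * \<kappa> * nrm w"
    using nrm_nonneg[OF y] nrm_nonneg[OF w] \<kappa> by (cases "nrm y = 0") (auto simp: mult_le_cancel_right)
  also have "\<dots> \<le> 2 * \<kappa> * (sqrt c2 * Crel * eta P H H ?uH)"
    using est_u.reliability[OF H] \<kappa> unfolding w_def nrm_def eta_def by (intro mult_left_mono) auto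
  finally have "Cstab * sqrt c1 * nrm y \<le> Cstab * sqrt c1 * (2 * \<kappa> * (sqrt c2 * Crel * eta P H H ?uH))"
    using const_bounds c1 by (intro mult_left_mono) auto
  moreover have "\<bar>zeta P H H ?zuH - zeta P H H ?zu\<bar> \<le> Cstab * sqrt c1 * nrm y"
    using est_z.stability[OF H mesh_self z(2,1), of H] unfolding y_def nrm_def zeta_def by simp
  ultimately show ?thesis by (simp add: mult_ac)
qed

definition Cmon :: real where "Cmon = 1 + Cstab * sqrt c1 * M * (sqrt c2 * Crel)"
text \<open>The 4 consists of the two slack factors 2 from the approximation norms; the bracket is
  the dual perturbation combined with quasi-monotonicity.\<close>

definition Cov :: real where
  "Cov = 4 * Cmon * ((1 + Cstab * sqrt c1 * (2 * \<kappa>) * (sqrt c2 * Crel)) * Cmon + Cmon)"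

lemma Cmon_pos: "0 < Cmon" unfolding Cmon_def using const_bounds c1 c2 M by (simp add: add_pos_nonneg)

lemma Cov_pos: "0 < Cov"
  unfolding Cov_def using Cmon_pos const_bounds c1 c2 \<kappa> by (intro mult_pos_pos add_nonneg_pos) auto

text \<open>\<open>h\<close> is the overlay of \<open>H\<close> with near-best meshes for the primal
  and the dual solution. Each of these adds at most \<open>N\<close> elements, and
  quasi-monotonicity carries their estimator bounds over to \<open>h\<close>.\<close>

lemma overlay_mesh:
  assumes H: "H \<in> meshes P" and au: "approx_u P s = ennreal Us" and az: "approx_z P t = ennreal Zt"
    and pos: "0 < Us" "0 \<le> Zt" and st: "0 < s" "0 < t"
  shows "\<exists>h\<in>R H. card (H - h) \<le> 2 * N \<and>
    estimator_product P h \<le> Cov * (Us * (Us + Zt)) * (real N + 1) powr (- min (2 * s) (s + t))"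
proof -
  define b where "b = (real N + 1) powr (- s)"
  define b' where "b' = (real N + 1) powr (- t)"
  \<comment> \<open>The combined estimator decays with the worse of the two rates, the other factor
    of the product with rate \<open>s\<close>; the total exponent is
    \<open>s + min s t\<close>.\<close>
  define m where "m = (real N + 1) powr (- min s t)"
  have bm: "0 < b" "0 < b'" "0 < m" "b \<le> m" "b' \<le> m" unfolding b_def b'_def m_def by (auto intro!: powr_mono)
  have bm_eq: "b * m = (real N + 1) powr (- min (2 * s) (s + t))"
    unfolding b_def m_def by (simp add: powr_add[symmetric] min_def)
  obtain T1 where T1: "T1 \<in> meshes P" "card T1 - card (mesh0 P) \<le> N" "eta P T1 T1 (disc_u P T1) \<le> 2 * Us * b"
    using approx_le(1)[OF approx_u_def au, of "2 * Us" N] pos unfolding b_def by auto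
  \<comment> \<open>\<open>Us + Zt\<close> replaces \<open>Zt\<close> because \<open>Zt\<close> may
    be zero, while \<open>approx_le\<close> wants a strictly larger constant.\<close>
  obtain T2 where T2: "T2 \<in> meshes P" "card T2 - card (mesh0 P) \<le> N"
      "zeta P T2 T2 (disc_z P T2 (sol_u P)) \<le> 2 * (Us + Zt) * b'"
    using approx_le(1)[OF approx_z_def az, of "2 * (Us + Zt)" N] pos unfolding b'_def by auto
  obtain T' where T': "T' \<in> R T1" "T' \<in> R T2" "card T' + card (mesh0 P) \<le> card T1 + card T2"
    using mesh_overlay[OF T1(1) T2(1)] by auto
  have T'_mesh: "T' \<in> meshes P" using mesh_R[OF T1(1) T'(1)] .
  obtain h where h: "h \<in> R H" "h \<in> R T'" "card h + card (mesh0 P) \<le> card H + card T'"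
    using mesh_overlay[OF H T'_mesh] by auto
  have h_mesh: "h \<in> meshes P" using mesh_R[OF H h(1)] .
  have hT: "h \<in> R T1" "h \<in> R T2" using refinements_trans[OF T'(1) h(2)] refinements_trans[OF T'(2) h(2)] .
  have "card (H - h) \<le> 2 * N"
    using mesh_card[OF H h(1)] T1(2) T2(2) T'(3) h(3) mesh0_card[OF T1(1)] mesh0_card[OF T2(1)] by linarith
  moreover have "estimator_product P h \<le> Cov * (Us * (Us + Zt)) * (b * m)"
  proof -
    let ?e = "eta P h h (disc_u P h)" and ?z = "zeta P h h (disc_z P h (sol_u P))"
      and ?z' = "zeta P h h (disc_z P h (disc_u P h))"
    let ?p = "1 + Cstab * sqrt c1 * (2 * \<kappa>) * (sqrt c2 * Crel)"
    have p0: "0 \<le> ?p" using const_bounds c1 c2 \<kappa> by (intro add_nonneg_nonneg) auto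
    have "?e \<le> Cmon * eta P T1 T1 (disc_u P T1)"
      using est_u.quasi_monotone[OF T1(1) hT(1)] unfolding est_u_eq Cmon_def by simp
    also have "\<dots> \<le> Cmon * (2 * Us * b)" using T1(3) Cmon_pos by (intro mult_left_mono) auto
    finally have e: "?e \<le> Cmon * (2 * Us * b)" .
    have "?z \<le> Cmon * zeta P T2 T2 (disc_z P T2 (sol_u P))"
      using est_z.quasi_monotone[OF T2(1) hT(2)] unfolding est_z.est2_def zeta_def Cmon_def by simp
    also have "\<dots> \<le> Cmon * (2 * (Us + Zt) * b')" using T2(3) Cmon_pos by (intro mult_left_mono) auto
    also have "\<dots> \<le> Cmon * (2 * (Us + Zt) * m)" using bm pos Cmon_pos by (intro mult_left_mono) auto
    finally have z: "?z \<le> Cmon * (2 * (Us + Zt) * m)" .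
    have "?e \<le> Cmon * (2 * (Us + Zt) * m)"
      using e bm pos Cmon_pos by (elim order_trans) (intro mult_left_mono mult_mono, auto)
    then have pe: "?p * ?e \<le> ?p * (Cmon * (2 * (Us + Zt) * m))" using p0 by (rule mult_left_mono)
    have "eta_zeta P h h (disc_u P h) (disc_z P h (disc_u P h)) \<le> ?e + ?z'"
      unfolding eta_zeta_def by (intro sqrt_sum_squares_le_sum) (auto simp: eta_nonneg zeta_nonneg)
    also have "\<dots> \<le> ?p * ?e + ?z" using dual_perturbation[OF h_mesh] by (simp add: algebra_simps)
    also have "\<dots> \<le> ?p * (Cmon * (2 * (Us + Zt) * m)) + Cmon * (2 * (Us + Zt) * m)" using pe z by (rule add_mono)
    also have "\<dots> = (?p * Cmon + Cmon) * (2 * (Us + Zt) * m)" by (simp add: algebra_simps)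
    finally have ez: "eta_zeta P h h (disc_u P h) (disc_z P h (disc_u P h)) \<le> (?p * Cmon + Cmon) * (2 * (Us + Zt) * m)" .
    have "estimator_product P h = ?e * eta_zeta P h h (disc_u P h) (disc_z P h (disc_u P h))"
      by (simp add: product_eq est_u_eq est_uz_eq)
    also have "\<dots> \<le> (Cmon * (2 * Us * b)) * ((?p * Cmon + Cmon) * (2 * (Us + Zt) * m))"
      using e ez bm pos Cmon_pos by (intro mult_mono) (auto simp: eta_nonneg eta_zeta_def)
    also have "\<dots> = Cov * (Us * (Us + Zt)) * (b * m)" unfolding Cov_def by (simp add: algebra_simps)
    finally show ?thesis .
  qed
  ultimately show ?thesis using h(1) unfolding bm_eq by blast
qed

text \<open>If the product drops by \<open>k\<^sup>2\<close>, at least one of its two factors drops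
  by \<open>k\<close>, and this is the reduction required by \<open>optimality_of_doerfler\<close>
  for that factor.\<close>

lemma doerfler_of_overlay:
  assumes H: "H \<in> meshes P" and h: "h \<in> R H" and \<theta>: "0 < \<theta>" "\<theta> < 1"
    and k: "k = sqrt (1 - \<theta>) - Cstab * Cdrel * sqrt \<theta>" "0 < k"
    and small: "estimator_product P h \<le> k\<^sup>2 * estimator_product P H"
  shows "doerfler_u \<theta> H (H - h) \<or> doerfler_uz \<theta> H (H - h)"
proof -
  have L: "0 \<le> Cstab * Cdrel" using const_bounds by simp
  have h_mesh: "h \<in> meshes P" using mesh_R[OF H h] .
  have hX: "disc_u P h \<in> X h" "disc_u P H \<in> X H" "disc_z P h (disc_u P h) \<in> X h" "disc_z P H (disc_u P H) \<in> X H"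
    using discrete(1,3)[OF h_mesh] discrete(1,3)[OF H] disc_u_H10[OF H] disc_u_H10[OF h_mesh] by auto
  have "sqrt (est_u.est2 h) \<le> k * sqrt (est_u.est2 H) \<or> sqrt (est_uz.est2 h) \<le> k * sqrt (est_uz.est2 H)"
  proof (rule ccontr)
    assume "\<not> ?thesis"
    then have "(k * sqrt (est_u.est2 H)) * (k * sqrt (est_uz.est2 H)) < sqrt (est_u.est2 h) * sqrt (est_uz.est2 h)"
      using k(2) by (intro mult_strict_mono') (auto simp: est_u.est2_nonneg est_uz.est2_nonneg)
    then show False using small by (simp add: product_eq power2_eq_square mult_ac)
  qed
  then show ?thesis
  proof
    assume *: "sqrt (est_u.est2 h) \<le> k * sqrt (est_u.est2 H)"
    have "\<bar>eta P h (h \<inter> H) (disc_u P h) - eta P H (h \<inter> H) (disc_u P H)\<bar> \<le> Cstab * d (disc_u P h) (disc_u P H)"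
      using est_ax(1)[OF H h, rule_format, OF hX(1,2) order_refl] by linarith
    also have "\<dots> \<le> Cstab * (Cdrel * eta P H (H - h) (disc_u P H))"
      using est_ax(5)[OF H h] const_bounds by (intro mult_left_mono) auto
    finally have "doerfler_u \<theta> H (H - h)"
      unfolding doerfler_u_def using * \<theta> L k
      by (intro est_u.optimality_of_doerfler[OF H h, where L = "Cstab * Cdrel"]) (auto simp: eta_def mult.assoc)
    then show ?thesis ..
  next
    assume *: "sqrt (est_uz.est2 h) \<le> k * sqrt (est_uz.est2 H)"
    have "\<bar>eta_zeta P h (h \<inter> H) (disc_u P h) (disc_z P h (disc_u P h)) - eta_zeta P H (h \<inter> H) (disc_u P H) (disc_z P H (disc_u P H))\<bar>
        \<le> Cstab * (d (disc_u P h) (disc_u P H) + d (disc_z P h (disc_u P h)) (disc_z P H (disc_u P H)))"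
      using est_ax(6)[OF H h, rule_format, OF hX(1,3,2,4) order_refl] .
    also have "\<dots> \<le> Cstab * (Cdrel * eta_zeta P H (H - h) (disc_u P H) (disc_z P H (disc_u P H)))"
      using est_ax(8)[OF H h] const_bounds by (intro mult_left_mono) auto
    finally have "doerfler_uz \<theta> H (H - h)"
      unfolding doerfler_uz_def using * \<theta> L k
      by (intro est_uz.optimality_of_doerfler[OF H h, where L = "Cstab * Cdrel"])
         (auto simp: sqrt_sum_ind2 UH2_def mult.assoc)
    then show ?thesis ..
  qed
qed

end

context adaptive
begin

text \<open>Each marked set is compared with the elements refined on the way to an overlay mesh
  whose product is \<open>k\<^sup>2\<close> times smaller. Summing these counts against linear
  convergence gives the rate.\<close>

lemma optimal_convergence:
  fixes \<theta> Cmark :: real and \<T> :: "nat \<Rightarrow> 'n mesh"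
  assumes \<theta>: "0 < \<theta>" "\<theta> \<le> 1" and Cmark: "1 \<le> Cmark" and alg: "algorithm_A P \<theta> Cmark \<T>"
    and \<theta>opt: "\<theta> < 1 / (1 + Cstab\<^sup>2 * Cdrel\<^sup>2)"
    and lin: "\<And>l n. l \<le> n \<Longrightarrow> estimator_product P (\<T> n) \<le> Clin * q ^ (n - l) * estimator_product P (\<T> l)"
    and q: "0 < q" "q < 1" and Clin: "0 < Clin"
    and st: "0 < s" "s \<le> smax" "0 < t" and fin: "approx_u P s + approx_z P t < \<infinity>" and l: "1 \<le> l"
    and k: "k = sqrt (1 - \<theta>) - Cstab * Cdrel * sqrt \<theta>"
    and Copt: "(max 1 (Cmesh * (4 * Cmark)) / (1 - q powr (1 / (2 * smax)))) powr (2 * smax) * Clin * (Cov / k\<^sup>2) \<le> Copt"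
  shows "ennreal (estimator_product P (\<T> l)) \<le> ennreal Copt * approx_u P s * (approx_u P s + approx_z P t) *
           ennreal ((real (card (\<T> l)) - real (card (mesh0 P))) powr (- min (2 * s) (s + t)))"
proof (cases "estimator_product P (\<T> l) = 0")
  case True
  then show ?thesis by simp
next
  case False
  define p where "p j = estimator_product P (\<T> j)" for j
  define \<alpha> where "\<alpha> = min (2 * s) (s + t)"
  have \<alpha>: "0 < \<alpha>" "\<alpha> \<le> 2 * smax" unfolding \<alpha>_def using st by auto
  note mesh = algorithm_mesh[OF \<theta> Cmark alg]
  have p: "0 \<le> p j" for j unfolding p_def by (rule product_nonneg)
  have pl: "0 < p l" using False p[of l] unfolding p_def by simp
  have p0: "0 < p 0"
  proof (rule ccontr)
    assume "\<not> 0 < p 0"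
    then have "p 0 = 0" using p[of 0] by simp
    then show False using lin[of 0 l] pl unfolding p_def by simp
  qed
  have "approx_u P s < \<infinity>" "approx_z P t < \<infinity>" using fin by (auto simp: less_top ennreal_add_eq_top)
  then obtain Us Zt where UZ: "0 \<le> Us" "approx_u P s = ennreal Us" "0 \<le> Zt" "approx_z P t = ennreal Zt"
    by (metis ennreal_cases infinity_ennreal_def less_irrefl)
  \<comment> \<open>If the approximation norm were zero, the primal estimator and hence the product
    would vanish on the initial mesh already.\<close>
  have Us: "0 < Us"
  proof (rule ccontr)
    assume "\<not> 0 < Us"
    then have "eta P (mesh0 P) (mesh0 P) (disc_u P (mesh0 P)) \<le> 0"
      using approx_le(2)[OF approx_u_def UZ(2) UZ(1)] UZ(1) by simp
    then have "eta P (mesh0 P) (mesh0 P) (disc_u P (mesh0 P)) = 0" using eta_nonneg by (intro antisym)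
    then have "p 0 = 0"
      unfolding p_def product_eq est_u_eq algorithm_start[OF \<theta> Cmark alg] by simp
    then show False using p0 by simp
  qed
  define Q where "Q = Us * (Us + Zt)"
  have Q: "0 < Q" unfolding Q_def using Us UZ by simp
  have den: "0 < 1 + Cstab\<^sup>2 * Cdrel\<^sup>2" by (simp add: add_pos_nonneg)
  have \<theta>L: "\<theta> * (1 + Cstab\<^sup>2 * Cdrel\<^sup>2) < 1" using \<theta>opt den by (simp add: field_simps)
  have \<theta>1: "\<theta> < 1"
  proof -
    have "\<theta> * 1 \<le> \<theta> * (1 + Cstab\<^sup>2 * Cdrel\<^sup>2)" using \<theta> by (intro mult_left_mono) auto
    then show ?thesis using \<theta>L by simp
  qed
  \<comment> \<open>This is where the threshold on \<open>\<theta>\<close> enters: it says that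
    \<open>(Cstab * Cdrel)\<^sup>2 * \<theta>\<close> is below \<open>1 - \<theta>\<close>.\<close>
  have k0: "0 < k"
  proof -
    have "(Cstab * Cdrel * sqrt \<theta>)\<^sup>2 < 1 - \<theta>" using \<theta>L \<theta> by (simp add: power_mult_distrib algebra_simps)
    then have "Cstab * Cdrel * sqrt \<theta> < sqrt (1 - \<theta>)" by (rule real_less_rsqrt)
    then show ?thesis unfolding k by simp
  qed
  define D where "D = Cov * Q / k\<^sup>2"
  have D: "0 < D" unfolding D_def using Cov_pos Q k0 by simp
  have "\<forall>j. \<exists>\<M>. \<M> \<subseteq> \<T> j \<and> \<T> (Suc j) = mesh_refine P (\<T> j) \<M> \<and>
    (doerfler_u \<theta> (\<T> j) \<M> \<or> doerfler_uz \<theta> (\<T> j) \<M>) \<and>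
    (\<forall>S. S \<subseteq> \<T> j \<longrightarrow> doerfler_u \<theta> (\<T> j) S \<or> doerfler_uz \<theta> (\<T> j) S \<longrightarrow> real (card \<M>) \<le> 2 * Cmark * real (card S))"
    using algorithm_step[OF \<theta> Cmark alg mesh_finite[OF mesh]] by blast
  then obtain \<M> where \<M>: "\<And>j. \<M> j \<subseteq> \<T> j" "\<And>j. \<T> (Suc j) = mesh_refine P (\<T> j) (\<M> j)"
    "\<And>j. doerfler_u \<theta> (\<T> j) (\<M> j) \<or> doerfler_uz \<theta> (\<T> j) (\<M> j)"
    "\<And>j S. S \<subseteq> \<T> j \<Longrightarrow> doerfler_u \<theta> (\<T> j) S \<or> doerfler_uz \<theta> (\<T> j) S \<Longrightarrow> real (card (\<M> j)) \<le> 2 * Cmark * real (card S)"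
    by metis
  have m: "real (card (\<M> j)) \<le> (4 * Cmark) * (D / p j) powr (1 / \<alpha>)" if pj: "0 < p j" for j
  proof -
    \<comment> \<open>\<open>N + 1\<close> is large enough for the overlay to reach
      \<open>k\<^sup>2 * p j\<close>, while the at most \<open>2 * N\<close> refined elements stay
      below twice the wanted count.\<close>
    define N where "N = nat \<lfloor>(D / p j) powr (1 / \<alpha>)\<rfloor>"
    have "0 \<le> (D / p j) powr (1 / \<alpha>)" by simp
    then have N: "real N \<le> (D / p j) powr (1 / \<alpha>)" "(D / p j) powr (1 / \<alpha>) \<le> real N + 1"
      unfolding N_def by (simp_all add: of_nat_floor)
    have "((D / p j) powr (1 / \<alpha>)) powr \<alpha> \<le> (real N + 1) powr \<alpha>" using N(2) \<alpha> by (intro powr_mono2) auto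
    then have "D / p j \<le> (real N + 1) powr \<alpha>" using \<alpha> D pj by (simp add: powr_powr)
    then have "D * (real N + 1) powr (- \<alpha>) \<le> p j" using pj by (simp add: powr_minus field_simps)
    then have "k\<^sup>2 * (D * (real N + 1) powr (- \<alpha>)) \<le> k\<^sup>2 * p j" by (rule mult_left_mono) simp
    then have small: "Cov * Q * (real N + 1) powr (- \<alpha>) \<le> k\<^sup>2 * p j" using k0 by (simp add: D_def)
    obtain h where h: "h \<in> R (\<T> j)" "card (\<T> j - h) \<le> 2 * N"
        "estimator_product P h \<le> Cov * Q * (real N + 1) powr (- \<alpha>)"
      using overlay_mesh[OF mesh UZ(2,4) Us UZ(3) st(1,3), of j N] unfolding Q_def \<alpha>_def by blast
    have "doerfler_u \<theta> (\<T> j) (\<T> j - h) \<or> doerfler_uz \<theta> (\<T> j) (\<T> j - h)"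
      using h(3) small unfolding p_def by (intro doerfler_of_overlay[OF mesh h(1) \<theta>(1) \<theta>1 k k0]) linarith
    then have "real (card (\<M> j)) \<le> 2 * Cmark * real (card (\<T> j - h))" by (intro \<M>(4)) auto
    also have "\<dots> \<le> 2 * Cmark * (2 * (D / p j) powr (1 / \<alpha>))" using h(2) N(1) Cmark by (intro mult_left_mono) linarith+
    finally show ?thesis by simp
  qed
  have Cmesh: "0 < Cmesh" and count: "real (card (\<T> l)) - real (card (mesh0 P)) \<le> Cmesh * (\<Sum>j<l. real (card (\<M> j)))"
  proof -
    have start: "\<T> 0 = mesh0 P \<and> (\<forall>j. \<M> j \<subseteq> \<T> j \<and> \<T> (Suc j) = mesh_refine P (\<T> j) (\<M> j))"
      using algorithm_start[OF \<theta> Cmark alg] \<M>(1,2) by blast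
    show "0 < Cmesh" using ref_assms by (simp add: refinement_assumptions_def)
    show "real (card (\<T> l)) - real (card (mesh0 P)) \<le> Cmesh * (\<Sum>j<l. real (card (\<M> j)))"
      using ref_assms[unfolded refinement_assumptions_def, THEN conjunct2, THEN conjunct2, THEN conjunct1] start by blast
  qed
  define N where "N = real (card (\<T> l)) - real (card (mesh0 P))"
  \<comment> \<open>Both estimators are nonzero on the initial mesh, so the first step marks an
    element; \<open>l \<ge> 1\<close> includes this step, and the power of \<open>N\<close> can be
    moved to the other side.\<close>
  have N: "0 < N"
  proof -
    have "\<M> 0 \<noteq> {}"
    proof
      assume "\<M> 0 = {}"
      then have "\<theta> * est_u.est2 (\<T> 0) \<le> 0 \<or> \<theta> * est_uz.est2 (\<T> 0) \<le> 0"
        using \<M>(3)[of 0] by (simp add: doerfler_u_def doerfler_uz_def)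
      then have "est_u.est2 (\<T> 0) = 0 \<or> est_uz.est2 (\<T> 0) = 0"
        using \<theta>(1) est_u.est2_nonneg[of "\<T> 0"] est_uz.est2_nonneg[of "\<T> 0"] by (auto simp: mult_le_0_iff)
      then show False using p0 by (auto simp: p_def product_eq)
    qed
    moreover have "\<M> 0 \<subseteq> \<T> 0 - \<T> (Suc 0)"
      using refinement_strategy_step(3)[OF strat mesh[unfolded meshes_def] \<M>(1), of 0] \<M>(2)[of 0] by simp
    ultimately have "0 < card (\<T> 0 - \<T> (Suc 0))" using mesh_finite[OF mesh[of 0]] by (subst card_gt_0_iff) auto
    then have "card (\<T> 0) < card (\<T> (Suc 0))"
      using mesh_card[OF mesh algorithm_next[OF \<theta> Cmark alg, of 0]] by simp
    also have "\<dots> \<le> card (\<T> l)"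
      using mesh_card[OF mesh algorithm_R[OF \<theta> Cmark alg, of "Suc 0" l]] l by simp
    finally show ?thesis unfolding N_def algorithm_start[OF \<theta> Cmark alg] by simp
  qed
  have "p l * N powr \<alpha> \<le> (max 1 (Cmesh * (4 * Cmark)) / (1 - q powr (1 / (2 * smax)))) powr (2 * smax) * Clin * D"
    using lin q Clin \<alpha> D Cmark Cmesh N count m p pl unfolding p_def N_def
    by (intro optimal_rate_of_counting[where m = "\<lambda>j. real (card (\<M> j))"]) auto
  also have "\<dots> = (max 1 (Cmesh * (4 * Cmark)) / (1 - q powr (1 / (2 * smax)))) powr (2 * smax) * Clin * (Cov / k\<^sup>2) * Q"
    by (simp add: D_def)
  also have "\<dots> \<le> Copt * Q" using Copt Q by (intro mult_right_mono) auto
  finally have main: "p l \<le> Copt * Q * N powr (- \<alpha>)" using N by (simp add: powr_minus field_simps)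
  have "0 \<le> Copt"
  proof (rule ccontr)
    assume "\<not> 0 \<le> Copt"
    then have "Copt * Q * N powr (- \<alpha>) \<le> 0" using Q by (simp add: mult_nonpos_nonneg)
    then show False using main pl by linarith
  qed
  then have "ennreal (Copt * Q * N powr (- \<alpha>)) = ennreal Copt * approx_u P s * (approx_u P s + approx_z P t) * ennreal (N powr (- \<alpha>))"
    unfolding UZ(2,4) Q_def using UZ(1,3) by (simp add: ennreal_mult mult_ac)
  then show ?thesis using ennreal_leI[OF main] unfolding p_def N_def \<alpha>_def by simp
qed

end

context goal_problem
begin

lemma linear_rates_exist:
  assumes "0 < \<theta>" "\<theta> \<le> 1" "0 < qred" "qred < 1" "0 < Cstab" "0 < Crel"
  shows "\<exists>C r. linear_rate M (Cstab * sqrt c1) (sqrt c2 * Crel) qred \<theta> C r"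
    "\<exists>C r. linear_rate (2 * M2) (2 * sqrt c1 * Cstab) (sqrt (M2 * c2) * Crel) qred \<theta> C r"
proof -
  show "\<exists>C r. linear_rate M (Cstab * sqrt c1) (sqrt c2 * Crel) qred \<theta> C r"
    using assms M c1 c2 prim.rho_bounds by (intro linear_rate_exists) auto
  show "\<exists>C r. linear_rate (2 * M2) (2 * sqrt c1 * Cstab) (sqrt (M2 * c2) * Crel) qred \<theta> C r"
    using assms M2_nonneg c1 c2 pair.rho_bounds by (intro linear_rate_exists) auto
qed

end

text \<open>The order of quantifiers expresses on what each constant depends. \<open>smax\<close> is
  present because the counting constants are raised to the power \<open>\<alpha>\<close>; as
  \<open>\<alpha> \<le> 2 * s\<close>, bounding \<open>s\<close> makes them uniform.\<close>

theorem theorem2: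
  fixes \<Omega> :: "(real ^ 'n) set"
    and A :: "real ^ 'n \<Rightarrow> real ^ 'n ^ 'n"
    and b :: "real ^ 'n \<Rightarrow> real ^ 'n"
    and c :: "real ^ 'n \<Rightarrow> real"
    and K :: "(real ^ 'n \<Rightarrow> real) \<Rightarrow> (real ^ 'n \<Rightarrow> real) \<Rightarrow> real"
  assumes "model_problem \<Omega> A b c"
    and "compact_linear_operator \<Omega> K"
  shows "\<forall>\<theta> qred Cstab Crel :: real.
    0 < \<theta> \<and> \<theta> \<le> 1 \<and> 0 < qred \<and> qred < 1 \<and> 0 < Cstab \<and> 0 < Crel \<longrightarrow>
    (\<exists>(l0::nat) Clin qlin. 0 < Clin \<and> 0 < qlin \<and> qlin < 1 \<and>
      (\<forall>Cmark Cmesh Cdrel P \<T>.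
        1 \<le> Cmark \<and> admissible \<Omega> A b c K Cmesh qred Cstab Crel Cdrel P \<and> algorithm_A P \<theta> Cmark \<T> \<longrightarrow>
        (\<forall>l n. l0 \<le> l \<and> l \<le> n \<longrightarrow>
           estimator_product P (\<T> n) \<le> Clin * qlin ^ (n - l) * estimator_product P (\<T> l))) \<and>
      (\<forall>Cmark Cmesh Cdrel smax. 1 \<le> Cmark \<and> \<theta> < 1 / (1 + Cstab\<^sup>2 * Cdrel\<^sup>2) \<longrightarrow>
        (\<exists>Copt>0. \<forall>P \<T>.
          admissible \<Omega> A b c K Cmesh qred Cstab Crel Cdrel P \<and> algorithm_A P \<theta> Cmark \<T> \<longrightarrow>
          (\<forall>s t. 0 < s \<and> s \<le> smax \<and> 0 < t \<and> approx_u P s + approx_z P t < \<infinity> \<longrightarrow>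
            (\<forall>l\<ge>l0. ennreal (estimator_product P (\<T> l))
               \<le> ennreal Copt * approx_u P s * (approx_u P s + approx_z P t) *
                 ennreal ((real (card (\<T> l)) - real (card (mesh0 P))) powr (- min (2 * s) (s + t))))))))"
proof (intro allI impI, goal_cases)
  case (1 \<theta> qred Cstab Crel)
  then have \<theta>: "0 < \<theta>" "\<theta> \<le> 1" and const: "0 < qred" "qred < 1" "0 < Cstab" "0 < Crel" by auto
  interpret model \<Omega> A b c by unfold_locales (rule assms(1))
  obtain M where M: "0 \<le> M" "bounded_form (H10 \<Omega>) (a_form \<Omega> A b c) M" using a_bounded_form by blast
  obtain \<kappa> where \<kappa>: "0 \<le> \<kappa>"
      "\<And>v w. v \<in> H10 \<Omega> \<Longrightarrow> w \<in> H10 \<Omega> \<Longrightarrow> (K v w)\<^sup>2 \<le> \<kappa>\<^sup>2 * a_form \<Omega> A b c v v * a_form \<Omega> A b c w w"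
    using compact_operator_form_bounded[OF assms(2)] by blast
  obtain c1 c2 where c12: "0 < c1" "\<And>v. v \<in> H10 \<Omega> \<Longrightarrow> (energy_norm \<Omega> A v)\<^sup>2 \<le> c1 * a_form \<Omega> A b c v v"
      "0 < c2" "\<And>v. v \<in> H10 \<Omega> \<Longrightarrow> a_form \<Omega> A b c v v \<le> c2 * (energy_norm \<Omega> A v)\<^sup>2"
    using energy_equivalent by blast
  interpret goal_problem \<Omega> A b c K M \<kappa> c1 c2
    by (intro goal_problem.intro goal_problem_axioms.intro model_axioms assms(2) M \<kappa> c12)
  obtain C r C' r' where rate: "linear_rate M (Cstab * sqrt c1) (sqrt c2 * Crel) qred \<theta> C r"
      and rate2: "linear_rate (2 * M2) (2 * sqrt c1 * Cstab) (sqrt (M2 * c2) * Crel) qred \<theta> C' r'"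
    using linear_rates_exist[OF \<theta> const] by blast
  define D where "D = C * (1 + (Cstab * sqrt c1) * M * (sqrt c2 * Crel))\<^sup>2"
  define D' where "D' = C' * (1 + (2 * sqrt c1 * Cstab) * (2 * M2) * (sqrt (M2 * c2) * Crel))\<^sup>2"
  define Clin where "Clin = sqrt (D * D')"
  define qlin where "qlin = sqrt (max r r')"
  have r: "1 \<le> C" "1 \<le> C'" "0 < r" "r < 1" "0 < r'" "r' < 1" using rate rate2 by (auto simp: linear_rate_def)
  have "0 \<le> (Cstab * sqrt c1) * M * (sqrt c2 * Crel)" "0 \<le> (2 * sqrt c1 * Cstab) * (2 * M2) * (sqrt (M2 * c2) * Crel)"
    using const M c12 M2_nonneg by (auto intro!: mult_nonneg_nonneg)
  then have "0 < D" "0 < D'" unfolding D_def D'_def using r by (auto intro!: mult_pos_pos zero_less_power add_pos_nonneg)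
  then have Clin: "0 < Clin" unfolding Clin_def by simp
  have qlin: "0 < qlin" "qlin < 1" unfolding qlin_def using r by auto
  have lin: "estimator_product P (\<T> n) \<le> Clin * qlin ^ (n - l) * estimator_product P (\<T> l)"
    if adm: "admissible \<Omega> A b c K Cmesh qred Cstab Crel Cdrel P" and alg: "algorithm_A P \<theta> Cmark \<T>"
      and Cmark: "1 \<le> Cmark" and ln: "l \<le> n" for Cmark Cmesh Cdrel P \<T> l n
  proof -
    interpret adaptive \<Omega> A b c K M \<kappa> c1 c2 P Cmesh qred Cstab Crel Cdrel
      by (intro adaptive.intro adaptive_axioms.intro goal_problem_axioms adm)
    show ?thesis unfolding Clin_def qlin_def
      using product_linear_convergence[OF \<theta> Cmark alg rate rate2 D_def D'_def ln] .
  qed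
  have opt: "\<exists>Copt>0. \<forall>P \<T>.
          admissible \<Omega> A b c K Cmesh qred Cstab Crel Cdrel P \<and> algorithm_A P \<theta> Cmark \<T> \<longrightarrow>
          (\<forall>s t. 0 < s \<and> s \<le> smax \<and> 0 < t \<and> approx_u P s + approx_z P t < \<infinity> \<longrightarrow>
            (\<forall>l\<ge>1. ennreal (estimator_product P (\<T> l))
               \<le> ennreal Copt * approx_u P s * (approx_u P s + approx_z P t) *
                 ennreal ((real (card (\<T> l)) - real (card (mesh0 P))) powr (- min (2 * s) (s + t)))))"
    if Cmark: "1 \<le> Cmark" and \<theta>opt: "\<theta> < 1 / (1 + Cstab\<^sup>2 * Cdrel\<^sup>2)" for Cmark Cmesh Cdrel smax :: real
  proof -
    define k where "k = sqrt (1 - \<theta>) - Cstab * Cdrel * sqrt \<theta>"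
    \<comment> \<open>\<open>Copt\<close> precedes the choice of \<open>P\<close>, so the sign of
      \<open>Cmesh\<close> is still unknown and \<open>max 1\<close> secures positivity.
      \<open>adaptive.Cov\<close> takes only the form and estimator constants and can be named
      before the locale is interpreted.\<close>
    define Copt where "Copt = max 1 ((max 1 (Cmesh * (4 * Cmark)) / (1 - qlin powr (1 / (2 * smax)))) powr (2 * smax)
      * Clin * (adaptive.Cov M \<kappa> c1 c2 Cstab Crel / k\<^sup>2))"
    have "ennreal (estimator_product P (\<T> l)) \<le> ennreal Copt * approx_u P s * (approx_u P s + approx_z P t) *
        ennreal ((real (card (\<T> l)) - real (card (mesh0 P))) powr (- min (2 * s) (s + t)))"
      if adm: "admissible \<Omega> A b c K Cmesh qred Cstab Crel Cdrel P" and alg: "algorithm_A P \<theta> Cmark \<T>"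
        and st: "0 < s" "s \<le> smax" "0 < t" and fin: "approx_u P s + approx_z P t < \<infinity>" and l: "1 \<le> l" for P \<T> s t l
    proof -
      interpret adaptive \<Omega> A b c K M \<kappa> c1 c2 P Cmesh qred Cstab Crel Cdrel
        by (intro adaptive.intro adaptive_axioms.intro goal_problem_axioms adm)
      show ?thesis
        by (rule optimal_convergence[OF \<theta> Cmark alg \<theta>opt lin[OF adm alg Cmark] qlin Clin st fin l k_def])
           (auto simp: Copt_def)
    qed
    moreover have "0 < Copt" by (simp add: Copt_def)
    ultimately show ?thesis by blast
  qed
  show ?case
    \<comment> \<open>Part (i) holds from the start; part (ii) fails for \<open>l = 0\<close>, since \<open>0 powr x = 0\<close>.\<close>
    by (rule exI[of _ 1], rule exI[of _ Clin], rule exI[of _ qlin]) (use Clin qlin lin opt in auto)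
qed

end
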